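(* Let $\sigma_0:\mathbb R_+\to[0,\infty)$ satisfy $\sigma_0\in L^\infty_{\rm loc}(\mathbb R_+)$ and $$\sigma_0(\lambda)=O(\lambda^{-l_+})\ \text{ as }\lambda\to0,\qquad \sigma_0(\lambda)=O(\lambda^{l_-})\ \text{ as }\lambda\to\infty,$$ where $l_+<1$ and $l_-$ may be arbitrarily large, let $s_0(x)=\sigma_0(e^{-x})$, and let $H_0$ be the self-adjoint nonnegative Hankel operator defined by the corresponding quadratic form. Let $V$ be the self-adjoint Hankel operator of finite rank with kernel $$v(t)=\sum_{m=1}^M P_m(t)e^{-\beta_m t},\qquad v(t)=\overline{v(t)},$$ where the $\beta_m$ are pairwise distinct, $\operatorname{Re}\beta_m>0$, and $P_m$ are polynomials (not identically zero) of degree $K_m$. Let the terms be enumerated so that $M=M_0+2M_1$, $\operatorname{Im}\beta_m=0$ and $P_m(t)=\overline{P_m(t)}$ for $m=1,\dots,M_0$, and $\operatorname{Im}\beta_m>0$, $\beta_{M_1+m}=\overline{\beta_m}$, $P_{M_1+m}(t)=\overline{P_m(t)}$ for $m=M_0+1,\dots,M_0+M_1$ (the cases $M_0=0$ or $M_1=0$ are not excluded). For $m=1,\dots,M_0$ let $\mathsf p_m=P_m^{(K_m)}$ and $$\mathcal N_m=\begin{cases}(K_m+1)/2 & \text{if }K_m\text{ is odd},\\ K_m/2 &\text{if }K_m\text{ is even and }\mathsf p_m>0,\\ K_m/2+1&\text{if }K_m\text{ is even and }\mathsf p_m<0.\end{cases}$$ Then the total number $N_-(H)$ of (strictly) negative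 eigenvalues of the operator $H=H_0+V$ is given by $$N_-(H)=\sum_{m=1}^{M_0}\mathcal N_m+\sum_{m=M_0+1}^{M_0+M_1}K_m+M_1.$$
   Context: $\mathbb R_+=(0,\infty)$ and $(\mathsf L f)(\lambda)=\int_0^\infty e^{-t\lambda}f(t)\,dt$. $H_0$ is the self-adjoint operator in $L^2(\mathbb R_+)$ corresponding to the closed form $$h_0[f,f]=\int_0^\infty|(\mathsf L f)(\lambda)|^2\sigma_0(\lambda)\,d\lambda=\int_{-\infty}^\infty|u(x)|^2s_0(x)\,dx,\qquad u(x)=e^{-x/2}(\mathsf L f)(e^{-x}),$$ with domain $\mathcal D[h_0]$ the set of all $f\in L^2(\mathbb R_+)$ for which the integral is finite. $V$ acts by $(Vf)(t)=\int_0^\infty v(t+s)f(s)\,ds$. $H=H_0+V$ is the self-adjoint operator corresponding to the closed form $h_0[f,f]+(Vf,f)$ on $\mathcal D[h_0]$. $N_-(H)$ is the total number of negative eigenvalues counted with multiplicity. $P_m^{(K_m)}$ is the (constant) $K_m$-th derivative, i.e. $\mathsf p_m/K_m!$ is the coefficient of $t^{K_m}$ in $P_m$. *)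

theory Defs
  imports "HOL-Analysis.Analysis" "HOL-Library.Extended_Nat" "HOL-Library.Landau_Symbols"
    "HOL-Computational_Algebra.Polynomial"
begin

abbreviation Rplus :: "real measure" where
  "Rplus \<equiv> lebesgue_on {0<..}"

text \<open>Elements of \<open>L\<^sup>2(\<real>\<^sub>+)\<close> are represented by functions on \<open>\<real>\<close>; only the values on
  \<open>(0,\<infinity>)\<close> matter, and two representatives are the same vector iff they agree almost everywhere
  with respect to \<^const>\<open>Rplus\<close>.\<close>

definition L2_Rplus :: "(real \<Rightarrow> complex) set" where
  "L2_Rplus = {f \<in> borel_measurable Rplus. integrable Rplus (\<lambda>t. (cmod (f t))\<^sup>2)}"

definition inner_L2 :: "(real \<Rightarrow> complex) \<Rightarrow> (real \<Rightarrow> complex) \<Rightarrow> complex" where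
  "inner_L2 f g = (\<integral>t. f t * cnj (g t) \<partial>Rplus)"

definition Linf_loc_Rplus :: "(real \<Rightarrow> real) set" where
  "Linf_loc_Rplus = {\<sigma> \<in> borel_measurable Rplus.
     \<forall>K. compact K \<and> K \<subseteq> {0<..} \<longrightarrow> (\<exists>C. AE x in lebesgue_on K. \<bar>\<sigma> x\<bar> \<le> C)}"

definition laplace :: "(real \<Rightarrow> complex) \<Rightarrow> real \<Rightarrow> complex" where
  "laplace f l = (\<integral>t. of_real (exp (- t * l)) * f t \<partial>Rplus)"

definition hankel :: "(real \<Rightarrow> complex) \<Rightarrow> (real \<Rightarrow> complex) \<Rightarrow> real \<Rightarrow> complex" where
  "hankel v f t = (\<integral>s. v (t + s) * f s \<partial>Rplus)"

definition dom_h0 :: "(real \<Rightarrow> real) \<Rightarrow> (real \<Rightarrow> complex) set" where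
  "dom_h0 \<sigma> = {f \<in> L2_Rplus. integrable Rplus (\<lambda>l. (cmod (laplace f l))\<^sup>2 * \<sigma> l)}"

text \<open>The sesquilinear form whose diagonal is \<open>h\<^sub>0[f,f] = \<integral> |(L f)(\<lambda>)|\<^sup>2 \<sigma>(\<lambda>) d\<lambda>\<close>.\<close>

definition h0 :: "(real \<Rightarrow> real) \<Rightarrow> (real \<Rightarrow> complex) \<Rightarrow> (real \<Rightarrow> complex) \<Rightarrow> complex" where
  "h0 \<sigma> f g = (\<integral>l. laplace f l * cnj (laplace g l) * of_real (\<sigma> l) \<partial>Rplus)"

text \<open>The operator corresponding to a form \<open>h\<close> with domain \<open>D\<close>, as a graph: \<open>f\<close> is in the
  domain of the operator and is mapped to \<open>g\<close> iff \<open>f \<in> D\<close> and \<open>h[f,\<phi>] = (g,\<phi>)\<close> for all \<open>\<phi> \<in> D\<close>.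
  For a densely defined, closed, semibounded form this is the self-adjoint operator of the first
  representation theorem.\<close>

definition form_operator ::
  "(real \<Rightarrow> complex) set \<Rightarrow> ((real \<Rightarrow> complex) \<Rightarrow> (real \<Rightarrow> complex) \<Rightarrow> complex) \<Rightarrow>
   ((real \<Rightarrow> complex) \<times> (real \<Rightarrow> complex)) set" where
  "form_operator D h = {(f, g). f \<in> D \<and> g \<in> L2_Rplus \<and> (\<forall>\<phi>\<in>D. h f \<phi> = inner_L2 g \<phi>)}"

text \<open>\<open>H = H\<^sub>0 + V\<close>, defined through the form \<open>h\<^sub>0[f,f] + (V f, f)\<close> on the domain
  of \<open>h\<^sub>0\<close>.\<close>

definition perturbed_hankel ::
  "(real \<Rightarrow> real) \<Rightarrow> (real \<Rightarrow> complex) \<Rightarrow> ((real \<Rightarrow> complex) \<times> (real \<Rightarrow> complex)) set" where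
  "perturbed_hankel \<sigma> v =
     form_operator (dom_h0 \<sigma>) (\<lambda>f g. h0 \<sigma> f g + inner_L2 (hankel v f) g)"

definition eigenspace ::
  "((real \<Rightarrow> complex) \<times> (real \<Rightarrow> complex)) set \<Rightarrow> real \<Rightarrow> (real \<Rightarrow> complex) set" where
  "eigenspace T l = {f. (f, \<lambda>t. of_real l * f t) \<in> T}"

definition is_eigenvalue :: "((real \<Rightarrow> complex) \<times> (real \<Rightarrow> complex)) set \<Rightarrow> real \<Rightarrow> bool" where
  "is_eigenvalue T l \<longleftrightarrow> (\<exists>f \<in> eigenspace T l. \<not> (AE t in Rplus. f t = 0))"

definition lin_indep_ae :: "(real \<Rightarrow> complex) set \<Rightarrow> bool" where
  "lin_indep_ae S \<longleftrightarrow>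
     (\<forall>c. (AE t in Rplus. (\<Sum>f\<in>S. c f * f t) = 0) \<longrightarrow> (\<forall>f\<in>S. c f = 0))"

text \<open>Dimension of the eigenspace modulo almost everywhere equality, possibly \<open>\<infinity>\<close>.\<close>

definition multiplicity_of ::
  "((real \<Rightarrow> complex) \<times> (real \<Rightarrow> complex)) set \<Rightarrow> real \<Rightarrow> enat" where
  "multiplicity_of T l =
     (SUP S \<in> {S. finite S \<and> S \<subseteq> eigenspace T l \<and> lin_indep_ae S}. enat (card S))"

text \<open>The supremum of the finite partial sums is the possibly infinite sum of the multiplicities
  over all negative eigenvalues.\<close>

definition N_minus :: "((real \<Rightarrow> complex) \<times> (real \<Rightarrow> complex)) set \<Rightarrow> enat" where
  "N_minus T =
     (SUP F \<in> {F. finite F \<and> F \<subseteq> {l. l < 0 \<and> is_eigenvalue T l}}. \<Sum>l\<in>F. multiplicity_of T l)"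

text \<open>The \<open>K\<close>-th derivative of a polynomial of degree \<open>K\<close>, evaluated at \<open>0\<close>. It is a real number
  when the polynomial is real on the real line, which is the only case where it is used;
  it is then nonzero for \<open>p \<noteq> 0\<close>, so the last case of \<open>N_real\<close> is the negative one.\<close>

definition top_deriv :: "complex poly \<Rightarrow> real" where
  "top_deriv p = Re (poly ((pderiv ^^ degree p) p) 0)"

definition N_real :: "complex poly \<Rightarrow> nat" where
  "N_real p =
     (if odd (degree p) then (degree p + 1) div 2
      else if top_deriv p > 0 then degree p div 2
      else degree p div 2 + 1)"

end

theory Submission
  imports Defs "HOL-Library.Function_Algebras"
begin

text \<open>The reason behind the formula is that \<open>H\<close> has as many negative eigenvalues as \<open>V\<close> alone has: the
nonnegative summand \<open>H\<^sub>0\<close> cannot create negative directions, and it is unable to destroy them.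

In terms of the jets \<open>\<ell>\<^sub>m\<^sub>,\<^sub>a(f) = (1/a!) \<integral> t\<^sup>a exp (- \<beta>\<^sub>m t) f(t) dt\<close>, which up to sign are the Taylor
coefficients of the Laplace transform of \<open>f\<close> at \<open>\<beta>\<^sub>m\<close>, the form of \<open>V\<close> is
\<open>\<Sum>\<^sub>m \<Sum> q\<^sub>m(a + b) \<ell>\<^sub>m\<^sub>,\<^sub>b(f) cnj (\<ell>\<^sub>m\<^sub>*\<^sub>,\<^sub>a(g))\<close> over \<open>a + b \<le> K\<^sub>m\<close>, where \<open>q\<^sub>m(k)\<close> is the \<open>k\<close>-th derivative of
\<open>P\<^sub>m\<close> at \<open>0\<close> and \<open>m*\<close> is the index of the exponent conjugate to \<open>\<beta>\<^sub>m\<close> (lemma \<open>hankel_form\<close>). For a real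
exponent this is an anti-triangular \<open>(K + 1) \<times> (K + 1)\<close> Hankel block, whose inertia is that of its
antidiagonal with entries \<open>q\<^sub>m(K\<^sub>m)\<close>; a pair of conjugate exponents couples two spaces of dimension
\<open>K + 1\<close> and is nonzero only between them, which gives \<open>K + 1\<close> negative squares. The summands of the
claimed number are these counts, and they are realised by an explicit set \<open>J\<close> of jets.

Upper bound: if the jets in \<open>J\<close> of \<open>f\<close> vanish, then \<open>(V f, f) \<ge> 0\<close> and so \<open>h[f, f] \<ge> 0\<close>. More than
\<open>card J\<close> independent eigenvectors would have a nonzero combination with this property, but on the
span of eigenvectors with negative eigenvalues the form is negative
(lemma \<open>negative_eigenvectors_le_functionals\<close>).

Lower bound: a jet is not controlled by \<open>h\<^sub>0\<close>. Every jet vector is attained by some \<open>f\<close> with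
\<open>h\<^sub>0[f, f]\<close> as small as one likes (lemma \<open>every_jet_attainable\<close>), because there are polynomials in
\<open>w = 1 / (1 + \<lambda>)\<close> that equal \<open>1\<close> at one of the points \<open>1 / (1 + \<beta>\<^sub>m)\<close> and whose powers tend to \<open>0\<close>
almost everywhere on \<open>(0, 1)\<close>. After a rescaling of the jets that suppresses everything but the antidiagonals
one obtains a space of dimension \<open>card J\<close> on which \<open>h\<close> is negative. On a closed form with a compact
perturbation, minimising the Rayleigh quotient over the orthogonal complement of the eigenvectors
already found turns that space into as many orthonormal eigenvectors
(lemma \<open>eigenvectors_of_negative_subspace\<close>).\<close>

section \<open>Hermitian forms on complex vector spaces\<close>

lemma underdetermined_system:
  fixes A :: "'i \<Rightarrow> 'k \<Rightarrow> complex"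
  assumes "finite J" "finite I" "card J < card I"
  shows "\<exists>c. (\<exists>i\<in>I. c i \<noteq> 0) \<and> (\<forall>k\<in>J. (\<Sum>i\<in>I. c i * A i k) = 0)"
  using assms
proof (induction J arbitrary: I A rule: finite_induct)
  case empty
  then obtain i where "i \<in> I" by fastforce
  then show ?case by (intro exI[of _ "\<lambda>_. 1"]) auto
next
  case (insert k J)
  show ?case
  proof (cases "\<forall>i\<in>I. A i k = 0")
    case True
    have "card J < card I" using insert by simp
    from insert.IH[OF insert.prems(1) this] obtain c where
      "\<exists>i\<in>I. c i \<noteq> 0" "\<forall>k\<in>J. (\<Sum>i\<in>I. c i * A i k) = 0" by blast
    with True show ?thesis by (intro exI[of _ c]) auto
  next
    case False
    then obtain i0 where i0: "i0 \<in> I" "A i0 k \<noteq> 0" by blast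
    let ?I = "I - {i0}"
    have "card J < card ?I" using insert i0 by simp
    from insert.IH[OF _ this, of "\<lambda>i l. A i l - A i k / A i0 k * A i0 l"] insert.prems
    obtain c where c: "\<exists>i\<in>?I. c i \<noteq> 0"
      "\<forall>l\<in>J. (\<Sum>i\<in>?I. c i * (A i l - A i k / A i0 k * A i0 l)) = 0" by auto
    define d where "d = c(i0 := - (\<Sum>i\<in>?I. c i * A i k) / A i0 k)"
    have sum_d: "(\<Sum>i\<in>I. d i * A i l) = d i0 * A i0 l + (\<Sum>i\<in>?I. c i * A i l)" for l
    proof -
      have "(\<Sum>i\<in>?I. d i * A i l) = (\<Sum>i\<in>?I. c i * A i l)"
        by (intro sum.cong) (auto simp: d_def)
      then show ?thesis using insert.prems i0 by (subst sum.remove[of I i0]) auto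
    qed
    have "(\<Sum>i\<in>I. d i * A i l) = 0" if "l \<in> insert k J" for l
    proof (cases "l = k")
      case True
      then show ?thesis unfolding sum_d using i0 by (simp add: d_def)
    next
      case False
      have "d i0 * A i0 l = (\<Sum>i\<in>?I. - (c i * (A i k / A i0 k * A i0 l)))"
        by (simp add: d_def sum_distrib_right sum_divide_distrib sum_negf mult.assoc)
      then have "(\<Sum>i\<in>I. d i * A i l)
          = (\<Sum>i\<in>?I. c i * (A i l - A i k / A i0 k * A i0 l))"
        unfolding sum_d by (simp add: sum.distrib[symmetric] algebra_simps)
      then show ?thesis using c(2) that False by auto
    qed
    moreover have "\<exists>i\<in>I. d i \<noteq> 0" using c(1) by (auto simp: d_def)
    ultimately show ?thesis by blast
  qed
qed

text \<open>The vectors form a type, but a form need only be defined on the subspace \<open>D\<close>; a quadratic form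
that is given by a convergent integral only on its domain has this shape.\<close>

locale hermitian_form = vector_space scale
  for scale :: "complex \<Rightarrow> 'v::ab_group_add \<Rightarrow> 'v" +
  fixes D :: "'v set" and F :: "'v \<Rightarrow> 'v \<Rightarrow> complex"
  assumes subspace_D: "subspace D"
    and add_left: "\<lbrakk>x \<in> D; y \<in> D; z \<in> D\<rbrakk> \<Longrightarrow> F (x + y) z = F x z + F y z"
    and scale_left: "\<lbrakk>x \<in> D; z \<in> D\<rbrakk> \<Longrightarrow> F (scale c x) z = c * F x z"
    and hermitian: "\<lbrakk>x \<in> D; y \<in> D\<rbrakk> \<Longrightarrow> F y x = cnj (F x y)"
begin

lemmas D_add = subspace_add[OF subspace_D]
  and D_scale = subspace_scale[OF subspace_D]
  and D_diff = subspace_diff[OF subspace_D]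
  and D_zero = subspace_0[OF subspace_D]

lemma D_combination: "(\<And>i. i \<in> I \<Longrightarrow> x i \<in> D) \<Longrightarrow> (\<Sum>i\<in>I. scale (c i) (x i)) \<in> D"
  by (intro subspace_sum[OF subspace_D] D_scale) auto

lemma add_right: "\<lbrakk>x \<in> D; y \<in> D; z \<in> D\<rbrakk> \<Longrightarrow> F z (x + y) = F z x + F z y"
  using hermitian[of _ z] add_left[of x y z] D_add by (metis complex_cnj_add complex_cnj_cnj hermitian)

lemma scale_right: "\<lbrakk>x \<in> D; z \<in> D\<rbrakk> \<Longrightarrow> F z (scale c x) = cnj c * F z x"
  by (metis complex_cnj_mult D_scale hermitian scale_left)

lemma diff_left: "\<lbrakk>x \<in> D; y \<in> D; z \<in> D\<rbrakk> \<Longrightarrow> F (x - y) z = F x z - F y z"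
  using add_left[of "x - y" y z] D_diff by (simp add: algebra_simps)

lemma diff_right: "\<lbrakk>x \<in> D; y \<in> D; z \<in> D\<rbrakk> \<Longrightarrow> F z (x - y) = F z x - F z y"
  using add_right[of "x - y" y z] D_diff by (simp add: algebra_simps)

lemma zero_left: "z \<in> D \<Longrightarrow> F 0 z = 0"
  using scale_left[of 0 z 0] D_zero by simp

lemma sum_left:
  "\<lbrakk>\<And>i. i \<in> I \<Longrightarrow> x i \<in> D; z \<in> D\<rbrakk> \<Longrightarrow>
    F (\<Sum>i\<in>I. scale (c i) (x i)) z = (\<Sum>i\<in>I. c i * F (x i) z)"
proof (induction I rule: infinite_finite_induct)
  case (insert i I)
  then show ?case
    using add_left[of "scale (c i) (x i)" "\<Sum>i\<in>I. scale (c i) (x i)" z]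
    by (simp add: D_combination D_scale scale_left)
qed (auto simp: zero_left)

lemma sum_right:
  assumes "\<And>i. i \<in> I \<Longrightarrow> x i \<in> D" "z \<in> D"
  shows "F z (\<Sum>i\<in>I. scale (c i) (x i)) = (\<Sum>i\<in>I. cnj (c i) * F z (x i))"
proof -
  have "F z (\<Sum>i\<in>I. scale (c i) (x i)) = cnj (\<Sum>i\<in>I. c i * F (x i) z)"
    using assms by (subst hermitian[of "\<Sum>i\<in>I. scale (c i) (x i)"]) (auto simp: D_combination sum_left)
  also have "\<dots> = (\<Sum>i\<in>I. cnj (c i) * F z (x i))"
    using assms by (auto intro!: sum.cong simp: hermitian[of _ z])
  finally show ?thesis .
qed

lemma diagonal_real: "x \<in> D \<Longrightarrow> F x x = of_real (Re (F x x))"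
  using hermitian[of x x] by (simp add: complex_eq_iff)

lemma diagonal_scale: "x \<in> D \<Longrightarrow> Re (F (scale c x) (scale c x)) = (cmod c)\<^sup>2 * Re (F x x)"
proof -
  assume x: "x \<in> D"
  have "F (scale c x) (scale c x) = (c * cnj c) * F x x"
    using x by (simp add: scale_left scale_right D_scale)
  also have "c * cnj c = of_real ((cmod c)\<^sup>2)" by (rule complex_norm_square[symmetric])
  finally show ?thesis by (simp flip: of_real_power)
qed

lemma diagonal_add:
  "\<lbrakk>x \<in> D; y \<in> D\<rbrakk> \<Longrightarrow> Re (F (x + y) (x + y)) = Re (F x x) + Re (F y y) + 2 * Re (F x y)"
  using hermitian[of x y] by (simp add: add_left add_right D_add)

lemma diagonal_diff:
  "\<lbrakk>x \<in> D; y \<in> D\<rbrakk> \<Longrightarrow> Re (F (x - y) (x - y)) = Re (F x x) + Re (F y y) - 2 * Re (F x y)"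
  using hermitian[of x y] by (simp add: diff_left diff_right D_diff)

lemma subspace_restrict:
  assumes "subspace E" "E \<subseteq> D"
  shows "hermitian_form scale E F"
  using assms by unfold_locales (auto intro: add_left scale_left hermitian dest: subsetD)

end

text \<open>A Gram matrix within \<open>\<eta>\<close> of \<open>- diag g\<close> stays negative definite as long as \<open>\<eta>\<close> times its size is below
the least \<open>g j\<close>, since \<open>(\<Sum> \<bar>c\<^sub>j\<bar>)\<^sup>2 \<le> card J * \<Sum> \<bar>c\<^sub>j\<bar>\<^sup>2\<close>. Linear independence of the vectors then comes
for free.\<close>

lemma (in hermitian_form) nearly_diagonal_negative:
  fixes f :: "'j \<Rightarrow> 'v" and c :: "'j \<Rightarrow> complex"
  assumes J: "finite J" and f: "\<And>j. j \<in> J \<Longrightarrow> f j \<in> D"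
    and near: "\<And>j k. j \<in> J \<Longrightarrow> k \<in> J \<Longrightarrow> cmod (F (f j) (f k) + of_real (g j) * of_bool (j = k)) \<le> \<eta>"
    and g: "\<And>j. j \<in> J \<Longrightarrow> \<delta> \<le> g j" and \<eta>: "\<eta> * card J < \<delta>"
    and c: "\<exists>j\<in>J. c j \<noteq> 0"
  shows "Re (F (\<Sum>j\<in>J. scale (c j) (f j)) (\<Sum>j\<in>J. scale (c j) (f j))) < 0"
proof -
  let ?x = "\<Sum>j\<in>J. scale (c j) (f j)"
  define E where "E j k = F (f j) (f k) + of_real (g j) * of_bool (j = k)" for j k
  define N where "N = (\<Sum>j\<in>J. (cmod (c j))\<^sup>2)"
  have xD: "?x \<in> D" using f by (intro D_combination)
  have "F ?x ?x = (\<Sum>j\<in>J. c j * F (f j) ?x)" using f xD by (intro sum_left)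
  also have "\<dots> = (\<Sum>j\<in>J. \<Sum>k\<in>J. c j * cnj (c k) * F (f j) (f k))"
  proof (intro sum.cong refl)
    fix j assume "j \<in> J"
    then have "F (f j) ?x = (\<Sum>k\<in>J. cnj (c k) * F (f j) (f k))" using f by (intro sum_right)
    then show "c j * F (f j) ?x = (\<Sum>k\<in>J. c j * cnj (c k) * F (f j) (f k))"
      by (simp add: sum_distrib_left mult.assoc)
  qed
  also have "\<dots> = (\<Sum>j\<in>J. \<Sum>k\<in>J. c j * cnj (c k) * E j k)
      - (\<Sum>j\<in>J. \<Sum>k\<in>J. if k = j then of_real (g j * (cmod (c j))\<^sup>2) else 0)"
    unfolding sum_subtractf[symmetric]
  proof (intro sum.cong refl)
    fix j k
    have "c j * cnj (c j) * of_real (g j) = of_real (g j * (cmod (c j))\<^sup>2)"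
      unfolding of_real_mult complex_norm_square by (simp add: mult_ac)
    then show "c j * cnj (c k) * F (f j) (f k) = c j * cnj (c k) * E j k
        - (if k = j then of_real (g j * (cmod (c j))\<^sup>2) else 0)"
      by (auto simp: E_def algebra_simps)
  qed
  also have "(\<Sum>j\<in>J. \<Sum>k\<in>J. if k = j then of_real (g j * (cmod (c j))\<^sup>2) else 0)
      = complex_of_real (\<Sum>j\<in>J. g j * (cmod (c j))\<^sup>2)" using J by simp
  finally have F: "Re (F ?x ?x) = Re (\<Sum>j\<in>J. \<Sum>k\<in>J. c j * cnj (c k) * E j k)
      - (\<Sum>j\<in>J. g j * (cmod (c j))\<^sup>2)" by simp
  have "N > 0" unfolding N_def using c J by (auto intro!: sum_pos2 simp del: sum_power2_eq_zero_iff)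
  have "cmod (\<Sum>j\<in>J. \<Sum>k\<in>J. c j * cnj (c k) * E j k)
      \<le> (\<Sum>j\<in>J. \<Sum>k\<in>J. cmod (c j * cnj (c k) * E j k))"
    by (intro order.trans[OF norm_sum] sum_mono norm_sum)
  also have "\<dots> \<le> (\<Sum>j\<in>J. \<Sum>k\<in>J. cmod (c j) * cmod (c k) * \<eta>)"
    unfolding norm_mult complex_mod_cnj using near
    by (intro sum_mono mult_left_mono) (auto simp: E_def)
  also have "\<dots> = \<eta> * (\<Sum>j\<in>J. cmod (c j))\<^sup>2"
    unfolding power2_eq_square sum_product by (simp add: sum_distrib_left mult_ac)
  also have "\<dots> \<le> \<eta> * (N * card J)"
  proof -
    obtain j where "j \<in> J" using c by blast
    then have "0 \<le> \<eta>" using order.trans[OF norm_ge_zero near[of j j]] by blast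
    then show ?thesis unfolding N_def by (intro mult_left_mono sum_squared_le_sum_of_squares)
  qed
  also have "\<dots> = (\<eta> * card J) * N" by (simp add: mult_ac)
  also have "\<dots> < \<delta> * N" using \<eta> \<open>N > 0\<close> by (rule mult_strict_right_mono)
  also have "\<dots> \<le> (\<Sum>j\<in>J. g j * (cmod (c j))\<^sup>2)"
    unfolding N_def sum_distrib_left using g by (intro sum_mono mult_right_mono) auto
  finally show ?thesis
    using F complex_Re_le_cmod[of "\<Sum>j\<in>J. \<Sum>k\<in>J. c j * cnj (c k) * E j k"] by linarith
qed

lemma hermitian_form_plus:
  fixes scale :: "complex \<Rightarrow> 'v::ab_group_add \<Rightarrow> 'v"
  assumes "hermitian_form scale D F" "hermitian_form scale D G"
  shows "hermitian_form scale D (\<lambda>x y. F x y + of_real a * G x y)"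
proof -
  interpret F: hermitian_form scale D F by fact
  interpret G: hermitian_form scale D G by fact
  show ?thesis
    by unfold_locales
      (auto simp: F.subspace_D F.add_left G.add_left F.scale_left G.scale_left algebra_simps
        F.hermitian[symmetric] G.hermitian[symmetric])
qed

locale nonneg_form = hermitian_form +
  assumes nonneg: "x \<in> D \<Longrightarrow> 0 \<le> Re (F x x)"
begin

text \<open>The form may be degenerate, so the case \<open>F y y = 0\<close> needs an argument of its own: there the
diagonal value at \<open>x - s * F x y * y\<close> is an affine function of the real number \<open>s\<close> that is bounded below, so
its slope vanishes.\<close>

lemma Cauchy_Schwarz:
  assumes "x \<in> D" "y \<in> D"
  shows "(cmod (F x y))\<^sup>2 \<le> Re (F x x) * Re (F y y)"
proof -
  define A where "A = (cmod (F x y))\<^sup>2"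
  have *: "0 \<le> Re (F x x) - 2 * s * A + s\<^sup>2 * A * Re (F y y)" for s
  proof -
    let ?c = "of_real s * F x y"
    have "F x y * cnj ?c = of_real (s * A)"
      unfolding A_def of_real_mult complex_norm_square by (simp add: mult_ac)
    then have "Re (F x (scale ?c y)) = s * A"
      using scale_right[OF assms(2,1), of ?c] by (metis Re_complex_of_real mult.commute)
    moreover have "Re (F (scale ?c y) (scale ?c y)) = s\<^sup>2 * A * Re (F y y)"
      using assms by (simp add: diagonal_scale norm_mult power_mult_distrib A_def)
    moreover have "0 \<le> Re (F (x - scale ?c y) (x - scale ?c y))"
      using assms by (intro nonneg D_diff D_scale)
    ultimately show ?thesis using assms by (simp add: diagonal_diff D_scale)
  qed
  show ?thesis
  proof (cases "Re (F y y) = 0")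
    case True
    have "A = 0"
    proof (rule ccontr)
      assume "A \<noteq> 0"
      then have "A > 0" by (simp add: A_def)
      then show False
        using *[of "(Re (F x x) + 1) / (2 * A)"] True by (simp add: field_simps)
    qed
    then show ?thesis using True by (simp add: A_def)
  next
    case False
    then have "Re (F y y) > 0" using nonneg[OF assms(2)] by simp
    then have "A \<le> Re (F x x) * Re (F y y)" using *[of "1 / Re (F y y)"]
      by (simp add: power2_eq_square field_simps)
    then show ?thesis by (simp add: A_def)
  qed
qed

lemma Cauchy_Schwarz_sqrt:
  assumes "x \<in> D" "y \<in> D"
  shows "cmod (F x y) \<le> sqrt (Re (F x x)) * sqrt (Re (F y y))"
  using Cauchy_Schwarz[OF assms] real_le_rsqrt by (simp add: real_sqrt_mult[symmetric])

lemma tendsto_left: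
  assumes D: "\<And>n. f n \<in> D" "x \<in> D" "y \<in> D"
    and lim: "(\<lambda>n. Re (F (f n - x) (f n - x))) \<longlonglongrightarrow> 0"
  shows "(\<lambda>n. F (f n) y) \<longlonglongrightarrow> F x y"
proof (rule LIM_zero_cancel)
  have "(\<lambda>n. F (f n - x) y) \<longlonglongrightarrow> 0"
  proof (rule Lim_null_comparison)
    show "\<forall>\<^sub>F n in sequentially. cmod (F (f n - x) y)
        \<le> sqrt (Re (F (f n - x) (f n - x))) * sqrt (Re (F y y))"
      using D by (intro always_eventually allI Cauchy_Schwarz_sqrt D_diff)
    show "(\<lambda>n. sqrt (Re (F (f n - x) (f n - x))) * sqrt (Re (F y y))) \<longlonglongrightarrow> 0"
      using tendsto_real_sqrt[OF lim] by (intro tendsto_mult_left_zero) simp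
  qed
  then show "(\<lambda>n. F (f n) y - F x y) \<longlonglongrightarrow> 0" using D by (simp add: diff_left)
qed

lemma tendsto_diagonal:
  assumes D: "\<And>n. f n \<in> D" "x \<in> D"
    and lim: "(\<lambda>n. Re (F (f n - x) (f n - x))) \<longlonglongrightarrow> 0"
  shows "(\<lambda>n. Re (F (f n) (f n))) \<longlonglongrightarrow> Re (F x x)"
proof -
  have "Re (F (f n) (f n)) = Re (F (f n - x) (f n - x)) + 2 * Re (F (f n) x) - Re (F x x)" for n
    using D by (simp add: diagonal_diff)
  moreover have "(\<lambda>n. Re (F (f n - x) (f n - x)) + 2 * Re (F (f n) x) - Re (F x x))
      \<longlonglongrightarrow> 0 + 2 * Re (F x x) - Re (F x x)"
    using D by (intro tendsto_intros lim tendsto_left)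
  ultimately show ?thesis by simp
qed

end

lemma common_convergent_subsequence:
  fixes u :: "'i \<Rightarrow> nat \<Rightarrow> complex"
  assumes "finite I" "\<And>i. i \<in> I \<Longrightarrow> bounded (range (u i))"
  shows "\<exists>r c. strict_mono r \<and> (\<forall>i\<in>I. (\<lambda>n. u i (r n)) \<longlonglongrightarrow> c i)"
  using assms
proof (induction I rule: finite_induct)
  case empty
  then show ?case by (intro exI[of _ "\<lambda>n. n"]) (auto simp: strict_mono_def)
next
  case (insert j I)
  then obtain r c where r: "strict_mono r" "\<forall>i\<in>I. (\<lambda>n. u i (r n)) \<longlonglongrightarrow> c i" by auto
  have "bounded (range (u j \<circ> r))" using insert.prems[of j] by (rule bounded_subset) auto
  from bounded_imp_convergent_subsequence[OF this]
  obtain l s where s: "strict_mono s" "((u j \<circ> r) \<circ> s) \<longlonglongrightarrow> l" by blast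
  have "(\<lambda>n. u i ((r \<circ> s) n)) \<longlonglongrightarrow> (c(j := l)) i" if "i \<in> insert j I" for i
  proof (cases "i = j")
    case True
    then show ?thesis using s(2) by (simp add: o_def)
  next
    case False
    with that r(2) have "(\<lambda>n. u i (r n)) \<longlonglongrightarrow> c i" by auto
    from LIMSEQ_subseq_LIMSEQ[OF this s(1)] show ?thesis using False by (simp add: o_def)
  qed
  moreover have "strict_mono (r \<circ> s)" using r(1) s(1) by (rule strict_mono_o)
  ultimately show ?case by blast
qed

section \<open>Negative eigenvalues of a form with a finite rank perturbation\<close>

text \<open>\<open>complete\<close> says that the form \<open>h0\<close> is closed. Vectors at distance \<open>0\<close> are not identified, so limits
are unique only up to null vectors of \<open>ip\<close>.\<close>

locale finite_rank_perturbation =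
  ip: nonneg_form scale D ip + h0: nonneg_form scale D h0 + b: hermitian_form scale D b
  for scale :: "complex \<Rightarrow> 'v::ab_group_add \<Rightarrow> 'v" and D ip h0 b +
  fixes I :: "'i set" and L :: "'i \<Rightarrow> 'v \<Rightarrow> complex" and coupling :: "'i \<Rightarrow> 'i \<Rightarrow> complex" and C :: real
  assumes complete: "\<lbrakk>\<And>n. f n \<in> D;
      \<And>\<epsilon>. \<epsilon> > 0 \<Longrightarrow> \<exists>N. \<forall>m\<ge>N. \<forall>n\<ge>N.
         Re (ip (f m - f n) (f m - f n)) + Re (h0 (f m - f n) (f m - f n)) \<le> \<epsilon>\<rbrakk>
      \<Longrightarrow> \<exists>x\<in>D. (\<lambda>n. Re (ip (f n - x) (f n - x))) \<longlonglongrightarrow> 0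
              \<and> (\<lambda>n. Re (h0 (f n - x) (f n - x))) \<longlonglongrightarrow> 0"
    and finite_I: "finite I"
    and L_diff: "\<lbrakk>i \<in> I; x \<in> D; y \<in> D\<rbrakk> \<Longrightarrow> L i (x - y) = L i x - L i y"
    and L_bound: "\<lbrakk>i \<in> I; x \<in> D\<rbrakk> \<Longrightarrow> (cmod (L i x))\<^sup>2 \<le> C * Re (ip x x)"
    and b_eq: "\<lbrakk>x \<in> D; y \<in> D\<rbrakk> \<Longrightarrow> b x y = (\<Sum>i\<in>I. \<Sum>j\<in>I. coupling i j * L i x * cnj (L j y))"
begin

abbreviation h where "h x y \<equiv> h0 x y + b x y"

definition "Bnorm = (\<Sum>i\<in>I. \<Sum>j\<in>I. cmod (coupling i j))"

lemma b_le_functionals: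
  assumes "x \<in> D" "y \<in> D" "\<And>i. i \<in> I \<Longrightarrow> cmod (L i x) \<le> s" "\<And>i. i \<in> I \<Longrightarrow> cmod (L i y) \<le> t"
  shows "cmod (b x y) \<le> Bnorm * (s * t)"
proof -
  have "cmod (b x y) \<le> (\<Sum>i\<in>I. \<Sum>j\<in>I. cmod (coupling i j * L i x * cnj (L j y)))"
    unfolding b_eq[OF assms(1,2)] by (intro order.trans[OF norm_sum] sum_mono norm_sum)
  also have "\<dots> \<le> (\<Sum>i\<in>I. \<Sum>j\<in>I. cmod (coupling i j) * (s * t))"
  proof (intro sum_mono)
    fix i j assume "i \<in> I" "j \<in> I"
    with assms(3)[of i] assms(4)[of j] show "cmod (coupling i j * L i x * cnj (L j y)) \<le> cmod (coupling i j) * (s * t)"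
      by (auto simp: norm_mult mult.assoc intro!: mult_left_mono mult_mono
          intro: order.trans[OF norm_ge_zero])
  qed
  also have "\<dots> = Bnorm * (s * t)" by (simp add: Bnorm_def sum_distrib_right)
  finally show ?thesis .
qed

lemma b_bound:
  assumes "x \<in> D" "y \<in> D"
  shows "cmod (b x y) \<le> Bnorm * (sqrt (C * Re (ip x x)) * sqrt (C * Re (ip y y)))"
  using assms L_bound by (intro b_le_functionals) (auto intro: real_le_rsqrt)

lemma b_tendsto_left:
  assumes D: "\<And>n. f n \<in> D" "x \<in> D" "y \<in> D"
    and lim: "(\<lambda>n. Re (ip (f n - x) (f n - x))) \<longlonglongrightarrow> 0"
  shows "(\<lambda>n. b (f n) y) \<longlonglongrightarrow> b x y"
proof (rule LIM_zero_cancel)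
  have "(\<lambda>n. b (f n - x) y) \<longlonglongrightarrow> 0"
  proof (rule Lim_null_comparison)
    let ?g = "\<lambda>n. Bnorm * (sqrt (C * Re (ip (f n - x) (f n - x))) * sqrt (C * Re (ip y y)))"
    show "\<forall>\<^sub>F n in sequentially. cmod (b (f n - x) y) \<le> ?g n"
      using D by (intro always_eventually allI b_bound ip.D_diff)
    have "?g \<longlonglongrightarrow> Bnorm * (sqrt (C * 0) * sqrt (C * Re (ip y y)))"
      by (intro tendsto_intros lim)
    then show "?g \<longlonglongrightarrow> 0" by simp
  qed
  then show "(\<lambda>n. b (f n) y - b x y) \<longlonglongrightarrow> 0" using D by (simp add: b.diff_left)
qed

lemma h_lower_bound: "x \<in> D \<Longrightarrow> Re (h x x) \<ge> - (Bnorm * \<bar>C\<bar>) * Re (ip x x)"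
proof -
  assume x: "x \<in> D"
  have "0 \<le> Bnorm" by (auto simp: Bnorm_def intro!: sum_nonneg)
  have "\<bar>Re (b x x)\<bar> \<le> Bnorm * \<bar>C * Re (ip x x)\<bar>"
    using order.trans[OF abs_Re_le_cmod b_bound[OF x x]] by (simp flip: real_sqrt_mult)
  with h0.nonneg[OF x] ip.nonneg[OF x] show ?thesis by (simp add: abs_mult algebra_simps)
qed

text \<open>A form that factors through finitely many bounded functionals is compact: along a subsequence on
which all the functionals converge, \<open>b\<close> of the differences tends to \<open>0\<close>.\<close>

lemma b_compact:
  fixes f :: "nat \<Rightarrow> 'v"
  assumes D: "\<And>n. f n \<in> D" and f1: "\<And>n. Re (ip (f n) (f n)) = 1"
  shows "\<exists>r d. strict_mono r \<and> d \<longlonglongrightarrow> 0 \<and>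
    (\<forall>m n. cmod (b (f (r m) - f (r n)) (f (r m) - f (r n))) \<le> Bnorm * (d m + d n)\<^sup>2)"
proof -
  have bdd: "bounded (range (\<lambda>n. L i (f n)))" if "i \<in> I" for i
  proof -
    have "cmod (L i (f n)) \<le> sqrt C" for n
      using L_bound[OF that D[of n]] f1[of n] by (simp add: real_le_rsqrt)
    then show ?thesis by (auto simp: bounded_iff)
  qed
  obtain r c where r: "strict_mono r" "\<And>i. i \<in> I \<Longrightarrow> (\<lambda>n. L i (f (r n))) \<longlonglongrightarrow> c i"
    using common_convergent_subsequence[OF finite_I, of "\<lambda>i n. L i (f n)"] bdd by blast
  define d where "d n = (\<Sum>i\<in>I. cmod (L i (f (r n)) - c i))" for n
  have "d \<longlonglongrightarrow> (\<Sum>i\<in>I. cmod (c i - c i))"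
    unfolding d_def by (intro tendsto_intros r)
  then have "d \<longlonglongrightarrow> 0" by simp
  moreover have "cmod (b (f (r m) - f (r n)) (f (r m) - f (r n))) \<le> Bnorm * (d m + d n)\<^sup>2" for m n
    unfolding power2_eq_square
  proof (intro b_le_functionals b.D_diff D)
    fix i assume i: "i \<in> I"
    have le: "cmod (L i (f (r k)) - c i) \<le> d k" for k
      unfolding d_def using i finite_I by (intro member_le_sum) auto
    have "L i (f (r m) - f (r n)) = (L i (f (r m)) - c i) - (L i (f (r n)) - c i)"
      using i D by (simp add: L_diff)
    then show "cmod (L i (f (r m) - f (r n))) \<le> d m + d n"
      using norm_triangle_ineq4[of "L i (f (r m)) - c i" "L i (f (r n)) - c i"] le[of m] le[of n]
      by simp
    then show "cmod (L i (f (r m) - f (r n))) \<le> d m + d n" .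
  qed
  ultimately show ?thesis using r(1) by blast
qed

text \<open>The weak form of the eigenvalue equation for the operator of the form \<open>h\<close>. The vector may be
zero.\<close>

definition eigenpair :: "'v \<Rightarrow> real \<Rightarrow> bool" where
  "eigenpair x l \<longleftrightarrow> x \<in> D \<and> (\<forall>y\<in>D. h x y = of_real l * ip x y)"

text \<open>Let \<open>\<mu> < 0\<close> be the infimum of \<open>h\<close> over unit vectors orthogonal to the eigenvectors found so far. The
form \<open>p = h - \<mu> ip\<close> is nonnegative there and tends to \<open>0\<close> along a minimising sequence, so by the
parallelogram identity it tends to \<open>0\<close> on differences. As \<open>b\<close> is compact, \<open>h0 - \<mu> ip\<close> tends to \<open>0\<close>
on differences of a subsequence; because \<open>- \<mu> > 0\<close> this is the Cauchy property needed for a limit. The limit \<open>y\<close>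
satisfies \<open>p y z = 0\<close> by the Cauchy-Schwarz inequality for \<open>p\<close>, first for \<open>z\<close> in the orthogonal
complement and then for all \<open>z\<close>.\<close>

lemma next_eigenvector:
  fixes e :: "nat \<Rightarrow> 'v" and l :: "nat \<Rightarrow> real"
  assumes eig: "\<And>i. i < k \<Longrightarrow> eigenpair (e i) (l i)"
    and orth: "\<And>i j. i < k \<Longrightarrow> j < k \<Longrightarrow> ip (e i) (e j) = of_bool (i = j)"
    and x: "x \<in> D" "\<And>i. i < k \<Longrightarrow> ip x (e i) = 0" "Re (h x x) < 0"
  shows "\<exists>f \<mu>. \<mu> < 0 \<and> eigenpair f \<mu> \<and> ip f f = 1 \<and> (\<forall>i<k. ip f (e i) = 0)"
proof -
  have eD: "e i \<in> D" if "i < k" for i using eig[OF that] by (simp add: eigenpair_def)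
  define E where "E = {y \<in> D. \<forall>i<k. ip y (e i) = 0}"
  have ED: "E \<subseteq> D" by (auto simp: E_def)
  have subE: "ip.subspace E"
    using eD by (intro ip.subspaceI)
      (auto simp: E_def ip.D_zero ip.D_add ip.D_scale ip.zero_left ip.add_left ip.scale_left)
  define S where "S = {Re (h y y) | y. y \<in> E \<and> Re (ip y y) = 1}"
  define \<mu> where "\<mu> = Inf S"
  have bdd: "bdd_below S"
    by (intro bdd_belowI[of _ "- (Bnorm * \<bar>C\<bar>)"]) (use h_lower_bound ED in \<open>force simp: S_def\<close>)
  interpret h: hermitian_form scale D h
    using hermitian_form_plus[OF h0.hermitian_form_axioms b.hermitian_form_axioms, of 1] by simp
  have normalised: "Re (h y y) / Re (ip y y) \<in> S" if "y \<in> E" "Re (ip y y) > 0" for y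
  proof -
    let ?z = "scale (of_real (1 / sqrt (Re (ip y y)))) y"
    have "y \<in> D" using that ED by auto
    have "?z \<in> E" using that subE by (simp add: ip.subspace_scale)
    moreover have "Re (ip ?z ?z) = 1" "Re (h ?z ?z) = Re (h y y) / Re (ip y y)"
      using that \<open>y \<in> D\<close> ip.diagonal_scale[of y] h.diagonal_scale[of y]
      by (simp_all add: norm_divide power_divide)
    ultimately show ?thesis unfolding S_def by (intro CollectI exI[of _ ?z]) auto
  qed
  have "Re (ip x x) > 0"
  proof (rule ccontr)
    assume "\<not> ?thesis"
    with ip.nonneg[OF x(1)] have "Re (ip x x) = 0" by simp
    with h_lower_bound[OF x(1)] x(3) show False by simp
  qed
  moreover have "x \<in> E" using x by (simp add: E_def)
  ultimately have "\<mu> \<le> Re (h x x) / Re (ip x x)" "S \<noteq> {}"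
    using normalised[of x] bdd by (auto simp: \<mu>_def intro: cInf_lower)
  with x(3) \<open>Re (ip x x) > 0\<close> have \<mu>: "\<mu> < 0" by (smt (verit) divide_neg_pos)
  define p where "p y z = h y z + of_real (- \<mu>) * ip y z" for y z
  interpret pD: hermitian_form scale D p
    unfolding p_def using hermitian_form_plus[OF h.hermitian_form_axioms ip.hermitian_form_axioms] .
  have p_nonneg: "0 \<le> Re (p y y)" if "y \<in> E" for y
  proof (cases "Re (ip y y) = 0")
    case True
    then show ?thesis using h_lower_bound[of y] that ED by (auto simp: p_def)
  next
    case False
    with that ED ip.nonneg have pos: "Re (ip y y) > 0" by force
    have "\<mu> \<le> Re (h y y) / Re (ip y y)"
      unfolding \<mu>_def by (intro cInf_lower normalised that pos bdd)
    then show ?thesis using pos by (simp add: p_def field_simps)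
  qed
  interpret pE: nonneg_form scale E p
    using pD.subspace_restrict[OF subE ED] p_nonneg
    by (simp add: nonneg_form_def nonneg_form_axioms_def)
  have "\<exists>y. y \<in> E \<and> Re (ip y y) = 1 \<and> Re (h y y) < \<mu> + 1 / real (Suc n)" for n
  proof -
    have "\<exists>s\<in>S. s < \<mu> + 1 / real (Suc n)"
      using \<open>S \<noteq> {}\<close> by (intro cInf_lessD) (auto simp: \<mu>_def[symmetric])
    then show ?thesis by (auto simp: S_def)
  qed
  then obtain g where g: "\<And>n. g n \<in> E" "\<And>n. Re (ip (g n) (g n)) = 1"
      "\<And>n. Re (h (g n) (g n)) < \<mu> + 1 / real (Suc n)" by metis
  obtain r d where r: "strict_mono r" "d \<longlonglongrightarrow> 0" and
    rb: "\<And>m n. cmod (b (g (r m) - g (r n)) (g (r m) - g (r n))) \<le> Bnorm * (d m + d n)\<^sup>2"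
    using b_compact[of g] g ED by blast
  define f where "f = g \<circ> r"
  have fE: "f n \<in> E" and f1: "Re (ip (f n) (f n)) = 1" for n using g by (auto simp: f_def)
  have fD: "f n \<in> D" for n using fE ED by auto
  have pf: "Re (p (f n) (f n)) \<le> 1 / real (Suc n)" for n
  proof -
    have "Re (p (f n) (f n)) \<le> 1 / real (Suc (r n))"
      using g(2,3)[of "r n"] by (simp add: p_def f_def)
    also have "\<dots> \<le> 1 / real (Suc n)"
      using seq_suble[OF r(1), of n] by (simp add: frac_le)
    finally show ?thesis .
  qed
  have p_lim: "(\<lambda>n. Re (p (f n) (f n))) \<longlonglongrightarrow> 0"
    by (rule tendsto_sandwich[OF _ _ tendsto_const LIMSEQ_inverse_real_of_nat])
      (use pf p_nonneg[OF fE] in \<open>auto simp: inverse_eq_divide\<close>)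
  define w where "w n = 2 * Re (p (f n) (f n)) + 2 * Bnorm * (d n)\<^sup>2" for n
  have w_lim: "w \<longlonglongrightarrow> 0"
  proof -
    have "w \<longlonglongrightarrow> 2 * 0 + 2 * Bnorm * 0\<^sup>2" unfolding w_def by (intro tendsto_intros p_lim r)
    then show ?thesis by simp
  qed
  have "Bnorm \<ge> 0" by (auto simp: Bnorm_def intro!: sum_nonneg)
  \<comment> \<open>the parallelogram identity for \<open>p\<close> and compactness of \<open>b\<close>\<close>
  have close: "Re (h0 (f m - f n) (f m - f n)) + (- \<mu>) * Re (ip (f m - f n) (f m - f n)) \<le> w m + w n"
    for m n
  proof -
    have "0 \<le> Re (p (f m + f n) (f m + f n))" using fE subE by (intro p_nonneg ip.subspace_add)
    then have "Re (p (f m - f n) (f m - f n)) \<le> 2 * Re (p (f m) (f m)) + 2 * Re (p (f n) (f n))"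
      using fD by (simp add: pD.diagonal_add pD.diagonal_diff)
    moreover have "- Re (b (f m - f n) (f m - f n)) \<le> Bnorm * (d m + d n)\<^sup>2"
      using rb[of m n] abs_Re_le_cmod[of "b (f m - f n) (f m - f n)"] by (simp add: f_def)
    moreover have "(d m + d n)\<^sup>2 \<le> 2 * (d m)\<^sup>2 + 2 * (d n)\<^sup>2"
      by (smt (verit) power2_sum sum_squares_bound)
    then have "Bnorm * (d m + d n)\<^sup>2 \<le> Bnorm * (2 * (d m)\<^sup>2 + 2 * (d n)\<^sup>2)"
      using \<open>Bnorm \<ge> 0\<close> by (rule mult_left_mono)
    ultimately show ?thesis by (simp add: p_def w_def algebra_simps)
  qed
  have "\<exists>x\<in>D. (\<lambda>n. Re (ip (f n - x) (f n - x))) \<longlonglongrightarrow> 0 \<and> (\<lambda>n. Re (h0 (f n - x) (f n - x))) \<longlonglongrightarrow> 0"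
  proof (rule complete[OF fD])
    fix \<epsilon> :: real assume \<epsilon>: "\<epsilon> > 0"
    \<comment> \<open>\<open>\<kappa> (ip + h0) \<le> h0 - \<mu> ip\<close>, which turns the bound into one for the complete norm\<close>
    define \<kappa> where "\<kappa> = min 1 (- \<mu>)"
    have \<kappa>: "\<kappa> > 0" "\<kappa> \<le> 1" "\<kappa> \<le> - \<mu>" using \<mu> by (auto simp: \<kappa>_def)
    obtain N where N: "\<And>n. n \<ge> N \<Longrightarrow> \<bar>w n\<bar> < \<kappa> * \<epsilon> / 2"
      using LIMSEQ_D[OF w_lim, of "\<kappa> * \<epsilon> / 2"] \<kappa> \<epsilon> by auto
    have "Re (ip (f m - f n) (f m - f n)) + Re (h0 (f m - f n) (f m - f n)) \<le> \<epsilon>"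
      if "m \<ge> N" "n \<ge> N" for m n
    proof -
      have D: "f m - f n \<in> D" using fD ip.D_diff by blast
      have "\<kappa> * (Re (ip (f m - f n) (f m - f n)) + Re (h0 (f m - f n) (f m - f n)))
          \<le> - \<mu> * Re (ip (f m - f n) (f m - f n)) + 1 * Re (h0 (f m - f n) (f m - f n))"
        unfolding distrib_left using \<kappa> ip.nonneg[OF D] h0.nonneg[OF D]
        by (intro add_mono mult_right_mono)
      also have "\<dots> \<le> w m + w n" using close[of m n] by simp
      also have "\<dots> \<le> \<kappa> * \<epsilon>" using N[OF that(1)] N[OF that(2)] by linarith
      finally show ?thesis using \<kappa> by simp
    qed
    then show "\<exists>N. \<forall>m\<ge>N. \<forall>n\<ge>N. Re (ip (f m - f n) (f m - f n)) + Re (h0 (f m - f n) (f m - f n)) \<le> \<epsilon>"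
      by blast
  qed
  then obtain y where y: "y \<in> D" "(\<lambda>n. Re (ip (f n - y) (f n - y))) \<longlonglongrightarrow> 0"
    "(\<lambda>n. Re (h0 (f n - y) (f n - y))) \<longlonglongrightarrow> 0" by blast
  have "(\<lambda>n. Re (ip (f n) (f n))) \<longlonglongrightarrow> Re (ip y y)"
    by (rule ip.tendsto_diagonal[OF fD y(1,2)])
  with f1 have "Re (ip y y) = 1" by (simp add: LIMSEQ_const_iff)
  then have y1: "ip y y = 1" using ip.diagonal_real[OF y(1)] by simp
  have yE: "ip y (e i) = 0" if "i < k" for i
  proof -
    have "(\<lambda>n. ip (f n) (e i)) \<longlonglongrightarrow> ip y (e i)"
      by (rule ip.tendsto_left[OF fD y(1) eD[OF that] y(2)])
    moreover have "ip (f n) (e i) = 0" for n using fE that by (auto simp: E_def)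
    ultimately show ?thesis by (simp add: LIMSEQ_const_iff)
  qed
  have p0: "p y z = 0" if "z \<in> E" for z
  proof -
    have zD: "z \<in> D" using that ED by auto
    have "(\<lambda>n. p (f n) z) \<longlonglongrightarrow> p y z"
      unfolding p_def
      by (intro tendsto_intros h0.tendsto_left b_tendsto_left ip.tendsto_left fD y zD)
    moreover have "(\<lambda>n. p (f n) z) \<longlonglongrightarrow> 0"
    proof (rule Lim_null_comparison)
      show "\<forall>\<^sub>F n in sequentially. cmod (p (f n) z) \<le> sqrt (Re (p (f n) (f n))) * sqrt (Re (p z z))"
        using fE that by (intro always_eventually allI pE.Cauchy_Schwarz_sqrt)
      show "(\<lambda>n. sqrt (Re (p (f n) (f n))) * sqrt (Re (p z z))) \<longlonglongrightarrow> 0"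
        using tendsto_real_sqrt[OF p_lim] by (intro tendsto_mult_left_zero) simp
    qed
    ultimately show ?thesis using LIMSEQ_unique by blast
  qed
  \<comment> \<open>the eigenvectors already found are orthogonal to \<open>y\<close> for both \<open>ip\<close> and \<open>h\<close>\<close>
  have pe: "p y (e i) = 0" if "i < k" for i
  proof -
    have "h (e i) y = of_real (l i) * ip (e i) y"
      using eig[OF that] y(1) by (auto simp: eigenpair_def)
    also have "ip (e i) y = 0"
      using ip.hermitian[OF y(1) eD[OF that]] yE[OF that] by simp
    finally show ?thesis
      using h.hermitian[OF eD[OF that] y(1)] yE[OF that] by (simp add: p_def)
  qed
  have "p y z = 0" if z: "z \<in> D" for z
  proof -
    define z' where "z' = (\<Sum>i<k. scale (ip z (e i)) (e i))"
    have z'D: "z' \<in> D" unfolding z'_def using eD by (intro ip.D_combination) auto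
    have "ip z' (e j) = ip z (e j)" if "j < k" for j
    proof -
      have "ip z' (e j) = (\<Sum>i<k. ip z (e i) * ip (e i) (e j))"
        unfolding z'_def using eD that by (intro ip.sum_left) auto
      also have "\<dots> = (\<Sum>i<k. if i = j then ip z (e i) else 0)"
        using orth that by (intro sum.cong) auto
      finally show ?thesis using that by simp
    qed
    then have "z - z' \<in> E"
      using z z'D eD by (auto simp: E_def ip.D_diff ip.diff_left)
    then have "p y (z - z') = 0" by (rule p0)
    moreover have "p y z' = 0"
      unfolding z'_def using eD y(1) pe by (subst pD.sum_right) auto
    ultimately show ?thesis using y(1) z z'D by (simp add: pD.diff_right)
  qed
  then have "eigenpair y \<mu>" using y(1) by (auto simp: eigenpair_def p_def algebra_simps)
  then show ?thesis using \<mu> y1 yE by blast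
qed

text \<open>As long as fewer than \<open>card J\<close> eigenvectors are known, some nonzero combination of the \<open>g j\<close> is
orthogonal to all of them, and its negative energy is what \<open>next_eigenvector\<close> asks for.\<close>

theorem eigenvectors_of_negative_subspace:
  assumes J: "finite J" and gD: "\<And>j. j \<in> J \<Longrightarrow> g j \<in> D"
    and neg: "\<And>c. (\<exists>j\<in>J. c j \<noteq> 0) \<Longrightarrow>
      Re (h (\<Sum>j\<in>J. scale (c j) (g j)) (\<Sum>j\<in>J. scale (c j) (g j))) < 0"
  shows "\<exists>e l. (\<forall>i<card J. eigenpair (e i) (l i) \<and> l i < 0) \<and>
      (\<forall>i<card J. \<forall>j<card J. ip (e i) (e j) = of_bool (i = j))"
proof -
  have "k \<le> card J \<Longrightarrow> \<exists>e l. (\<forall>i<k. eigenpair (e i) (l i) \<and> l i < 0) \<and>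
      (\<forall>i<k. \<forall>j<k. ip (e i) (e j) = of_bool (i = j))" for k :: nat
  proof (induction k)
    case (Suc k)
    then obtain e l where el: "\<And>i. i < k \<Longrightarrow> eigenpair (e i) (l i)" "\<And>i. i < k \<Longrightarrow> l i < (0::real)"
      "\<And>i j. i < k \<Longrightarrow> j < k \<Longrightarrow> ip (e i) (e j) = of_bool (i = j)"
      by (metis Suc_leD)
    have eD: "e i \<in> D" if "i < k" for i using el(1)[OF that] by (simp add: eigenpair_def)
    obtain c where c: "\<exists>j\<in>J. c j \<noteq> 0" "\<And>i. i < k \<Longrightarrow> (\<Sum>j\<in>J. c j * ip (g j) (e i)) = 0"
      using underdetermined_system[of "{..<k}" J "\<lambda>j i. ip (g j) (e i)"] J Suc.prems by auto
    let ?x = "\<Sum>j\<in>J. scale (c j) (g j)"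
    have "?x \<in> D" using gD by (rule ip.D_combination)
    moreover have "ip ?x (e i) = 0" if "i < k" for i
      using that c gD eD by (subst ip.sum_left) auto
    ultimately obtain f \<mu> where f: "\<mu> < 0" "eigenpair f \<mu>" "ip f f = 1" "\<And>i. i < k \<Longrightarrow> ip f (e i) = 0"
      using next_eigenvector[OF el(1,3), of k ?x] neg[OF c(1)] by blast
    have "ip (e i) f = 0" if "i < k" for i
      using ip.hermitian[of f "e i"] f(2,4) that eD by (auto simp: eigenpair_def)
    with f el show ?case
      by (intro exI[of _ "e(k := f)"] exI[of _ "l(k := \<mu>)"]) (auto simp: less_Suc_eq)
  qed auto
  then show ?thesis by blast
qed

text \<open>Otherwise some nonzero combination of the eigenvectors is annihilated by all \<open>\<phi> k\<close>, so that \<open>h\<close> is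
nonnegative on it. Grouping it by eigenvalues gives mutually orthogonal parts, and
\<open>h = \<Sum> t ip (part t) (part t)\<close> with all \<open>t < 0\<close>; hence every part is a null vector.\<close>

theorem negative_eigenvectors_le_functionals:
  fixes \<phi> :: "'k \<Rightarrow> 'v \<Rightarrow> complex" and x :: "'j \<Rightarrow> 'v" and l :: "'j \<Rightarrow> real"
  assumes fin: "finite S" "finite J"
    and \<phi>_sum: "\<And>k c. k \<in> J \<Longrightarrow> \<phi> k (\<Sum>i\<in>S. scale (c i) (x i)) = (\<Sum>i\<in>S. c i * \<phi> k (x i))"
    and b_nonneg: "\<And>y. \<lbrakk>y \<in> D; \<And>k. k \<in> J \<Longrightarrow> \<phi> k y = 0\<rbrakk> \<Longrightarrow> 0 \<le> Re (b y y)"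
    and eig: "\<And>i. i \<in> S \<Longrightarrow> eigenpair (x i) (l i)" and neg: "\<And>i. i \<in> S \<Longrightarrow> l i < 0"
    and indep: "\<And>c. (\<And>t. let y = (\<Sum>i\<in>{i\<in>S. l i = t}. scale (c i) (x i)) in ip y y = 0)
       \<Longrightarrow> \<forall>i\<in>S. c i = 0"
  shows "card S \<le> card J"
proof (rule ccontr)
  assume "\<not> ?thesis"
  then obtain c where c: "\<exists>i\<in>S. c i \<noteq> 0" "\<And>k. k \<in> J \<Longrightarrow> (\<Sum>i\<in>S. c i * \<phi> k (x i)) = 0"
    using underdetermined_system[OF fin(2,1), of "\<lambda>i k. \<phi> k (x i)"] by auto
  define part where "part t = (\<Sum>i\<in>{i\<in>S. l i = t}. scale (c i) (x i))" for t
  define y where "y = (\<Sum>i\<in>S. scale (c i) (x i))"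
  have xD: "x i \<in> D" if "i \<in> S" for i using eig[OF that] by (simp add: eigenpair_def)
  have partD: "part t \<in> D" for t unfolding part_def using xD by (intro ip.D_combination) auto
  have y_part: "y = (\<Sum>t\<in>l ` S. part t)"
    unfolding y_def part_def using fin(1) by (simp add: sum.image_gen[of S _ l])
  have yD: "y \<in> D" unfolding y_def using xD by (rule ip.D_combination)
  interpret h: hermitian_form scale D h
    using hermitian_form_plus[OF h0.hermitian_form_axioms b.hermitian_form_axioms, of 1] by simp
  have h_part: "h (part t) z = of_real t * ip (part t) z" if "z \<in> D" for t z
  proof -
    have "h (part t) z = (\<Sum>i\<in>{i\<in>S. l i = t}. c i * h (x i) z)"
      unfolding part_def using xD that by (intro h.sum_left) auto
    also have "\<dots> = (\<Sum>i\<in>{i\<in>S. l i = t}. of_real t * (c i * ip (x i) z))"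
      using eig that by (intro sum.cong) (auto simp: eigenpair_def)
    also have "\<dots> = of_real t * ip (part t) z"
      unfolding part_def using xD that by (subst ip.sum_left) (auto simp: sum_distrib_left)
    finally show ?thesis .
  qed
  have orth: "ip (part s) (part t) = 0" if "s \<noteq> t" for s t
  proof -
    have "of_real s * ip (part s) (part t) = h (part s) (part t)"
      using h_part partD by simp
    also have "\<dots> = cnj (of_real t * ip (part t) (part s))"
      using h.hermitian[OF partD partD] h_part[OF partD] by metis
    also have "\<dots> = of_real t * ip (part s) (part t)"
      using ip.hermitian[OF partD partD, of t s] by simp
    finally show ?thesis using that by simp
  qed
  have "h y y = (\<Sum>t\<in>l ` S. h (part t) y)"
    using partD yD h.sum_left[of "l ` S" part y "\<lambda>_. 1"] by (simp add: y_part[symmetric])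
  also have "\<dots> = (\<Sum>t\<in>l ` S. of_real t * ip (part t) (part t))"
  proof (intro sum.cong refl)
    fix t assume t: "t \<in> l ` S"
    have "ip (part t) y = (\<Sum>s\<in>l ` S. ip (part t) (part s))"
      using partD ip.sum_right[of "l ` S" part "part t" "\<lambda>_. 1"] by (simp add: y_part[symmetric])
    also have "\<dots> = (\<Sum>s\<in>l ` S. if s = t then ip (part t) (part t) else 0)"
      using orth by (intro sum.cong) auto
    finally show "h (part t) y = of_real t * ip (part t) (part t)"
      using h_part[OF yD] t fin(1) by simp
  qed
  finally have h_y: "Re (h y y) = (\<Sum>t\<in>l ` S. t * Re (ip (part t) (part t)))" by simp
  have nonpos: "t * Re (ip (part t) (part t)) \<le> 0" if "t \<in> l ` S" for t
    using that neg ip.nonneg[OF partD] by (force simp: mult_le_0_iff)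
  have "\<phi> k y = 0" if "k \<in> J" for k unfolding y_def using \<phi>_sum c that by simp
  then have "0 \<le> Re (h y y)" using b_nonneg[OF yD] h0.nonneg[OF yD] by simp
  then have "(\<Sum>t\<in>l ` S. - (t * Re (ip (part t) (part t)))) = 0"
    using h_y nonpos by (simp add: sum_negf sum_nonpos order.antisym)
  then have zero: "\<forall>t\<in>l ` S. t * Re (ip (part t) (part t)) = 0"
    using nonpos fin(1) by (subst (asm) sum_nonneg_eq_0_iff) auto
  have "ip (part t) (part t) = 0" for t
  proof (cases "t \<in> l ` S")
    case True
    with zero neg have "Re (ip (part t) (part t)) = 0" by force
    then show ?thesis using ip.diagonal_real[OF partD[of t]] by simp
  next
    case False
    then have "part t = 0" unfolding part_def by (intro sum.neutral) auto
    then show ?thesis using ip.zero_left[OF ip.D_zero] by simp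
  qed
  then have "\<forall>i\<in>S. c i = 0" by (intro indep) (simp add: part_def Let_def)
  with c(1) show False by blast
qed

end

section \<open>The space of square integrable functions\<close>

text \<open>Functions form an additive group pointwise; together with this scaling they are a complex vector
space, which lets the theory of forms apply to representatives.\<close>

definition fscale :: "complex \<Rightarrow> (real \<Rightarrow> complex) \<Rightarrow> real \<Rightarrow> complex" where
  "fscale c f = (\<lambda>t. c * f t)"

lemma fscale_apply [simp]: "fscale c f t = c * f t"
  by (simp add: fscale_def)

interpretation fvec: vector_space fscale
  by unfold_locales (auto simp: fun_eq_iff algebra_simps)

lemma fscale_sum_apply: "(\<Sum>i\<in>I. fscale (c i) (x i)) t = (\<Sum>i\<in>I. c i * x i t)"
  by (induction I rule: infinite_finite_induct) auto

lemma borel_measurable_cnj [measurable (raw)]: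
  "f \<in> borel_measurable M \<Longrightarrow> (\<lambda>x. cnj (f x)) \<in> borel_measurable M"
  by (rule borel_measurable_continuous_on[OF continuous_on_cnj[OF continuous_on_id]])

lemma cmod_mult_le_squares: "cmod x * cmod y \<le> (cmod x)\<^sup>2 + (cmod y)\<^sup>2"
proof -
  have "2 * (cmod x * cmod y) \<le> (cmod x)\<^sup>2 + (cmod y)\<^sup>2"
    using sum_squares_bound[of "cmod x" "cmod y"] by simp
  moreover have "0 \<le> cmod x * cmod y" by simp
  ultimately show ?thesis by linarith
qed

lemma L2_product_integrable:
  assumes "f \<in> L2_Rplus" "g \<in> L2_Rplus"
  shows "integrable Rplus (\<lambda>t. f t * cnj (g t))"
proof (rule Bochner_Integration.integrable_bound)
  show "integrable Rplus (\<lambda>t. (cmod (f t))\<^sup>2 + (cmod (g t))\<^sup>2)"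
    using assms by (auto simp: L2_Rplus_def)
  have [measurable]: "f \<in> borel_measurable Rplus" "g \<in> borel_measurable Rplus"
    using assms by (auto simp: L2_Rplus_def)
  show "(\<lambda>t. f t * cnj (g t)) \<in> borel_measurable Rplus" by measurable
  have "cmod (f t * cnj (g t)) \<le> (cmod (f t))\<^sup>2 + (cmod (g t))\<^sup>2" for t
    using cmod_mult_le_squares by (simp add: norm_mult)
  then show "AE t in Rplus. cmod (f t * cnj (g t)) \<le> norm ((cmod (f t))\<^sup>2 + (cmod (g t))\<^sup>2)"
    by (intro AE_I2) (smt (verit) real_norm_def)
qed

lemma cmod_add_squared_le: "(cmod (x + y))\<^sup>2 \<le> 2 * (cmod x)\<^sup>2 + 2 * (cmod y)\<^sup>2"
proof -
  have "(cmod (x + y))\<^sup>2 \<le> (cmod x + cmod y)\<^sup>2"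
    by (intro power_mono norm_triangle_ineq) auto
  also have "\<dots> \<le> 2 * (cmod x)\<^sup>2 + 2 * (cmod y)\<^sup>2"
    using sum_squares_bound[of "cmod x" "cmod y"] by (simp add: power2_sum)
  finally show ?thesis .
qed

lemma L2_subspace: "fvec.subspace L2_Rplus"
proof (rule fvec.subspaceI)
  show "0 \<in> L2_Rplus" by (simp add: L2_Rplus_def zero_fun_def)
next
  fix f g assume fg: "f \<in> L2_Rplus" "g \<in> L2_Rplus"
  then have [measurable]: "f \<in> borel_measurable Rplus" "g \<in> borel_measurable Rplus"
    by (auto simp: L2_Rplus_def)
  have "integrable Rplus (\<lambda>t. (cmod (f t + g t))\<^sup>2)"
  proof (rule Bochner_Integration.integrable_bound)
    show "integrable Rplus (\<lambda>t. 2 * (cmod (f t))\<^sup>2 + 2 * (cmod (g t))\<^sup>2)"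
      using fg by (auto simp: L2_Rplus_def)
    show "AE t in Rplus. norm ((cmod (f t + g t))\<^sup>2) \<le> norm (2 * (cmod (f t))\<^sup>2 + 2 * (cmod (g t))\<^sup>2)"
      using cmod_add_squared_le by (intro AE_I2) (simp add: abs_of_nonneg)
  qed measurable
  moreover have "f + g \<in> borel_measurable Rplus" unfolding plus_fun_def by measurable
  ultimately show "f + g \<in> L2_Rplus" by (simp add: L2_Rplus_def)
next
  fix c f assume f: "f \<in> L2_Rplus"
  then have [measurable]: "f \<in> borel_measurable Rplus" by (auto simp: L2_Rplus_def)
  have "fscale c f \<in> borel_measurable Rplus" unfolding fscale_def by measurable
  then show "fscale c f \<in> L2_Rplus"
    using f by (simp add: L2_Rplus_def norm_mult power_mult_distrib)
qed

lemma inner_L2_diagonal: "inner_L2 f f = of_real (\<integral>t. (cmod (f t))\<^sup>2 \<partial>Rplus)"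
  unfolding inner_L2_def complex_norm_square[symmetric] by (rule integral_complex_of_real)

interpretation L2: nonneg_form fscale L2_Rplus inner_L2
proof
  show "fvec.subspace L2_Rplus" by (rule L2_subspace)
next
  fix f g k assume "f \<in> L2_Rplus" "g \<in> L2_Rplus" "k \<in> L2_Rplus"
  then show "inner_L2 (f + g) k = inner_L2 f k + inner_L2 g k"
    by (simp add: inner_L2_def distrib_right L2_product_integrable)
next
  fix f g c assume "f \<in> L2_Rplus" "g \<in> L2_Rplus"
  then show "inner_L2 (fscale c f) g = c * inner_L2 f g"
    by (simp add: inner_L2_def mult.assoc)
next
  fix f g
  show "inner_L2 g f = cnj (inner_L2 f g)"
    unfolding inner_L2_def Bochner_Integration.integral_cnj[symmetric] by (simp add: mult.commute)
next
  fix f show "0 \<le> Re (inner_L2 f f)" by (simp add: inner_L2_diagonal)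
qed

lemma inner_L2_eq_0_iff:
  assumes "f \<in> L2_Rplus"
  shows "inner_L2 f f = 0 \<longleftrightarrow> (AE t in Rplus. f t = 0)"
  using integral_nonneg_eq_0_iff_AE[of Rplus "\<lambda>t. (cmod (f t))\<^sup>2"] assms
  by (simp add: inner_L2_diagonal L2_Rplus_def)

lemma AE_zero_inner:
  assumes "f \<in> L2_Rplus" "g \<in> L2_Rplus" "AE t in Rplus. f t = 0"
  shows "inner_L2 f g = 0"
proof -
  have "inner_L2 f f = 0" using assms inner_L2_eq_0_iff by blast
  then show ?thesis using L2.Cauchy_Schwarz[OF assms(1,2)] by simp
qed

lemma integrable_power_exp_real:
  assumes "a > 0"
  shows "integrable Rplus (\<lambda>t. t ^ k * exp (- a * t))"
proof -
  let ?f = "\<lambda>t. complex_of_real t powr (of_nat (Suc k) - 1) / of_real (exp (a * t))"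
  have "set_integrable lebesgue {0<..} ?f"
    using assms by (intro absolutely_integrable_Gamma_integral) auto
  then have "integrable Rplus ?f"
    by (simp add: set_integrable_def integrable_restrict_space)
  then have "integrable Rplus (\<lambda>t. cmod (?f t))" by (rule integrable_norm)
  moreover have "cmod (?f t) = t ^ k * exp (- a * t)" if "t \<in> space Rplus" for t
    using that by (simp add: powr_nat norm_divide norm_power exp_minus field_simps)
  ultimately show ?thesis using Bochner_Integration.integrable_cong[OF refl] by (metis (no_types, lifting))
qed

lemma measurable_continuous_Rplus:
  "continuous_on {0<..} f \<Longrightarrow> f \<in> borel_measurable Rplus" for f :: "real \<Rightarrow> 'a::euclidean_space"
  by (intro continuous_imp_measurable_on_sets_lebesgue) auto

lemma integrable_power_exp:
  fixes \<beta> :: complex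
  assumes "Re \<beta> > 0"
  shows "integrable Rplus (\<lambda>t. of_real t ^ k * exp (- \<beta> * of_real t))"
proof (rule Bochner_Integration.integrable_bound[OF integrable_power_exp_real[OF assms, of k]])
  show "(\<lambda>t. of_real t ^ k * exp (- \<beta> * of_real t)) \<in> borel_measurable Rplus"
    by (intro measurable_continuous_Rplus continuous_intros)
  show "AE t in Rplus. norm (of_real t ^ k * exp (- \<beta> * of_real t)) \<le> norm (t ^ k * exp (- Re \<beta> * t))"
    by (intro AE_I2) (simp add: norm_mult norm_power)
qed

text \<open>The fundamental theorem of calculus for interval integrals, restated for the measure used here.\<close>

lemma integral_Rplus_derivative:
  fixes F f :: "real \<Rightarrow> complex"
  assumes deriv: "\<And>t. t > 0 \<Longrightarrow> (F has_vector_derivative f t) (at t)"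
    and cont: "continuous_on UNIV f"
    and int: "integrable Rplus f"
    and lim: "(F \<longlongrightarrow> A) (at_right 0)" "(F \<longlongrightarrow> coupling) at_top"
  shows "(\<integral>t. f t \<partial>Rplus) = coupling - A"
proof -
  have e: "einterval 0 \<infinity> = {0<..}" by (auto simp: einterval_def)
  have meas: "f \<in> borel_measurable borel" using cont by (rule borel_measurable_continuous_onI)
  have "set_integrable lebesgue {0<..} f"
    using int by (simp add: set_integrable_def integrable_restrict_space)
  then have int': "set_integrable lborel {0<..} f"
    unfolding set_integrable_def using meas by (subst (asm) integrable_completion) auto
  have "(LBINT t=0..\<infinity>. f t) = coupling - A"
  proof (rule interval_integral_FTC_integrable)
    show "(F has_vector_derivative f t) (at t)" if "0 < ereal t" for t using deriv that by simp
    show "isCont f t" for t using cont by (simp add: continuous_on_eq_continuous_at)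
    show "set_integrable lborel (einterval 0 \<infinity>) f" using int' by (simp add: e)
    show "((F \<circ> real_of_ereal) \<longlongrightarrow> A) (at_right 0)"
      using lim(1) by (simp add: ereal_tendsto_simps1 zero_ereal_def)
    show "((F \<circ> real_of_ereal) \<longlongrightarrow> coupling) (at_left \<infinity>)"
      using lim(2) by (simp add: ereal_tendsto_simps1)
  qed auto
  also have "(LBINT t=0..\<infinity>. f t) = (LINT t:{0<..}|lborel. f t)"
    by (simp add: interval_lebesgue_integral_def e)
  also have "\<dots> = (LINT t:{0<..}|lebesgue. f t)"
    unfolding set_lebesgue_integral_def using meas by (subst integral_completion) auto
  also have "\<dots> = (\<integral>t. f t \<partial>Rplus)"
    by (simp add: set_lebesgue_integral_def integral_restrict_space)
  finally show ?thesis by simp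
qed

lemma tendsto_power_exp_at_top:
  fixes \<beta> :: complex
  assumes "Re \<beta> > 0"
  shows "((\<lambda>t. of_real t ^ k * exp (- \<beta> * of_real t)) \<longlongrightarrow> 0) at_top"
proof (rule Lim_null_comparison)
  have "((\<lambda>t::real. t ^ k / exp (Re \<beta> * t)) \<longlongrightarrow> 0) at_top"
    using assms by real_asymp
  then show "((\<lambda>t::real. \<bar>t ^ k * exp (- Re \<beta> * t)\<bar>) \<longlongrightarrow> 0) at_top"
    by (intro tendsto_rabs_zero) (simp add: exp_minus field_simps)
qed (simp add: norm_mult norm_power abs_mult power_abs)

text \<open>Integration by parts lowers the exponent; the boundary terms vanish except for \<open>k = 0\<close>.\<close>

lemma moment_exp:
  fixes \<beta> :: complex
  assumes "Re \<beta> > 0"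
  shows "(\<integral>t. of_real t ^ k * exp (- \<beta> * of_real t) \<partial>Rplus) = fact k / \<beta> ^ Suc k"
proof (induction k)
  have nz: "\<beta> \<noteq> 0" using assms by auto
  have der: "((\<lambda>t. - (of_real t ^ k * exp (- \<beta> * of_real t)) / \<beta>) has_vector_derivative
      (of_real t ^ k * exp (- \<beta> * of_real t) - of_nat k / \<beta> * (of_real t ^ (k - 1) * exp (- \<beta> * of_real t)))) (at t)"
    for k t
  proof -
    have "((\<lambda>z. - (z ^ k * exp (- \<beta> * z)) / \<beta>) has_field_derivative
      (of_real t ^ k * exp (- \<beta> * of_real t) - of_nat k / \<beta> * (of_real t ^ (k - 1) * exp (- \<beta> * of_real t))))
      (at (complex_of_real t))"
      using nz by (auto intro!: derivative_eq_intros simp: field_simps)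
    from has_vector_derivative_real_field[OF this] show ?thesis by simp
  qed
  have lim0: "((\<lambda>t. - (of_real t ^ k * exp (- \<beta> * of_real t)) / \<beta>) \<longlongrightarrow> - (0 ^ k) / \<beta>) (at_right 0)" for k
  proof -
    have "isCont (\<lambda>t. - (of_real t ^ k * exp (- \<beta> * of_real t)) / \<beta>) (0::real)"
      using nz by (intro continuous_intros) auto
    then have "((\<lambda>t. - (of_real t ^ k * exp (- \<beta> * of_real t)) / \<beta>) \<longlongrightarrow> - (0 ^ k) / \<beta>) (at (0::real))"
      by (simp add: isCont_def)
    then show ?thesis by (rule tendsto_within_subset) auto
  qed
  have lim1: "((\<lambda>t. - (of_real t ^ k * exp (- \<beta> * of_real t)) / \<beta>) \<longlongrightarrow> - 0 / \<beta>) at_top" for k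
    using nz by (intro tendsto_intros tendsto_power_exp_at_top assms)
  have rec: "(\<integral>t. (of_real t ^ k * exp (- \<beta> * of_real t)
      - of_nat k / \<beta> * (of_real t ^ (k - 1) * exp (- \<beta> * of_real t))) \<partial>Rplus) = - 0 / \<beta> - (- (0 ^ k) / \<beta>)" for k
    by (intro integral_Rplus_derivative[OF der _ _ lim0 lim1])
      (intro continuous_intros integrable_power_exp assms Bochner_Integration.integrable_diff
        integrable_mult_right)+
  {
    case 0
    show ?case using rec[of 0] by simp
  next
    case (Suc k)
    have "(\<integral>t. of_real t ^ Suc k * exp (- \<beta> * of_real t) \<partial>Rplus)
        = of_nat (Suc k) / \<beta> * (\<integral>t. of_real t ^ k * exp (- \<beta> * of_real t) \<partial>Rplus)"
      using rec[of "Suc k"] integrable_power_exp[OF assms] 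
      by (subst (asm) Bochner_Integration.integral_diff) (auto intro!: integrable_mult_right simp del: power_Suc of_nat_Suc)
    then show ?case unfolding Suc.IH using nz by (simp add: field_simps)
  }
qed

lemma exp_in_L2:
  fixes \<beta> :: complex
  assumes "Re \<beta> > 0"
  shows "(\<lambda>t. of_real t ^ k * exp (- \<beta> * of_real t)) \<in> L2_Rplus"
proof -
  have "integrable Rplus (\<lambda>t. t ^ (2 * k) * exp (- (2 * Re \<beta>) * t))"
    using assms by (intro integrable_power_exp_real) auto
  also have "(\<lambda>t. t ^ (2 * k) * exp (- (2 * Re \<beta>) * t))
      = (\<lambda>t. (cmod (of_real t ^ k * exp (- \<beta> * of_real t)))\<^sup>2)"
    by (simp add: fun_eq_iff norm_mult norm_power power_mult_distrib power_mult[symmetric]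
        power_even_abs mult.commute[of k] flip: exp_double)
  finally show ?thesis using integrable_power_exp[OF assms] by (simp add: L2_Rplus_def borel_measurable_integrable)
qed

section \<open>The Laplace transform and the closedness of the unperturbed form\<close>

definition exp_kernel :: "real \<Rightarrow> real \<Rightarrow> complex" where
  "exp_kernel l = (\<lambda>t. of_real (exp (- t * l)))"

lemma exp_kernel_L2: "l > 0 \<Longrightarrow> exp_kernel l \<in> L2_Rplus"
  using exp_in_L2[of "of_real l" 0] by (simp add: exp_kernel_def exp_of_real[symmetric] mult.commute)

lemma laplace_eq_inner: "laplace f l = inner_L2 f (exp_kernel l)"
  by (simp add: laplace_def inner_L2_def exp_kernel_def mult.commute)

lemma inner_exp_kernel: "l > 0 \<Longrightarrow> m > 0 \<Longrightarrow> inner_L2 (exp_kernel l) (exp_kernel m) = of_real (1 / (l + m))"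
proof -
  assume "l > 0" "m > 0"
  have "exp_kernel l t * cnj (exp_kernel m t) = of_real t ^ 0 * exp (- of_real (l + m) * of_real t)" for t
    by (simp add: exp_kernel_def exp_of_real[symmetric] exp_cnj exp_add[symmetric] algebra_simps)
  then show ?thesis
    using moment_exp[of "of_real (l + m)" 0] \<open>l > 0\<close> \<open>m > 0\<close> by (simp add: inner_L2_def)
qed

text \<open>The values of the Laplace transform are inner products with \<open>exp_kernel\<close>, and the explicit Gram
matrix \<open>1 / (l + m)\<close> shows that these kernels depend continuously on the parameter.\<close>

lemma laplace_continuous:
  assumes f: "f \<in> L2_Rplus"
  shows "continuous_on {0<..} (laplace f)"
  unfolding continuous_on_def
proof
  fix m :: real assume m: "m \<in> {0<..}"
  define g where "g l = sqrt (Re (inner_L2 f f)) * sqrt (1 / (l + l) + 1 / (m + m) - 2 * (1 / (l + m)))" for l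
  have bound: "cmod (laplace f l - laplace f m) \<le> g l" if "l > 0" for l
  proof -
    have "laplace f l - laplace f m = inner_L2 f (exp_kernel l - exp_kernel m)"
      using f m that by (simp add: laplace_eq_inner L2.diff_right exp_kernel_L2)
    also have "cmod \<dots> \<le> sqrt (Re (inner_L2 f f)) * sqrt (Re (inner_L2 (exp_kernel l - exp_kernel m) (exp_kernel l - exp_kernel m)))"
      using f m that by (intro L2.Cauchy_Schwarz_sqrt L2.D_diff exp_kernel_L2) auto
    also have "\<dots> = g l"
      unfolding g_def using m that by (simp add: L2.diagonal_diff exp_kernel_L2 inner_exp_kernel del: of_real_divide)
    finally show ?thesis .
  qed
  have "isCont g m" unfolding g_def using m by (intro continuous_intros) auto
  moreover have "g m = 0" using m by (simp add: g_def field_simps)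
  ultimately have "(g \<longlongrightarrow> 0) (at m within {0<..})"
    by (metis continuous_at_imp_continuous_at_within continuous_within)
  then have "((\<lambda>l. laplace f l - laplace f m) \<longlongrightarrow> 0) (at m within {0<..})"
    by (rule Lim_null_comparison[rotated]) (auto simp: eventually_at_filter bound)
  then show "(laplace f \<longlongrightarrow> laplace f m) (at m within {0<..})" by (rule LIM_zero_cancel)
qed

lemma laplace_measurable: "f \<in> L2_Rplus \<Longrightarrow> laplace f \<in> borel_measurable Rplus"
  by (intro measurable_continuous_Rplus laplace_continuous)

lemma laplace_add: "\<lbrakk>f \<in> L2_Rplus; g \<in> L2_Rplus; l > 0\<rbrakk> \<Longrightarrow> laplace (f + g) l = laplace f l + laplace g l"
  by (simp add: laplace_eq_inner L2.add_left exp_kernel_L2)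

lemma laplace_scale: "\<lbrakk>f \<in> L2_Rplus; l > 0\<rbrakk> \<Longrightarrow> laplace (fscale c f) l = c * laplace f l"
  by (simp add: laplace_eq_inner L2.scale_left exp_kernel_L2)

lemma laplace_diff: "\<lbrakk>f \<in> L2_Rplus; g \<in> L2_Rplus; l > 0\<rbrakk> \<Longrightarrow> laplace (f - g) l = laplace f l - laplace g l"
  by (simp add: laplace_eq_inner L2.diff_left exp_kernel_L2)

lemma Fatou_bounded:
  fixes \<phi> :: "nat \<Rightarrow> 'a \<Rightarrow> real"
  assumes meas: "\<psi> \<in> borel_measurable M"
    and int: "\<And>k. integrable M (\<phi> k)" and nonneg: "\<And>k. AE x in M. 0 \<le> \<phi> k x"
    and lim: "AE x in M. (\<lambda>k. \<phi> k x) \<longlonglongrightarrow> \<psi> x"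
    and bound: "\<And>k. k \<ge> N \<Longrightarrow> (\<integral>x. \<phi> k x \<partial>M) \<le> \<epsilon>" and \<epsilon>: "0 \<le> \<epsilon>"
  shows "integrable M \<psi> \<and> (\<integral>x. \<psi> x \<partial>M) \<le> \<epsilon>"
proof -
  have "AE x in M. \<forall>k. 0 \<le> \<phi> k x" using nonneg by (simp add: AE_all_countable)
  with lim have psi: "AE x in M. 0 \<le> \<psi> x" by eventually_elim (auto intro: LIMSEQ_le_const)
  have meas_k: "\<phi> k \<in> borel_measurable M" for k using int by blast
  have "(\<integral>\<^sup>+x. ennreal (\<psi> x) \<partial>M) = (\<integral>\<^sup>+x. liminf (\<lambda>k. ennreal (\<phi> k x)) \<partial>M)"
  proof (rule nn_integral_cong_AE)
    show "AE x in M. ennreal (\<psi> x) = liminf (\<lambda>k. ennreal (\<phi> k x))"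
      using lim by eventually_elim (auto intro!: lim_imp_Liminf[symmetric] tendsto_ennrealI)
  qed
  also have "\<dots> \<le> liminf (\<lambda>k. \<integral>\<^sup>+x. ennreal (\<phi> k x) \<partial>M)"
    using meas_k by (intro nn_integral_liminf) auto
  also have "\<dots> \<le> ennreal \<epsilon>"
  proof (rule Liminf_le)
    have "(\<integral>\<^sup>+x. ennreal (\<phi> k x) \<partial>M) \<le> ennreal \<epsilon>" if "k \<ge> N" for k
      using nn_integral_eq_integral[OF int nonneg] bound[OF that] by (simp add: ennreal_leI)
    then show "\<forall>\<^sub>F k in sequentially. (\<integral>\<^sup>+x. ennreal (\<phi> k x) \<partial>M) \<le> ennreal \<epsilon>"
      by (auto simp: eventually_sequentially)
  qed auto
  finally have le: "(\<integral>\<^sup>+x. ennreal (\<psi> x) \<partial>M) \<le> ennreal \<epsilon>" .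
  then have int_psi: "integrable M \<psi>"
    by (intro integrableI_nonneg meas psi) (auto simp: le_less_trans)
  moreover have "(\<integral>x. \<psi> x \<partial>M) \<le> \<epsilon>"
    using le nn_integral_eq_integral[OF int_psi psi] \<epsilon> by simp
  ultimately show ?thesis ..
qed

text \<open>Adding up the thresholds makes them strictly increasing.\<close>

lemma fast_Cauchy_subsequence:
  fixes P :: "nat \<Rightarrow> nat \<Rightarrow> nat \<Rightarrow> bool"
  assumes "\<And>k. \<exists>N. \<forall>m\<ge>N. \<forall>n\<ge>N. P k m n"
  shows "\<exists>r. strict_mono r \<and> (\<forall>k. \<forall>m\<ge>r k. \<forall>n\<ge>r k. P k m n)"
proof -
  obtain N where N: "\<And>k m n. m \<ge> N k \<Longrightarrow> n \<ge> N k \<Longrightarrow> P k m n" using assms by metis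
  define r :: "nat \<Rightarrow> nat" where "r k = (\<Sum>i\<le>k. N i) + k" for k
  have "strict_mono r" by (auto simp: strict_mono_Suc_iff r_def)
  moreover have "N k \<le> r k" for k
    unfolding r_def using member_le_sum[of k "{..k}" N] by simp
  ultimately show ?thesis using N by (meson order.trans)
qed

text \<open>Along a subsequence whose increments \<open>u k\<close> satisfy \<open>\<parallel>u k\<parallel>\<^sup>2 \<le> 8\<^sup>-\<^sup>k\<close> the function \<open>\<Sum> 4\<^sup>k \<bar>u k\<bar>\<^sup>2\<close> is integrable, hence
finite almost everywhere, and there \<open>\<bar>u k\<bar>\<close> decays geometrically.\<close>

lemma L2_Cauchy_AE_limit:
  fixes f :: "nat \<Rightarrow> real \<Rightarrow> complex"
  assumes f: "\<And>n. f n \<in> L2_Rplus"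
    and cauchy: "\<And>\<epsilon>. \<epsilon> > 0 \<Longrightarrow> \<exists>N. \<forall>m\<ge>N. \<forall>n\<ge>N. Re (inner_L2 (f m - f n) (f m - f n)) \<le> \<epsilon>"
  shows "\<exists>r g. strict_mono r \<and> g \<in> borel_measurable Rplus \<and> (AE t in Rplus. (\<lambda>k. f (r k) t) \<longlonglongrightarrow> g t)"
proof -
  obtain r where r: "strict_mono r"
    and rc: "\<And>k m n. m \<ge> r k \<Longrightarrow> n \<ge> r k \<Longrightarrow> Re (inner_L2 (f m - f n) (f m - f n)) \<le> (1 / 8) ^ k"
    using fast_Cauchy_subsequence[of "\<lambda>k m n. Re (inner_L2 (f m - f n) (f m - f n)) \<le> (1 / 8) ^ k"]
      cauchy[of "(1 / 8) ^ _"] by auto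
  have [measurable]: "f n \<in> borel_measurable Rplus" for n using f by (auto simp: L2_Rplus_def)
  define u where "u k t = f (r (Suc k)) t - f (r k) t" for k t
  have u: "u k = f (r (Suc k)) - f (r k)" for k by (simp add: u_def fun_eq_iff)
  have uL2: "u k \<in> L2_Rplus" for k unfolding u by (intro L2.D_diff f)
  have [measurable]: "u k \<in> borel_measurable Rplus" for k using uL2 by (auto simp: L2_Rplus_def)
  have int: "(\<integral>\<^sup>+t. ennreal (4 ^ k * (cmod (u k t))\<^sup>2) \<partial>Rplus) \<le> ennreal ((1 / 2) ^ k)" for k
  proof -
    have "(\<integral>t. (cmod (u k t))\<^sup>2 \<partial>Rplus) \<le> (1 / 8) ^ k"
      using rc[of k "r (Suc k)" "r k"] r by (simp add: u inner_L2_diagonal strict_mono_less_eq)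
    then have "(\<integral>t. 4 ^ k * (cmod (u k t))\<^sup>2 \<partial>Rplus) \<le> 4 ^ k * (1 / 8) ^ k" by simp
    also have "\<dots> = (1 / 2) ^ k" by (simp flip: power_mult_distrib)
    finally show ?thesis
      using uL2[of k] by (subst nn_integral_eq_integral) (auto simp: L2_Rplus_def ennreal_leI)
  qed
  have "(\<integral>\<^sup>+t. (\<Sum>k. ennreal (4 ^ k * (cmod (u k t))\<^sup>2)) \<partial>Rplus)
      = (\<Sum>k. \<integral>\<^sup>+t. ennreal (4 ^ k * (cmod (u k t))\<^sup>2) \<partial>Rplus)"
    by (intro nn_integral_suminf) measurable
  also have "\<dots> \<le> (\<Sum>k. ennreal ((1 / 2) ^ k))" by (intro suminf_le int) auto
  also have "\<dots> < \<infinity>" by (simp add: suminf_ennreal2 summable_geometric)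
  finally have "AE t in Rplus. (\<Sum>k. ennreal (4 ^ k * (cmod (u k t))\<^sup>2)) \<noteq> \<infinity>"
    by (intro nn_integral_noteq_infinite) auto
  then have AE: "AE t in Rplus. convergent (\<lambda>k. f (r k) t)"
  proof eventually_elim
    case (elim t)
    then have summ: "summable (\<lambda>k. 4 ^ k * (cmod (u k t))\<^sup>2)"
      by (intro summable_suminf_not_top) auto
    define S where "S = (\<Sum>k. 4 ^ k * (cmod (u k t))\<^sup>2)"
    have "cmod (u k t) \<le> sqrt S * (1 / 2) ^ k" for k
    proof -
      have "4 ^ k * (cmod (u k t))\<^sup>2 \<le> S"
        unfolding S_def using sum_le_suminf[OF summ, of "{k}"] by simp
      moreover have "(4::real) ^ k = (2 ^ k)\<^sup>2"
        by (simp add: power_mult[symmetric] mult.commute[of k] power_mult)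
      then have "4 ^ k * (cmod (u k t))\<^sup>2 = (2 ^ k * cmod (u k t))\<^sup>2"
        by (simp only: power_mult_distrib)
      ultimately have "2 ^ k * cmod (u k t) \<le> sqrt S" by (intro real_le_rsqrt) simp
      then show ?thesis by (simp add: field_simps power_divide)
    qed
    moreover have "summable (\<lambda>k. sqrt S * (1 / 2) ^ k)"
      by (rule summable_mult[OF summable_geometric]) simp
    ultimately have "summable (\<lambda>k. u k t)"
      by (rule summable_comparison_test'[rotated, where N = 0])
    then have "convergent (\<lambda>n. \<Sum>k<n. u k t)" by (simp add: summable_iff_convergent)
    moreover have "(\<Sum>k<n. u k t) = f (r n) t - f (r 0) t" for n
      unfolding u_def by (rule sum_lessThan_telescope)
    ultimately have "convergent (\<lambda>n. (f (r n) t - f (r 0) t) + f (r 0) t)"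
      by (intro convergent_add convergent_const) simp
    then show ?case by simp
  qed
  have "(\<lambda>t. lim (\<lambda>k. f (r k) t)) \<in> borel_measurable Rplus" by (rule borel_measurable_lim_metric) measurable
  moreover have "AE t in Rplus. (\<lambda>k. f (r k) t) \<longlonglongrightarrow> lim (\<lambda>k. f (r k) t)"
    using AE by eventually_elim (simp add: convergent_LIMSEQ_iff)
  ultimately show ?thesis using r by blast
qed

locale weight =
  fixes \<sigma> :: "real \<Rightarrow> real"
  assumes \<sigma>_nonneg: "\<And>l. l > 0 \<Longrightarrow> \<sigma> l \<ge> 0"
    and \<sigma>_measurable [measurable]: "\<sigma> \<in> borel_measurable Rplus"
begin

lemma dom_L2: "f \<in> dom_h0 \<sigma> \<Longrightarrow> f \<in> L2_Rplus" by (simp add: dom_h0_def)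

lemma h0_integrable:
  assumes "f \<in> dom_h0 \<sigma>" "g \<in> dom_h0 \<sigma>"
  shows "integrable Rplus (\<lambda>l. laplace f l * cnj (laplace g l) * of_real (\<sigma> l))"
proof (rule Bochner_Integration.integrable_bound)
  show "integrable Rplus (\<lambda>l. (cmod (laplace f l))\<^sup>2 * \<sigma> l + (cmod (laplace g l))\<^sup>2 * \<sigma> l)"
    using assms by (auto simp: dom_h0_def)
  have [measurable]: "laplace f \<in> borel_measurable Rplus" "laplace g \<in> borel_measurable Rplus"
    using assms by (auto intro: laplace_measurable dom_L2)
  show "(\<lambda>l. laplace f l * cnj (laplace g l) * of_real (\<sigma> l)) \<in> borel_measurable Rplus" by measurable
  have "cmod (laplace f l * cnj (laplace g l) * of_real (\<sigma> l))
      \<le> norm ((cmod (laplace f l))\<^sup>2 * \<sigma> l + (cmod (laplace g l))\<^sup>2 * \<sigma> l)" if "l > 0" for l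
  proof -
    from mult_right_mono[OF cmod_mult_le_squares[of "laplace f l" "laplace g l"] \<sigma>_nonneg[OF that]] \<sigma>_nonneg[OF that] show ?thesis
      by (simp add: norm_mult distrib_right)
  qed
  then show "AE l in Rplus. cmod (laplace f l * cnj (laplace g l) * of_real (\<sigma> l))
      \<le> norm ((cmod (laplace f l))\<^sup>2 * \<sigma> l + (cmod (laplace g l))\<^sup>2 * \<sigma> l)"
    by (intro AE_I2) auto
qed

lemma h0_diagonal: "h0 \<sigma> f f = of_real (\<integral>l. (cmod (laplace f l))\<^sup>2 * \<sigma> l \<partial>Rplus)"
  unfolding h0_def complex_norm_square[symmetric] of_real_mult[symmetric] by (rule integral_complex_of_real)

lemma dom_subspace: "fvec.subspace (dom_h0 \<sigma>)"
proof (rule fvec.subspaceI)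
  show "0 \<in> dom_h0 \<sigma>" using L2.D_zero by (simp add: dom_h0_def laplace_def)
next
  fix f g assume fg: "f \<in> dom_h0 \<sigma>" "g \<in> dom_h0 \<sigma>"
  note L2 = fg[THEN dom_L2]
  have "integrable Rplus (\<lambda>l. (cmod (laplace (f + g) l))\<^sup>2 * \<sigma> l)"
  proof (rule Bochner_Integration.integrable_bound)
    show "integrable Rplus (\<lambda>l. 2 * ((cmod (laplace f l))\<^sup>2 * \<sigma> l) + 2 * ((cmod (laplace g l))\<^sup>2 * \<sigma> l))"
      using fg by (auto simp: dom_h0_def)
    have [measurable]: "laplace (f + g) \<in> borel_measurable Rplus"
      using L2 by (intro laplace_measurable L2.D_add)
    show "(\<lambda>l. (cmod (laplace (f + g) l))\<^sup>2 * \<sigma> l) \<in> borel_measurable Rplus" by measurable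
    have "(cmod (laplace (f + g) l))\<^sup>2 * \<sigma> l
        \<le> 2 * ((cmod (laplace f l))\<^sup>2 * \<sigma> l) + 2 * ((cmod (laplace g l))\<^sup>2 * \<sigma> l)" if "l > 0" for l
      using mult_right_mono[OF cmod_add_squared_le[of "laplace f l" "laplace g l"] \<sigma>_nonneg[OF that]]
      by (simp add: laplace_add L2 that algebra_simps)
    then show "AE l in Rplus. norm ((cmod (laplace (f + g) l))\<^sup>2 * \<sigma> l)
        \<le> norm (2 * ((cmod (laplace f l))\<^sup>2 * \<sigma> l) + 2 * ((cmod (laplace g l))\<^sup>2 * \<sigma> l))"
      using \<sigma>_nonneg by (intro AE_I2) (simp add: abs_of_nonneg)
  qed
  then show "f + g \<in> dom_h0 \<sigma>" using L2 by (simp add: dom_h0_def L2.D_add)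
next
  fix c f assume f: "f \<in> dom_h0 \<sigma>"
  have "integrable Rplus (\<lambda>l. (cmod (laplace (fscale c f) l))\<^sup>2 * \<sigma> l)
      \<longleftrightarrow> integrable Rplus (\<lambda>l. (cmod c)\<^sup>2 * ((cmod (laplace f l))\<^sup>2 * \<sigma> l))"
    using dom_L2[OF f]
    by (intro Bochner_Integration.integrable_cong refl) (simp add: laplace_scale norm_mult power_mult_distrib)
  then show "fscale c f \<in> dom_h0 \<sigma>" using f by (auto simp: dom_h0_def L2.D_scale)
qed

sublocale h0: nonneg_form fscale "dom_h0 \<sigma>" "h0 \<sigma>"
proof
  show "fvec.subspace (dom_h0 \<sigma>)" by (rule dom_subspace)
next
  fix f g k assume fgk: "f \<in> dom_h0 \<sigma>" "g \<in> dom_h0 \<sigma>" "k \<in> dom_h0 \<sigma>"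
  have "h0 \<sigma> (f + g) k = (\<integral>l. laplace f l * cnj (laplace k l) * of_real (\<sigma> l)
      + laplace g l * cnj (laplace k l) * of_real (\<sigma> l) \<partial>Rplus)"
    unfolding h0_def using fgk
    by (intro Bochner_Integration.integral_cong refl) (simp add: laplace_add dom_L2 algebra_simps)
  also have "\<dots> = h0 \<sigma> f k + h0 \<sigma> g k"
    unfolding h0_def using fgk by (intro Bochner_Integration.integral_add h0_integrable)
  finally show "h0 \<sigma> (f + g) k = h0 \<sigma> f k + h0 \<sigma> g k" .
next
  fix f k c assume fk: "f \<in> dom_h0 \<sigma>" "k \<in> dom_h0 \<sigma>"
  have "h0 \<sigma> (fscale c f) k = (\<integral>l. c * (laplace f l * cnj (laplace k l) * of_real (\<sigma> l)) \<partial>Rplus)"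
    unfolding h0_def using fk
    by (intro Bochner_Integration.integral_cong refl) (simp add: laplace_scale dom_L2 algebra_simps)
  then show "h0 \<sigma> (fscale c f) k = c * h0 \<sigma> f k" by (simp add: h0_def)
next
  fix f g
  show "h0 \<sigma> g f = cnj (h0 \<sigma> f g)"
    unfolding h0_def Bochner_Integration.integral_cnj[symmetric] by (simp add: mult_ac)
next
  fix f
  show "0 \<le> Re (h0 \<sigma> f f)"
    unfolding h0_diagonal using \<sigma>_nonneg by (auto intro!: Bochner_Integration.integral_nonneg_AE AE_I2)
qed

text \<open>Both summands are handled by Fatou's lemma: the increments bound the distance to an almost
everywhere limit. For the second summand the pointwise limit comes for free, since convergence in \<open>L\<^sup>2\<close>
implies convergence of the Laplace transforms at every point.\<close>

theorem h0_complete: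
  fixes f :: "nat \<Rightarrow> real \<Rightarrow> complex"
  assumes f: "\<And>n. f n \<in> dom_h0 \<sigma>"
    and cauchy: "\<And>\<epsilon>. \<epsilon> > 0 \<Longrightarrow> \<exists>N. \<forall>m\<ge>N. \<forall>n\<ge>N.
      Re (inner_L2 (f m - f n) (f m - f n)) + Re (h0 \<sigma> (f m - f n) (f m - f n)) \<le> \<epsilon>"
  shows "\<exists>g\<in>dom_h0 \<sigma>. (\<lambda>n. Re (inner_L2 (f n - g) (f n - g))) \<longlonglongrightarrow> 0
      \<and> (\<lambda>n. Re (h0 \<sigma> (f n - g) (f n - g))) \<longlonglongrightarrow> 0"
proof -
  note fL2 = f[THEN dom_L2]
  have split: "Re (inner_L2 (f m - f n) (f m - f n)) \<le> \<epsilon> \<and> Re (h0 \<sigma> (f m - f n) (f m - f n)) \<le> \<epsilon>"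
    if "Re (inner_L2 (f m - f n) (f m - f n)) + Re (h0 \<sigma> (f m - f n) (f m - f n)) \<le> \<epsilon>" for m n \<epsilon>
    using that L2.nonneg[OF L2.D_diff[OF fL2 fL2], of m n] h0.nonneg[OF h0.D_diff[OF f f], of m n] by linarith
  have "\<exists>r g. strict_mono r \<and> g \<in> borel_measurable Rplus \<and> (AE t in Rplus. (\<lambda>k. f (r k) t) \<longlonglongrightarrow> g t)"
  proof (rule L2_Cauchy_AE_limit[OF fL2])
    fix \<epsilon> :: real assume "\<epsilon> > 0"
    from cauchy[OF this] split
    show "\<exists>N. \<forall>m\<ge>N. \<forall>n\<ge>N. Re (inner_L2 (f m - f n) (f m - f n)) \<le> \<epsilon>" by meson
  qed
  then obtain r g where r: "strict_mono r" and [measurable]: "g \<in> borel_measurable Rplus"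
    and lim: "AE t in Rplus. (\<lambda>k. f (r k) t) \<longlonglongrightarrow> g t" by blast
  have [measurable]: "f n \<in> borel_measurable Rplus" for n using fL2 by (auto simp: L2_Rplus_def)
  have fatou1: "integrable Rplus (\<lambda>t. (cmod (f n t - g t))\<^sup>2) \<and>
    (\<integral>t. (cmod (f n t - g t))\<^sup>2 \<partial>Rplus) \<le> \<epsilon>"
    if N: "\<And>m. m \<ge> N \<Longrightarrow> Re (inner_L2 (f n - f m) (f n - f m)) \<le> \<epsilon>" and \<epsilon>: "0 \<le> \<epsilon>" for n N \<epsilon>
  proof (rule Fatou_bounded[where \<phi> = "\<lambda>k t. (cmod (f n t - f (r k) t))\<^sup>2" and N = N])
    show "AE t in Rplus. (\<lambda>k. (cmod (f n t - f (r k) t))\<^sup>2) \<longlonglongrightarrow> (cmod (f n t - g t))\<^sup>2"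
      using lim by eventually_elim (intro tendsto_intros)
    show "integrable Rplus (\<lambda>t. (cmod (f n t - f (r k) t))\<^sup>2)" for k
      using L2.D_diff[OF fL2[of n] fL2[of "r k"]] by (simp add: L2_Rplus_def)
    fix k assume "k \<ge> N"
    then have "r k \<ge> N" using seq_suble[OF r, of k] by simp
    from N[OF this] show "(\<integral>t. (cmod (f n t - f (r k) t))\<^sup>2 \<partial>Rplus) \<le> \<epsilon>"
      by (simp add: inner_L2_diagonal)
  qed (use \<epsilon> in auto)
  obtain N1 where "\<forall>m\<ge>N1. \<forall>n\<ge>N1. Re (inner_L2 (f m - f n) (f m - f n)) \<le> 1"
    using cauchy[of 1] split by (metis zero_less_one)
  then have "integrable Rplus (\<lambda>t. (cmod (f N1 t - g t))\<^sup>2)" by (intro fatou1[THEN conjunct1, of N1 _ 1]) auto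
  then have "f N1 - g \<in> L2_Rplus"
    by (simp add: L2_Rplus_def fun_diff_def)
  then have "f N1 - (f N1 - g) \<in> L2_Rplus" by (rule L2.D_diff[OF fL2])
  then have gL2: "g \<in> L2_Rplus" by simp
  have lim1: "(\<lambda>n. Re (inner_L2 (f n - g) (f n - g))) \<longlonglongrightarrow> 0"
  proof (rule LIMSEQ_I)
    fix \<epsilon> :: real assume \<epsilon>: "\<epsilon> > 0"
    obtain N where N: "\<forall>m\<ge>N. \<forall>n\<ge>N. Re (inner_L2 (f m - f n) (f m - f n)) \<le> \<epsilon> / 2"
      using cauchy[of "\<epsilon> / 2"] \<epsilon> split by (metis half_gt_zero)
    have "norm (Re (inner_L2 (f n - g) (f n - g)) - 0) < \<epsilon>" if "n \<ge> N" for n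
      using fatou1[THEN conjunct2, of N n "\<epsilon> / 2"] N that \<epsilon> by (simp add: inner_L2_diagonal)
    then show "\<exists>N. \<forall>n\<ge>N. norm (Re (inner_L2 (f n - g) (f n - g)) - 0) < \<epsilon>" by blast
  qed
  have laplace_lim: "(\<lambda>n. laplace (f n) l) \<longlonglongrightarrow> laplace g l" if "l > 0" for l
    unfolding laplace_eq_inner by (intro L2.tendsto_left fL2 gL2 exp_kernel_L2 that lim1)
  have [measurable]: "laplace (f n) \<in> borel_measurable Rplus" for n
    by (intro laplace_measurable fL2)
  have [measurable]: "laplace g \<in> borel_measurable Rplus" by (intro laplace_measurable gL2)
  have h0_diff: "Re (h0 \<sigma> (p - q) (p - q)) = (\<integral>l. (cmod (laplace p l - laplace q l))\<^sup>2 * \<sigma> l \<partial>Rplus)"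
    if "p \<in> L2_Rplus" "q \<in> L2_Rplus" for p q
    unfolding h0_diagonal Re_complex_of_real
    by (intro Bochner_Integration.integral_cong refl) (simp add: laplace_diff that)
  have int_diff: "integrable Rplus (\<lambda>l. (cmod (laplace p l - laplace q l))\<^sup>2 * \<sigma> l)
      \<longleftrightarrow> integrable Rplus (\<lambda>l. (cmod (laplace (p - q) l))\<^sup>2 * \<sigma> l)"
    if "p \<in> L2_Rplus" "q \<in> L2_Rplus" for p q
    by (intro Bochner_Integration.integrable_cong refl) (simp add: laplace_diff that)
  have fatou2: "integrable Rplus (\<lambda>l. (cmod (laplace (f n) l - laplace g l))\<^sup>2 * \<sigma> l) \<and>
    (\<integral>l. (cmod (laplace (f n) l - laplace g l))\<^sup>2 * \<sigma> l \<partial>Rplus) \<le> \<epsilon>"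
    if N: "\<And>m. m \<ge> N \<Longrightarrow> Re (h0 \<sigma> (f n - f m) (f n - f m)) \<le> \<epsilon>" and \<epsilon>: "0 \<le> \<epsilon>" for n N \<epsilon>
  proof (rule Fatou_bounded[where \<phi> = "\<lambda>k l. (cmod (laplace (f n) l - laplace (f k) l))\<^sup>2 * \<sigma> l" and N = N])
    show "AE l in Rplus. (\<lambda>k. (cmod (laplace (f n) l - laplace (f k) l))\<^sup>2 * \<sigma> l)
        \<longlonglongrightarrow> (cmod (laplace (f n) l - laplace g l))\<^sup>2 * \<sigma> l"
      by (intro AE_I2 tendsto_intros laplace_lim) simp
    show "integrable Rplus (\<lambda>l. (cmod (laplace (f n) l - laplace (f k) l))\<^sup>2 * \<sigma> l)" for k
      using int_diff[OF fL2 fL2] h0.D_diff[OF f[of n] f[of k]] by (simp add: dom_h0_def)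
    show "(\<integral>l. (cmod (laplace (f n) l - laplace (f k) l))\<^sup>2 * \<sigma> l \<partial>Rplus) \<le> \<epsilon>" if "k \<ge> N" for k
      using N[OF that] h0_diff[OF fL2 fL2] by simp
  qed (use \<epsilon> \<sigma>_nonneg in auto)
  obtain N2 where "\<forall>m\<ge>N2. \<forall>n\<ge>N2. Re (h0 \<sigma> (f m - f n) (f m - f n)) \<le> 1"
    using cauchy[of 1] split by (metis zero_less_one)
  then have "integrable Rplus (\<lambda>l. (cmod (laplace (f N2) l - laplace g l))\<^sup>2 * \<sigma> l)"
    by (intro fatou2[THEN conjunct1, of N2 _ 1]) auto
  then have "f N2 - g \<in> dom_h0 \<sigma>"
    using int_diff[OF fL2 gL2] L2.D_diff[OF fL2 gL2] by (simp add: dom_h0_def)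
  then have "f N2 - (f N2 - g) \<in> dom_h0 \<sigma>" by (rule h0.D_diff[OF f])
  then have "g \<in> dom_h0 \<sigma>" by simp
  moreover have "(\<lambda>n. Re (h0 \<sigma> (f n - g) (f n - g))) \<longlonglongrightarrow> 0"
  proof (rule LIMSEQ_I)
    fix \<epsilon> :: real assume \<epsilon>: "\<epsilon> > 0"
    obtain N where N: "\<forall>m\<ge>N. \<forall>n\<ge>N. Re (h0 \<sigma> (f m - f n) (f m - f n)) \<le> \<epsilon> / 2"
      using cauchy[of "\<epsilon> / 2"] \<epsilon> split by (metis half_gt_zero)
    have "norm (Re (h0 \<sigma> (f n - g) (f n - g)) - 0) < \<epsilon>" if "n \<ge> N" for n
      using fatou2[THEN conjunct2, of N n "\<epsilon> / 2"] N that \<epsilon> h0.nonneg[of "f n - g"] h0.D_diff[OF f[of n] \<open>g \<in> dom_h0 \<sigma>\<close>]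
      by (simp add: h0_diff[OF fL2 gL2])
    then show "\<exists>N. \<forall>n\<ge>N. norm (Re (h0 \<sigma> (f n - g) (f n - g)) - 0) < \<epsilon>" by blast
  qed
  ultimately show ?thesis using lim1 by blast
qed

end

section \<open>The Hankel form in terms of jets\<close>

text \<open>The involution \<open>star\<close> expresses that the symbol is real: it fixes the indices of real exponents and
exchanges those of conjugate exponents.\<close>

locale exp_poly_symbol =
  fixes Ix :: "nat set" and star :: "nat \<Rightarrow> nat" and \<beta> :: "nat \<Rightarrow> complex"
    and P :: "nat \<Rightarrow> complex poly"
  assumes finite_Ix: "finite Ix"
    and star_in: "m \<in> Ix \<Longrightarrow> star m \<in> Ix"
    and star_star: "m \<in> Ix \<Longrightarrow> star (star m) = m"
    and \<beta>_star: "m \<in> Ix \<Longrightarrow> \<beta> (star m) = cnj (\<beta> m)"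
    and P_star: "m \<in> Ix \<Longrightarrow> coeff (P (star m)) k = cnj (coeff (P m) k)"
    and inj_\<beta>: "inj_on \<beta> Ix"
    and Re_\<beta>: "m \<in> Ix \<Longrightarrow> Re (\<beta> m) > 0"
    and P_nz: "m \<in> Ix \<Longrightarrow> P m \<noteq> 0"
begin

abbreviation K where "K m \<equiv> degree (P m)"

definition idx :: "(nat \<times> nat) set" where
  "idx = Sigma Ix (\<lambda>m. {..K m})"

definition moment_kernel :: "nat \<times> nat \<Rightarrow> real \<Rightarrow> complex" where
  "moment_kernel i = (\<lambda>t. of_real t ^ snd i * exp (- cnj (\<beta> (fst i)) * of_real t))"

text \<open>Up to sign, the \<open>a\<close>-th Taylor coefficient of the Laplace transform of \<open>f\<close> at \<open>\<beta> m\<close>, for the index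
\<open>(m, a)\<close>. The conjugation in \<open>moment_kernel\<close> undoes the one in the inner product.\<close>

definition jet :: "nat \<times> nat \<Rightarrow> (real \<Rightarrow> complex) \<Rightarrow> complex" where
  "jet i f = inner_L2 f (moment_kernel i) / fact (snd i)"

text \<open>The derivatives of \<open>P m\<close> at \<open>0\<close>.\<close>

definition q :: "nat \<Rightarrow> nat \<Rightarrow> complex" where
  "q m k = fact k * coeff (P m) k"

definition coupling :: "nat \<times> nat \<Rightarrow> nat \<times> nat \<Rightarrow> complex" where
  "coupling i j = (if fst j = star (fst i) \<and> snd i + snd j \<le> K (fst i) then q (fst i) (snd i + snd j) else 0)"

definition bform :: "(real \<Rightarrow> complex) \<Rightarrow> (real \<Rightarrow> complex) \<Rightarrow> complex" where
  "bform f g = (\<Sum>i\<in>idx. \<Sum>j\<in>idx. coupling i j * jet i f * cnj (jet j g))"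

lemma finite_idx: "finite idx"
  using finite_Ix by (simp add: idx_def)

lemma K_star: "m \<in> Ix \<Longrightarrow> K (star m) = K m"
proof -
  assume m: "m \<in> Ix"
  have "coeff (P (star m)) k = 0 \<longleftrightarrow> coeff (P m) k = 0" for k
    using P_star[OF m, of k] by simp
  then show ?thesis by (metis le_degree leading_coeff_0_iff order_antisym P_nz m star_in)
qed

lemma q_star: "m \<in> Ix \<Longrightarrow> q (star m) k = cnj (q m k)"
  by (simp add: q_def P_star)

lemma coupling_hermitian: "i \<in> idx \<Longrightarrow> j \<in> idx \<Longrightarrow> coupling j i = cnj (coupling i j)"
  by (auto simp: coupling_def idx_def star_star K_star q_star add.commute)

lemma moment_kernel_L2: "i \<in> idx \<Longrightarrow> moment_kernel i \<in> L2_Rplus"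
  unfolding moment_kernel_def using Re_\<beta> by (intro exp_in_L2) (auto simp: idx_def)

lemma sum_coupling:
  assumes "(m, b) \<in> idx"
  shows "(\<Sum>j\<in>idx. coupling (m, b) j * X j) = (\<Sum>a\<le>K m - b. q m (b + a) * X (star m, a))"
proof -
  have m: "m \<in> Ix" "b \<le> K m" using assms by (auto simp: idx_def)
  have "(\<Sum>j\<in>idx. coupling (m, b) j * X j) = (\<Sum>j\<in>Pair (star m) ` {..K m - b}. coupling (m, b) j * X j)"
  proof (rule sum.mono_neutral_right[OF finite_idx])
    show "Pair (star m) ` {..K m - b} \<subseteq> idx"
      using m star_in by (auto simp: idx_def K_star)
    show "\<forall>j\<in>idx - Pair (star m) ` {..K m - b}. coupling (m, b) j * X j = 0"
      using m by (auto simp: coupling_def image_iff)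
  qed
  also have "\<dots> = (\<Sum>a\<le>K m - b. q m (b + a) * X (star m, a))"
    using m by (subst sum.reindex) (auto simp: inj_on_def coupling_def intro!: sum.cong)
  finally show ?thesis .
qed

text \<open>The binomial theorem splits each power of \<open>t + s\<close>, and \<open>fact k\<close> times the coefficient is \<open>q m k\<close>. In
the second factor \<open>exp (- \<beta> m * t)\<close> is the kernel with index \<open>star m\<close>.\<close>

lemma symbol_expansion:
  "(\<Sum>m\<in>Ix. poly (P m) (of_real (t + s)) * exp (- \<beta> m * of_real (t + s)))
    = (\<Sum>i\<in>idx. \<Sum>j\<in>idx. coupling i j * ((cnj (moment_kernel i s) / fact (snd i)) * (moment_kernel j t / fact (snd j))))"
proof -
  have "(\<Sum>i\<in>idx. \<Sum>j\<in>idx. coupling i j * ((cnj (moment_kernel i s) / fact (snd i)) * (moment_kernel j t / fact (snd j))))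
      = (\<Sum>m\<in>Ix. \<Sum>b\<le>K m. \<Sum>j\<in>idx. coupling (m, b) j * ((cnj (moment_kernel (m, b) s) / fact b) * (moment_kernel j t / fact (snd j))))"
    unfolding idx_def using finite_Ix by (subst sum.Sigma) (auto simp: split_def intro!: sum.cong)
  also have "\<dots> = (\<Sum>m\<in>Ix. poly (P m) (of_real (t + s)) * exp (- \<beta> m * of_real (t + s)))"
  proof (intro sum.cong refl)
    fix m assume m: "m \<in> Ix"
    let ?E = "exp (- \<beta> m * of_real (t + s))"
    define g where "g b a = q m (b + a) * (of_real s ^ b / fact b * (of_real t ^ a / fact a)) * ?E" for b a
    have E: "exp (- \<beta> m * of_real s) * exp (- \<beta> m * of_real t) = ?E"
      by (simp add: exp_add[symmetric] algebra_simps)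
    have "(\<Sum>b\<le>K m. \<Sum>j\<in>idx. coupling (m, b) j * ((cnj (moment_kernel (m, b) s) / fact b) * (moment_kernel j t / fact (snd j))))
        = (\<Sum>b\<le>K m. \<Sum>a\<le>K m - b. g b a)"
    proof (intro sum.cong refl)
      fix b assume "b \<in> {..K m}"
      then have "(m, b) \<in> idx" using m by (simp add: idx_def)
      moreover have "q m (b + a) * ((cnj (moment_kernel (m, b) s) / fact b) * (moment_kernel (star m, a) t / fact a)) = g b a" for a
        unfolding g_def E[symmetric] by (simp add: moment_kernel_def \<beta>_star m exp_cnj)
      ultimately show "(\<Sum>j\<in>idx. coupling (m, b) j * ((cnj (moment_kernel (m, b) s) / fact b) * (moment_kernel j t / fact (snd j))))
          = (\<Sum>a\<le>K m - b. g b a)"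
        by (subst sum_coupling) auto
    qed
    also have "\<dots> = (\<Sum>(b, a)\<in>{(b, a). b + a \<le> K m}. g b a)"
      by (subst sum.Sigma) (auto intro!: sum.cong)
    also have "\<dots> = (\<Sum>k\<le>K m. \<Sum>b\<le>k. g b (k - b))"
      by (rule sum.triangle_reindex_eq)
    also have "\<dots> = (\<Sum>k\<le>K m. coeff (P m) k * of_real (t + s) ^ k) * ?E"
      unfolding sum_distrib_right
    proof (intro sum.cong refl)
      fix k assume "k \<in> {..K m}"
      have "complex_of_real (t + s) ^ k = (of_real s + of_real t) ^ k" by (simp add: add.commute)
      also have "\<dots> = (\<Sum>b\<le>k. of_nat (k choose b) * of_real s ^ b * of_real t ^ (k - b))"
        by (rule binomial_ring)
      also have "\<dots> = (\<Sum>b\<le>k. fact k * (of_real s ^ b / fact b * (of_real t ^ (k - b) / fact (k - b))))"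
        by (intro sum.cong) (auto simp: binomial_fact)
      finally have "coeff (P m) k * of_real (t + s) ^ k * ?E
          = (\<Sum>b\<le>k. coeff (P m) k * (fact k * (of_real s ^ b / fact b * (of_real t ^ (k - b) / fact (k - b)))) * ?E)"
        by (simp only: sum_distrib_left sum_distrib_right)
      then show "(\<Sum>b\<le>k. g b (k - b)) = coeff (P m) k * of_real (t + s) ^ k * ?E"
        by (simp add: g_def q_def mult_ac)
    qed
    also have "(\<Sum>k\<le>K m. coeff (P m) k * of_real (t + s) ^ k) = poly (P m) (of_real (t + s))"
      by (simp add: poly_altdef)
    finally show "(\<Sum>b\<le>K m. \<Sum>j\<in>idx. coupling (m, b) j * ((cnj (moment_kernel (m, b) s) / fact b) * (moment_kernel j t / fact (snd j))))
        = poly (P m) (of_real (t + s)) * ?E" .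
  qed
  finally show ?thesis by simp
qed

text \<open>Inserting the expansion of the symbol separates the variables, so the integrals factor into jets.\<close>

lemma hankel_form:
  assumes v: "\<And>t. t > 0 \<Longrightarrow> v t = (\<Sum>m\<in>Ix. poly (P m) (of_real t) * exp (- \<beta> m * of_real t))"
    and f: "f \<in> L2_Rplus" and g: "g \<in> L2_Rplus"
  shows "inner_L2 (hankel v f) g = bform f g"
proof -
  define C where "C j = (\<Sum>i\<in>idx. coupling i j * jet i f) / fact (snd j)" for j
  have int: "integrable Rplus (\<lambda>s. cnj (moment_kernel i s) * f s)" if "i \<in> idx" for i
    using L2_product_integrable[OF f moment_kernel_L2[OF that]] by (simp add: mult.commute)
  have hankel: "hankel v f t = (\<Sum>j\<in>idx. fscale (C j) (moment_kernel j)) t" if t: "t > 0" for t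
  proof -
    have "hankel v f t = (\<integral>s. (\<Sum>i\<in>idx. \<Sum>j\<in>idx.
        (coupling i j * moment_kernel j t / (fact (snd i) * fact (snd j))) * (cnj (moment_kernel i s) * f s)) \<partial>Rplus)"
      unfolding hankel_def
    proof (intro Bochner_Integration.integral_cong refl)
      fix s assume "s \<in> space Rplus"
      then have "v (t + s) = (\<Sum>i\<in>idx. \<Sum>j\<in>idx. coupling i j * ((cnj (moment_kernel i s) / fact (snd i)) * (moment_kernel j t / fact (snd j))))"
        using v[of "t + s"] t symbol_expansion[of t s] by simp
      then show "v (t + s) * f s = (\<Sum>i\<in>idx. \<Sum>j\<in>idx.
        (coupling i j * moment_kernel j t / (fact (snd i) * fact (snd j))) * (cnj (moment_kernel i s) * f s))"
        by (simp only: sum_distrib_right) (intro sum.cong refl, simp add: field_simps)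
    qed
    also have "\<dots> = (\<Sum>i\<in>idx. \<Sum>j\<in>idx. (coupling i j * moment_kernel j t / (fact (snd i) * fact (snd j))) *
        (\<integral>s. cnj (moment_kernel i s) * f s \<partial>Rplus))"
    proof -
      have int': "integrable Rplus (\<lambda>s. c * (cnj (moment_kernel i s) * f s))" if "i \<in> idx" for i c
        by (intro integrable_mult_right int that)
      show ?thesis
        by (subst Bochner_Integration.integral_sum, intro Bochner_Integration.integrable_sum int', assumption,
            intro sum.cong refl, subst Bochner_Integration.integral_sum, intro int', assumption)
          (simp only: integral_mult_right_zero)
    qed
    also have "\<dots> = (\<Sum>i\<in>idx. \<Sum>j\<in>idx. coupling i j * jet i f / fact (snd j) * moment_kernel j t)"
      by (intro sum.cong refl) (simp add: jet_def inner_L2_def mult.commute)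
    also have "\<dots> = (\<Sum>j\<in>idx. C j * moment_kernel j t)"
      by (subst sum.swap) (simp add: C_def sum_divide_distrib sum_distrib_right)
    finally show ?thesis by (simp add: fscale_sum_apply)
  qed
  have "inner_L2 (hankel v f) g = inner_L2 (\<Sum>j\<in>idx. fscale (C j) (moment_kernel j)) g"
    unfolding inner_L2_def using hankel by (intro Bochner_Integration.integral_cong refl) simp
  also have "\<dots> = (\<Sum>j\<in>idx. C j * inner_L2 (moment_kernel j) g)"
    by (intro L2.sum_left moment_kernel_L2 g)
  also have "\<dots> = (\<Sum>j\<in>idx. \<Sum>i\<in>idx. coupling i j * jet i f * cnj (jet j g))"
  proof (intro sum.cong refl)
    fix j assume j: "j \<in> idx"
    have "inner_L2 (moment_kernel j) g / fact (snd j) = cnj (jet j g)"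
      using L2.hermitian[OF g moment_kernel_L2[OF j]] by (simp add: jet_def)
    then have "C j * inner_L2 (moment_kernel j) g = (\<Sum>i\<in>idx. coupling i j * jet i f) * cnj (jet j g)"
      by (simp add: C_def field_simps)
    then show "C j * inner_L2 (moment_kernel j) g = (\<Sum>i\<in>idx. coupling i j * jet i f * cnj (jet j g))"
      by (simp add: sum_distrib_right)
  qed
  also have "\<dots> = bform f g" unfolding bform_def by (rule sum.swap)
  finally show ?thesis .
qed

lemma jet_add: "\<lbrakk>i \<in> idx; f \<in> L2_Rplus; g \<in> L2_Rplus\<rbrakk> \<Longrightarrow> jet i (f + g) = jet i f + jet i g"
  by (simp add: jet_def L2.add_left moment_kernel_L2 add_divide_distrib)

lemma jet_diff: "\<lbrakk>i \<in> idx; f \<in> L2_Rplus; g \<in> L2_Rplus\<rbrakk> \<Longrightarrow> jet i (f - g) = jet i f - jet i g"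
  by (simp add: jet_def L2.diff_left moment_kernel_L2 diff_divide_distrib)

lemma jet_scale: "\<lbrakk>i \<in> idx; f \<in> L2_Rplus\<rbrakk> \<Longrightarrow> jet i (fscale c f) = c * jet i f"
  by (simp add: jet_def L2.scale_left moment_kernel_L2)

lemma jet_sum: "\<lbrakk>i \<in> idx; \<And>k. k \<in> S \<Longrightarrow> f k \<in> L2_Rplus\<rbrakk> \<Longrightarrow>
    jet i (\<Sum>k\<in>S. fscale (c k) (f k)) = (\<Sum>k\<in>S. c k * jet i (f k))"
  by (simp add: jet_def L2.sum_left moment_kernel_L2 sum_divide_distrib)

definition jet_const :: real where
  "jet_const = (\<Sum>i\<in>idx. Re (inner_L2 (moment_kernel i) (moment_kernel i)))"

lemma jet_bound:
  assumes i: "i \<in> idx" and f: "f \<in> L2_Rplus"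
  shows "(cmod (jet i f))\<^sup>2 \<le> jet_const * Re (inner_L2 f f)"
proof -
  let ?c = "\<lambda>i. Re (inner_L2 (moment_kernel i) (moment_kernel i))"
  have "cmod (jet i f) \<le> cmod (inner_L2 f (moment_kernel i)) / 1"
    unfolding jet_def norm_divide norm_fact by (intro frac_le) (auto simp: fact_ge_1)
  then have "(cmod (jet i f))\<^sup>2 \<le> (cmod (inner_L2 f (moment_kernel i)))\<^sup>2"
    by (intro power_mono) auto
  also have "\<dots> \<le> Re (inner_L2 f f) * ?c i" by (intro L2.Cauchy_Schwarz f moment_kernel_L2 i)
  also have "?c i \<le> (\<Sum>i\<in>idx. ?c i)"
    by (rule member_le_sum[OF i _ finite_idx]) (auto intro: L2.nonneg moment_kernel_L2)
  then have "Re (inner_L2 f f) * ?c i \<le> Re (inner_L2 f f) * (\<Sum>i\<in>idx. ?c i)"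
    by (rule mult_left_mono) (rule L2.nonneg[OF f])
  finally show ?thesis by (simp add: jet_const_def mult.commute)
qed

lemma bform_hermitian_form:
  assumes "fvec.subspace D" "D \<subseteq> L2_Rplus"
  shows "hermitian_form fscale D bform"
proof
  show "fvec.subspace D" by fact
next
  fix f g k assume "f \<in> D" "g \<in> D" "k \<in> D"
  with assms(2) have "f \<in> L2_Rplus" "g \<in> L2_Rplus" by auto
  then show "bform (f + g) k = bform f k + bform g k"
    by (simp add: bform_def jet_add algebra_simps sum.distrib)
next
  fix f k c assume "f \<in> D" "k \<in> D"
  with assms(2) have "f \<in> L2_Rplus" by auto
  then show "bform (fscale c f) k = c * bform f k"
    by (simp add: bform_def jet_scale sum_distrib_left mult_ac)
next
  fix f g
  have "bform g f = (\<Sum>j\<in>idx. \<Sum>i\<in>idx. coupling i j * jet i g * cnj (jet j f))"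
    unfolding bform_def by (rule sum.swap)
  also have "\<dots> = cnj (bform f g)"
    unfolding bform_def cnj_sum
  proof (intro sum.cong refl)
    fix j i assume "j \<in> idx" "i \<in> idx"
    then have "coupling i j = cnj (coupling j i)" by (intro coupling_hermitian)
    then show "coupling i j * jet i g * cnj (jet j f) = cnj (coupling j i * jet j f * cnj (jet i g))"
      by (simp add: mult_ac)
  qed
  finally show "bform g f = cnj (bform f g)" .
qed

end

section \<open>Laplace transforms that are polynomials in w = 1 / (1 + z)\<close>

text \<open>In the variable \<open>w = 1 / (1 + z)\<close> the derivation \<open>w\<^sup>2 d/dw\<close> is \<open>- d/dz\<close>.\<close>

definition w_deriv :: "complex poly \<Rightarrow> complex poly" where
  "w_deriv p = [:0, 0, 1:] * pderiv p"

lemma w_deriv_mult: "w_deriv (p * r) = w_deriv p * r + p * w_deriv r"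
  by (simp add: w_deriv_def pderiv_mult algebra_simps)

lemma w_deriv_sum: "w_deriv (\<Sum>i\<in>I. f i) = (\<Sum>i\<in>I. w_deriv (f i))"
  by (induction I rule: infinite_finite_induct) (simp_all add: w_deriv_def pderiv_add algebra_simps)

lemma w_deriv_monom: "w_deriv (monom c (Suc n)) = monom (of_nat (Suc n) * c) (Suc (Suc n))"
proof -
  have "[:0, 0, 1::complex:] = monom 1 2" by (simp add: monom_altdef numeral_2_eq_2)
  then show ?thesis by (simp add: w_deriv_def pderiv_monom mult_monom)
qed

lemma w_deriv_iter_pCons:
  "(w_deriv ^^ a) (pCons 0 R) = (\<Sum>k\<le>degree R. monom (coeff R k * fact (a + k) / fact k) (Suc (a + k)))"
proof (induction a)
  case 0
  have "pCons 0 R = [:0, 1:] * (\<Sum>k\<le>degree R. monom (coeff R k) k)"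
    by (simp add: poly_as_sum_of_monoms)
  also have "\<dots> = (\<Sum>k\<le>degree R. [:0, 1:] * monom (coeff R k) k)"
    by (rule sum_distrib_left)
  finally have "pCons 0 R = (\<Sum>k\<le>degree R. [:0, 1:] * monom (coeff R k) k)" .
  then show ?case by (simp add: monom_Suc)
next
  case (Suc a)
  have "coeff R k * fact (Suc a + k) / fact k = of_nat (Suc (a + k)) * (coeff R k * fact (a + k) / fact k)" for k
    by (simp add: field_simps)
  then show ?case using Suc by (simp only: funpow.simps o_apply w_deriv_sum w_deriv_monom add_Suc)
qed

lemma w_deriv_power_linear:
  "w_deriv ([:- w, 1:] ^ Suc c * S) = [:- w, 1:] ^ c * (smult (of_nat (Suc c)) ([:0, 0, 1:] * S) + [:- w, 1:] * w_deriv S)"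
proof -
  have "w_deriv ([:- w, 1:] ^ Suc c) = smult (of_nat (Suc c)) ([:0, 0, 1:] * [:- w, 1:] ^ c)"
    unfolding w_deriv_def pderiv_power_Suc by (simp add: pderiv_pCons)
  moreover have "smult n (Z * Y) * S + X * Y * U = Y * (smult n (Z * S) + X * U)"
    for n :: complex and X Y Z U :: "complex poly"
    by (simp add: algebra_simps)
  ultimately show ?thesis by (simp only: w_deriv_mult power_Suc)
qed

text \<open>Applying the derivation \<open>b\<close> times lowers the order of a zero at \<open>w\<close> by at most \<open>b\<close>; the second
conjunct with \<open>b = c\<close> gives the first value that may differ from \<open>0\<close>.\<close>

lemma w_deriv_iter_vanishing:
  "b \<le> c \<Longrightarrow> \<exists>S'. (w_deriv ^^ b) ([:- w, 1:] ^ c * S) = [:- w, 1:] ^ (c - b) * S' \<and>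
     poly S' w = fact c / fact (c - b) * w ^ (2 * b) * poly S w"
proof (induction b)
  case 0
  then show ?case by auto
next
  case (Suc b)
  then obtain S' where S': "(w_deriv ^^ b) ([:- w, 1:] ^ c * S) = [:- w, 1:] ^ (c - b) * S'"
    "poly S' w = fact c / fact (c - b) * w ^ (2 * b) * poly S w" by auto
  have c: "c - b = Suc (c - Suc b)" using Suc.prems by simp
  define S'' where "S'' = smult (of_nat (Suc (c - Suc b))) ([:0, 0, 1:] * S') + [:- w, 1:] * w_deriv S'"
  have "(w_deriv ^^ Suc b) ([:- w, 1:] ^ c * S) = [:- w, 1:] ^ (c - Suc b) * S''"
    using S'(1) c by (simp only: funpow.simps o_apply w_deriv_power_linear S''_def)
  moreover have "poly S'' w = fact c / fact (c - Suc b) * w ^ (2 * Suc b) * poly S w"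
    unfolding S''_def using S'(2) c
    by (simp add: field_simps power2_eq_square del: of_nat_Suc)
  ultimately show ?case by blast
qed

text \<open>Its Laplace transform is \<open>w R(w)\<close> with \<open>w = 1 / (1 + z)\<close>.\<close>

definition test_fun :: "complex poly \<Rightarrow> real \<Rightarrow> complex" where
  "test_fun R = (\<Sum>k\<le>degree R. fscale (coeff R k / fact k) (\<lambda>t. of_real t ^ k * exp (- 1 * of_real t)))"

lemma test_fun_L2: "test_fun R \<in> L2_Rplus"
  unfolding test_fun_def by (intro L2.D_combination exp_in_L2) simp

text \<open>The Laplace transform of \<open>t ^ k * exp (- t)\<close> is \<open>fact k * w ^ (k + 1)\<close>, and multiplying a function by
\<open>t\<close> applies \<open>- d/dz\<close> to its transform.\<close>

lemma test_fun_moment: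
  assumes "Re \<beta> > 0"
  shows "inner_L2 (test_fun R) (\<lambda>t. of_real t ^ a * exp (- cnj \<beta> * of_real t))
    = poly ((w_deriv ^^ a) (pCons 0 R)) (1 / (1 + \<beta>))"
proof -
  have "inner_L2 (\<lambda>t. of_real t ^ k * exp (- 1 * of_real t)) (\<lambda>t. of_real t ^ a * exp (- cnj \<beta> * of_real t))
      = fact (a + k) / (1 + \<beta>) ^ Suc (a + k)" for k
  proof -
    have "of_real t ^ k * exp (- 1 * of_real t) * cnj (of_real t ^ a * exp (- cnj \<beta> * of_real t))
        = of_real t ^ (a + k) * exp (- (1 + \<beta>) * of_real t)" for t
      by (simp add: exp_cnj power_add exp_add[symmetric] algebra_simps)
    then show ?thesis
      unfolding inner_L2_def using moment_exp[of "1 + \<beta>" "a + k"] assms by simp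
  qed
  then have "inner_L2 (test_fun R) (\<lambda>t. of_real t ^ a * exp (- cnj \<beta> * of_real t))
      = (\<Sum>k\<le>degree R. coeff R k / fact k * (fact (a + k) / (1 + \<beta>) ^ Suc (a + k)))"
    unfolding test_fun_def using assms by (subst L2.sum_left, intro exp_in_L2, simp, intro exp_in_L2, simp) (simp only:)
  also have "\<dots> = poly ((w_deriv ^^ a) (pCons 0 R)) (1 / (1 + \<beta>))"
    unfolding w_deriv_iter_pCons by (simp add: poly_sum poly_monom power_divide power_one_over divide_simps)
  finally show ?thesis .
qed

lemma laplace_test_fun:
  assumes "l > 0"
  shows "laplace (test_fun R) l = poly (pCons 0 R) (of_real (1 / (1 + l)))"
proof -
  have "laplace (test_fun R) l = inner_L2 (test_fun R) (\<lambda>t. of_real t ^ 0 * exp (- cnj (of_real l) * of_real t))"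
    unfolding laplace_eq_inner by (simp add: exp_kernel_def exp_of_real[symmetric] mult.commute)
  then show ?thesis using test_fun_moment[of "of_real l" R 0] assms by simp
qed

text \<open>At \<open>w\<close> the square is \<open>- (Im w)\<^sup>2\<close>, which the normalising factor compensates, whereas for real \<open>x\<close> the
square lies in \<open>(0, 1)\<close> if \<open>0 < \<bar>x - Re w\<bar> < 1\<close>. So a real \<open>w\<close> in \<open>(0, 1)\<close> is the strict maximum of
the peak on this interval, and for non-real \<open>w\<close> the peak is at most \<open>1 / (1 + (Im w)\<^sup>2)\<close>.\<close>

definition peak :: "complex \<Rightarrow> complex poly" where
  "peak w = smult (of_real (1 / (1 + (Im w)\<^sup>2))) (1 - [:- of_real (Re w), 1:] ^ 2)"

lemma peak_at: "poly (peak w) w = 1"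
proof -
  have "w - of_real (Re w) = \<i> * of_real (Im w)" by (simp add: complex_eq_iff)
  then have "poly (peak w) w = of_real (1 / (1 + (Im w)\<^sup>2)) * (1 + (of_real (Im w))\<^sup>2)"
    by (simp add: peak_def power_mult_distrib)
  also have "\<dots> = of_real (1 / (1 + (Im w)\<^sup>2) * (1 + (Im w)\<^sup>2))"
    by (simp only: of_real_mult of_real_add of_real_1 of_real_power)
  also have "1 + (Im w)\<^sup>2 > 0" by (simp add: add_pos_nonneg)
  then have "1 / (1 + (Im w)\<^sup>2) * (1 + (Im w)\<^sup>2) = 1" by simp
  finally show ?thesis by simp
qed

lemma peak_real:
  assumes x: "0 < x" "x < 1" and w: "0 < Re w" "Re w < 1"
  shows "cmod (poly (peak w) (of_real x)) \<le> 1" "x \<noteq> Re w \<Longrightarrow> cmod (poly (peak w) (of_real x)) < 1"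
proof -
  have "poly (peak w) (of_real x) = of_real ((1 - (x - Re w)\<^sup>2) / (1 + (Im w)\<^sup>2))"
    by (simp add: peak_def)
  then have eq: "cmod (poly (peak w) (of_real x)) = \<bar>1 - (x - Re w)\<^sup>2\<bar> / (1 + (Im w)\<^sup>2)"
    by (simp only: norm_of_real abs_divide) (simp add: add_nonneg_nonneg abs_of_nonneg)
  have "\<bar>x - Re w\<bar> \<le> 1" using x w by auto
  then have "(x - Re w)\<^sup>2 \<le> 1" by (simp add: abs_square_le_1)
  then have "\<bar>1 - (x - Re w)\<^sup>2\<bar> / (1 + (Im w)\<^sup>2) \<le> (1 - (x - Re w)\<^sup>2) / 1"
    by (intro frac_le) auto
  then have "cmod (poly (peak w) (of_real x)) \<le> 1 - (x - Re w)\<^sup>2" unfolding eq by simp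
  moreover have "0 \<le> (x - Re w)\<^sup>2" "x \<noteq> Re w \<Longrightarrow> 0 < (x - Re w)\<^sup>2" by auto
  ultimately show "cmod (poly (peak w) (of_real x)) \<le> 1" "x \<noteq> Re w \<Longrightarrow> cmod (poly (peak w) (of_real x)) < 1"
    by linarith+
qed

text \<open>The growth condition makes \<open>h0\<close> finite on test functions that are divisible by \<open>w\<^sup>d\<close>.\<close>

locale moderate_weight = weight +
  fixes d :: nat
  assumes moderate: "integrable Rplus (\<lambda>l. (1 / (1 + l)) ^ (2 * d) * \<sigma> l)"
begin

lemma poly_bounded_unit_interval:
  fixes A :: "complex poly"
  obtains C where "C \<ge> 0" "\<And>x. 0 \<le> x \<Longrightarrow> x \<le> 1 \<Longrightarrow> cmod (poly A (of_real x)) \<le> C"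
proof -
  have "compact ((\<lambda>x. poly A (of_real x)) ` {0..1::real})"
    by (intro compact_continuous_image continuous_intros) auto
  then obtain C where "\<forall>z\<in>(\<lambda>x. poly A (of_real x)) ` {0..1::real}. cmod z \<le> C"
    using compact_imp_bounded bounded_iff by metis
  then have "\<And>x. 0 \<le> x \<Longrightarrow> x \<le> 1 \<Longrightarrow> cmod (poly A (of_real x)) \<le> C" by auto
  moreover from this[of 0] have "C \<ge> 0"
    using order.trans[OF norm_ge_zero[of "poly A (of_real 0)"]] by simp
  ultimately show ?thesis using that by blast
qed

lemma test_fun_weight_bound:
  assumes C: "\<And>x. 0 \<le> x \<Longrightarrow> x \<le> 1 \<Longrightarrow> cmod (poly A (of_real x)) \<le> C" and l: "l > 0"
  shows "norm ((cmod (laplace (test_fun (monom 1 d * A)) l))\<^sup>2 * \<sigma> l) \<le> C\<^sup>2 * ((1 / (1 + l)) ^ (2 * d) * \<sigma> l)"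
proof -
  let ?x = "1 / (1 + l)"
  have x: "0 \<le> ?x" "?x \<le> 1" using l by auto
  have "cmod (laplace (test_fun (monom 1 d * A)) l) = ?x * (?x ^ d * cmod (poly A (of_real ?x)))"
    unfolding laplace_test_fun[OF l] using x by (simp add: poly_monom norm_mult norm_power norm_divide del: of_real_divide)
  also have "\<dots> \<le> 1 * (?x ^ d * C)"
    using x C[OF x] by (intro mult_mono mult_nonneg_nonneg) auto
  finally have "(cmod (laplace (test_fun (monom 1 d * A)) l))\<^sup>2 \<le> (?x ^ d * C)\<^sup>2" by (intro power_mono) auto
  also have "\<dots> = C\<^sup>2 * ?x ^ (2 * d)" by (simp add: power_mult_distrib power_even_eq power_mult mult.commute)
  finally have "(cmod (laplace (test_fun (monom 1 d * A)) l))\<^sup>2 * \<sigma> l \<le> C\<^sup>2 * ?x ^ (2 * d) * \<sigma> l"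
    by (rule mult_right_mono[OF _ \<sigma>_nonneg[OF l]])
  then show ?thesis using \<sigma>_nonneg[OF l] by (simp add: mult.assoc abs_of_nonneg)
qed

lemma test_fun_in_dom: "test_fun (monom 1 d * A) \<in> dom_h0 \<sigma>"
proof -
  obtain C where C: "\<And>x. 0 \<le> x \<Longrightarrow> x \<le> 1 \<Longrightarrow> cmod (poly A (of_real x)) \<le> C"
    using poly_bounded_unit_interval by metis
  have [measurable]: "laplace (test_fun (monom 1 d * A)) \<in> borel_measurable Rplus"
    by (intro laplace_measurable test_fun_L2)
  have "integrable Rplus (\<lambda>l. (cmod (laplace (test_fun (monom 1 d * A)) l))\<^sup>2 * \<sigma> l)"
  proof (rule Bochner_Integration.integrable_bound)
    show "integrable Rplus (\<lambda>l. C\<^sup>2 * ((1 / (1 + l)) ^ (2 * d) * \<sigma> l))"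
      by (rule integrable_mult_right[OF moderate])
    show "AE l in Rplus. norm ((cmod (laplace (test_fun (monom 1 d * A)) l))\<^sup>2 * \<sigma> l)
        \<le> norm (C\<^sup>2 * ((1 / (1 + l)) ^ (2 * d) * \<sigma> l))"
      using test_fun_weight_bound[OF C] by (intro AE_I2) (auto intro: order.trans[OF _ abs_ge_self])
  qed measurable
  then show ?thesis by (simp add: dom_h0_def test_fun_L2)
qed

lemma peak_test_funs_vanish:
  assumes w: "0 < Re w" "Re w < 1"
  shows "(\<lambda>N. Re (h0 \<sigma> (test_fun (monom 1 d * (A * peak w ^ N))) (test_fun (monom 1 d * (A * peak w ^ N))))) \<longlonglongrightarrow> 0"
proof -
  obtain C where C: "C \<ge> 0" "\<And>x. 0 \<le> x \<Longrightarrow> x \<le> 1 \<Longrightarrow> cmod (poly A (of_real x)) \<le> C"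
    using poly_bounded_unit_interval by metis
  let ?f = "\<lambda>N. test_fun (monom 1 d * (A * peak w ^ N))"
  have [measurable]: "laplace (?f N) \<in> borel_measurable Rplus" for N
    by (intro laplace_measurable test_fun_L2)
  have laplace: "cmod (laplace (?f N) l) = cmod (laplace (test_fun (monom 1 d * A)) l) * cmod (poly (peak w) (of_real (1 / (1 + l)))) ^ N"
    if "l > 0" for l N
    unfolding laplace_test_fun[OF that] by (simp add: norm_mult norm_power norm_divide mult_ac)
  have unit: "0 < 1 / (1 + l)" "1 / (1 + l) < 1" if "l > 0" for l :: real using that by auto
  have "(\<lambda>N. \<integral>l. (cmod (laplace (?f N) l))\<^sup>2 * \<sigma> l \<partial>Rplus) \<longlonglongrightarrow> (\<integral>l. 0 \<partial>Rplus)"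
  proof (rule integral_dominated_convergence)
    show "integrable Rplus (\<lambda>l. C\<^sup>2 * ((1 / (1 + l)) ^ (2 * d) * \<sigma> l))"
      by (rule integrable_mult_right[OF moderate])
    show "AE l in Rplus. norm ((cmod (laplace (?f N) l))\<^sup>2 * \<sigma> l) \<le> C\<^sup>2 * ((1 / (1 + l)) ^ (2 * d) * \<sigma> l)" for N
    proof (rule AE_I2)
      fix l assume "l \<in> space Rplus"
      then have l: "l > 0" by simp
      have "cmod (laplace (?f N) l) \<le> cmod (laplace (test_fun (monom 1 d * A)) l) * 1"
        unfolding laplace[OF l] using peak_real(1)[OF unit[OF l] w] by (intro mult_left_mono power_le_one) auto
      then have "(cmod (laplace (?f N) l))\<^sup>2 \<le> (cmod (laplace (test_fun (monom 1 d * A)) l))\<^sup>2"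
        by (intro power_mono) auto
      from mult_right_mono[OF this \<sigma>_nonneg[OF l]] test_fun_weight_bound[of A C, OF C(2) l] \<sigma>_nonneg[OF l]
      show "norm ((cmod (laplace (?f N) l))\<^sup>2 * \<sigma> l) \<le> C\<^sup>2 * ((1 / (1 + l)) ^ (2 * d) * \<sigma> l)"
        by (simp add: abs_mult)
    qed
    have "AE l in lebesgue. l \<noteq> 1 / Re w - 1"
      by (intro AE_I[of _ _ "{1 / Re w - 1}"]) auto
    then have "AE l in lebesgue. l \<in> {0<..} \<longrightarrow> l \<noteq> 1 / Re w - 1" by eventually_elim simp
    then have "AE l in Rplus. l \<noteq> 1 / Re w - 1" by (subst AE_restrict_space_iff) auto
    then show "AE l in Rplus. (\<lambda>N. (cmod (laplace (?f N) l))\<^sup>2 * \<sigma> l) \<longlonglongrightarrow> 0"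
      using AE_space
    proof eventually_elim
      case (elim l)
      then have l: "l > 0" and "1 / (1 + l) \<noteq> Re w" using w by (auto simp: field_simps)
      then have "cmod (poly (peak w) (of_real (1 / (1 + l)))) < 1"
        using peak_real(2)[OF unit[OF l] w] by blast
      then have "(\<lambda>N. (cmod (laplace (test_fun (monom 1 d * A)) l) * cmod (poly (peak w) (of_real (1 / (1 + l)))) ^ N)\<^sup>2 * \<sigma> l)
          \<longlonglongrightarrow> (cmod (laplace (test_fun (monom 1 d * A)) l) * 0)\<^sup>2 * \<sigma> l"
        by (intro tendsto_intros LIMSEQ_power_zero) auto
      then show ?case unfolding laplace[OF l] by simp
    qed
  qed measurable
  then show ?thesis by (simp add: h0_diagonal)
qed

end

text \<open>Near \<open>0\<close> the weight is integrable because \<open>lp < 1\<close>, on a compact interval it is essentially bounded,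
and at infinity the factor \<open>(1 + l) ^ (- 2 * d)\<close> beats the polynomial growth once \<open>d \<ge> lm + 2\<close>.\<close>

lemma moderate_growth:
  fixes \<sigma> :: "real \<Rightarrow> real"
  assumes nonneg: "\<And>l. l > 0 \<Longrightarrow> \<sigma> l \<ge> 0" and loc: "\<sigma> \<in> Linf_loc_Rplus"
    and zero: "\<sigma> \<in> O[at_right 0](\<lambda>l. l powr (- lp))" and inf: "\<sigma> \<in> O[at_top](\<lambda>l. l powr lm)"
    and lp: "lp < 1"
  shows "\<exists>d. integrable Rplus (\<lambda>l. (1 / (1 + l)) ^ (2 * d) * \<sigma> l)"
proof -
  obtain C1 where "\<forall>\<^sub>F l in at_right 0. norm (\<sigma> l) \<le> C1 * norm (l powr (- lp))"
    using zero by (elim landau_o.bigE)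
  then obtain a where a: "a > 0" "\<And>l. 0 < l \<Longrightarrow> l < a \<Longrightarrow> norm (\<sigma> l) \<le> C1 * norm (l powr (- lp))"
    by (auto simp: eventually_at_right_field)
  obtain C2 where "\<forall>\<^sub>F l in at_top. norm (\<sigma> l) \<le> C2 * norm (l powr lm)"
    using inf by (elim landau_o.bigE)
  then obtain b' where b': "\<And>l. l \<ge> b' \<Longrightarrow> norm (\<sigma> l) \<le> C2 * norm (l powr lm)"
    by (auto simp: eventually_at_top_linorder)
  \<comment> \<open>\<open>b \<ge> 1\<close> makes \<open>powr\<close> monotone in the exponent beyond \<open>b\<close>\<close>
  define b where "b = max 1 (max a b')"
  have "b > 0" by (simp add: b_def)
  define d where "d = nat \<lceil>lm + 2\<rceil>"
  have d: "lm + 2 \<le> real d" unfolding d_def by linarith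
  define g where "g l = (1 / (1 + l)) ^ (2 * d) * \<sigma> l" for l
  have g_le: "norm (g l) \<le> norm (\<sigma> l)" if "l > 0" for l
    using that nonneg[OF that] by (auto simp: g_def abs_mult intro!: mult_left_le_one_le power_le_one)
  have [measurable]: "\<sigma> \<in> borel_measurable Rplus" using loc by (simp add: Linf_loc_Rplus_def)
  have "(\<lambda>l::real. (1 / (1 + l)) ^ (2 * d)) \<in> borel_measurable Rplus"
    by (intro measurable_continuous_Rplus continuous_intros) auto
  then have "g \<in> borel_measurable Rplus" unfolding g_def by measurable
  then have meas0: "set_borel_measurable lebesgue {0<..} g"
    by (simp add: set_borel_measurable_def borel_measurable_restrict_space_iff)
  have meas: "set_borel_measurable lebesgue A g" if "A \<in> sets lebesgue" "A \<subseteq> {0<..}" for A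
    using set_borel_measurable_subset[OF meas0 that] by simp
  have near0: "set_integrable lebesgue {0<..<a} g"
  proof (rule set_integrable_bound)
    have "(\<lambda>l. l powr (- lp)) absolutely_integrable_on {0..a}"
      using has_integral_powr_from_0[of "- lp" a] lp a(1)
      by (intro nonnegative_absolutely_integrable_1) (auto simp: integrable_on_def)
    then have "set_integrable lebesgue {0<..<a} (\<lambda>l. l powr (- lp))"
      by (rule set_integrable_subset) auto
    then show "set_integrable lebesgue {0<..<a} (\<lambda>l. C1 * l powr (- lp))" by (rule set_integrable_mult_right)
    show "set_borel_measurable lebesgue {0<..<a} g" by (rule meas) auto
    have "norm (g l) \<le> norm (C1 * l powr (- lp))" if "0 < l" "l < a" for l
      using order.trans[OF g_le[OF that(1)] a(2)[OF that]] by simp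
    then show "AE l in lebesgue. l \<in> {0<..<a} \<longrightarrow> norm (g l) \<le> norm (C1 * l powr (- lp))"
      by (intro AE_I2) auto
  qed
  have middle: "set_integrable lebesgue {a..b} g"
  proof -
    have "compact {a..b}" "{a..b} \<subseteq> {0<..}" using a(1) by auto
    then obtain C where "AE x in lebesgue_on {a..b}. \<bar>\<sigma> x\<bar> \<le> C"
      using loc unfolding Linf_loc_Rplus_def by blast
    then have C: "AE x in lebesgue. x \<in> {a..b} \<longrightarrow> \<bar>\<sigma> x\<bar> \<le> C"
      by (subst (asm) AE_restrict_space_iff) auto
    show ?thesis
    proof (rule set_integrable_bound)
      have "(\<lambda>l. C) absolutely_integrable_on {a..b}" by (rule absolutely_integrable_on_const) simp
      then show "set_integrable lebesgue {a..b} (\<lambda>l. C)" .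
      show "set_borel_measurable lebesgue {a..b} g" using a(1) by (intro meas) auto
      show "AE l in lebesgue. l \<in> {a..b} \<longrightarrow> norm (g l) \<le> norm C"
        using C
      proof eventually_elim
        case (elim l)
        show ?case
        proof
          assume l: "l \<in> {a..b}"
          then have "norm (g l) \<le> \<bar>\<sigma> l\<bar>" using g_le[of l] a(1) by simp
          also have "\<dots> \<le> C" using elim l by blast
          also have "\<dots> \<le> norm C" by simp
          finally show "norm (g l) \<le> norm C" .
        qed
      qed
    qed
  qed
  have far: "set_integrable lebesgue {b..} g"
  proof (rule set_integrable_bound)
    have "(\<lambda>l. l powr (- 2)) absolutely_integrable_on {b..}"
      using has_integral_powr_to_inf[of "-2" b] \<open>b > 0\<close>
      by (intro nonnegative_absolutely_integrable_1) (auto simp: integrable_on_def)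
    then show "set_integrable lebesgue {b..} (\<lambda>l. C2 * l powr (- 2))" by (rule set_integrable_mult_right)
    show "set_borel_measurable lebesgue {b..} g" by (rule meas) (auto simp: b_def)
    have "norm (g l) \<le> norm (C2 * l powr (- 2))" if l: "l \<ge> b" for l
    proof -
      have l1: "l \<ge> 1" "l \<ge> b'" using l by (auto simp: b_def)
      have "(1 / (1 + l)) ^ (2 * d) \<le> (1 / l) ^ (2 * d)"
        using l1 by (intro power_mono divide_left_mono) auto
      also have "\<dots> = l powr (- real (2 * d))"
        using l1 by (simp add: powr_minus powr_realpow power_one_over inverse_eq_divide del: of_nat_mult)
      finally have p: "(1 / (1 + l)) ^ (2 * d) \<le> l powr (- real (2 * d))" .
      have "norm (g l) = (1 / (1 + l)) ^ (2 * d) * norm (\<sigma> l)" using l1 by (simp add: g_def abs_mult)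
      also have "\<dots> \<le> l powr (- real (2 * d)) * (C2 * norm (l powr lm))"
        using p b'[OF l1(2)] by (intro mult_mono) auto
      also have "\<dots> = C2 * l powr (lm - real (2 * d))" by (simp add: powr_diff powr_minus field_simps)
      also have "\<dots> \<le> C2 * l powr (- 2)"
      proof (rule mult_left_mono)
        show "l powr (lm - real (2 * d)) \<le> l powr (- 2)"
          using l1 d by (intro powr_mono) auto
        have "0 \<le> C2 * l powr lm" using order.trans[OF norm_ge_zero b'[OF l1(2)]] by simp
        moreover have "l powr lm > 0" using l1 by simp
        ultimately show "0 \<le> C2" by (simp add: zero_le_mult_iff)
      qed
      finally show ?thesis using abs_ge_self order.trans unfolding real_norm_def by blast
    qed
    then show "AE l in lebesgue. l \<in> {b..} \<longrightarrow> norm (g l) \<le> norm (C2 * l powr (- 2))"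
      by (intro AE_I2) auto
  qed
  have "set_integrable lebesgue (({0<..<a} \<union> {a..b}) \<union> {b..}) g"
    by (intro set_integrable_Un near0 middle far) auto
  moreover have "({0<..<a} \<union> {a..b}) \<union> {b..} = {0<..}" using a(1) by (auto simp: b_def)
  ultimately have "set_integrable lebesgue {0<..} g" by simp
  then have "integrable Rplus g" by (simp add: set_integrable_def integrable_restrict_space)
  then show ?thesis unfolding g_def by blast
qed

section \<open>Prescribing jets at small energy\<close>

locale hankel_model = exp_poly_symbol + moderate_weight
begin

text \<open>The image of \<open>\<beta> m\<close> under \<open>z \<mapsto> 1 / (1 + z)\<close>, which maps the right half plane to the disc over the
diameter \<open>(0, 1)\<close>.\<close>

definition node :: "nat \<Rightarrow> complex" where "node m = 1 / (1 + \<beta> m)"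

lemma node_props:
  assumes "m \<in> Ix"
  shows "0 < Re (node m)" "Re (node m) < 1" "node m \<noteq> 0"
proof -
  have a: "Re (\<beta> m) > 0" using Re_\<beta>[OF assms] .
  have "Re (node m) = (1 + Re (\<beta> m)) / ((1 + Re (\<beta> m))\<^sup>2 + (Im (\<beta> m))\<^sup>2)"
    by (simp add: node_def Re_divide)
  moreover have "1 + Re (\<beta> m) < (1 + Re (\<beta> m))\<^sup>2 + (Im (\<beta> m))\<^sup>2"
    using a by (simp add: power2_eq_square algebra_simps add_pos_nonneg)
  ultimately show "0 < Re (node m)" "Re (node m) < 1" using a by auto
  then show "node m \<noteq> 0" by auto
qed

lemma node_inj: "m \<in> Ix \<Longrightarrow> m' \<in> Ix \<Longrightarrow> node m = node m' \<Longrightarrow> m = m'"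
proof -
  assume m: "m \<in> Ix" "m' \<in> Ix" "node m = node m'"
  then have "\<beta> m = \<beta> m'" using node_props(3) by (auto simp: node_def divide_simps split: if_splits)
  with m show ?thesis using inj_\<beta> by (auto dest: inj_onD)
qed

lemma jet_test_fun:
  assumes "i \<in> idx"
  shows "jet i (test_fun R) = poly ((w_deriv ^^ snd i) (pCons 0 R)) (node (fst i)) / fact (snd i)"
  using test_fun_moment[of "\<beta> (fst i)" R "snd i"] Re_\<beta>[of "fst i"] assms
  by (auto simp: jet_def moment_kernel_def node_def idx_def)

text \<open>The polynomial \<open>R N\<close> vanishes to high order at all other nodes and exactly to order \<open>a\<close> at \<open>node m\<close>, and the
first derivative that survives there does not depend on \<open>N\<close>, as the peak has value \<open>1\<close> at \<open>node m\<close>. The jets of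
order above \<open>a\<close> at that node are not controlled and may be large.\<close>

lemma leading_jet:
  assumes i: "(m, a) \<in> idx" and \<epsilon>: "\<epsilon> > 0"
  shows "\<exists>f\<in>dom_h0 \<sigma>. jet (m, a) f = 1 \<and> (\<forall>j\<in>idx. fst j \<noteq> m \<or> snd j < a \<longrightarrow> jet j f = 0)
    \<and> Re (h0 \<sigma> f f) \<le> \<epsilon>"
proof -
  have m: "m \<in> Ix" "a \<le> K m" using i by (auto simp: idx_def)
  define Q where "Q n = (\<Prod>m'\<in>Ix - {n}. [:- node m', 1:] ^ Suc (K m'))" for n
  define A where "A = [:- node m, 1:] ^ a * Q m"
  define R where "R N = monom 1 d * (A * peak (node m) ^ N)" for N
  define c where "c = jet (m, a) (test_fun (R 0))"
  have c_eq: "jet (m, a) (test_fun (R N)) = node m ^ (2 * a) * (node m * (node m ^ d * poly (Q m) (node m)))" for N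
  proof -
    have "pCons 0 (R N) = [:- node m, 1:] ^ a * ([:0, 1:] * (monom 1 d * (Q m * peak (node m) ^ N)))"
      by (simp add: R_def A_def mult_ac)
    with w_deriv_iter_vanishing[of a a "node m" "[:0, 1:] * (monom 1 d * (Q m * peak (node m) ^ N))"]
    have "poly ((w_deriv ^^ a) (pCons 0 (R N))) (node m)
        = fact a * node m ^ (2 * a) * (node m * (node m ^ d * poly (Q m) (node m)))"
      by (auto simp: poly_monom peak_at)
    then show ?thesis using jet_test_fun[OF i, of "R N"] by simp
  qed
  have "poly (Q m) (node m) \<noteq> 0"
    unfolding Q_def using finite_Ix m node_inj[OF m(1)] by (auto simp: poly_prod simp del: power_Suc)
  then have c: "c \<noteq> 0" unfolding c_def c_eq using node_props(3)[OF m(1)] by simp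
  have zero: "jet j (test_fun (R N)) = 0" if j: "j \<in> idx" "fst j \<noteq> m \<or> snd j < a" for j N
  proof -
    obtain n b where jnb: "j = (n, b)" by force
    have n: "n \<in> Ix" "b \<le> K n" using j jnb by (auto simp: idx_def)
    have "\<exists>c S. b < c \<and> pCons 0 (R N) = [:- node n, 1:] ^ c * S"
    proof (cases "n = m")
      case True
      then have "pCons 0 (R N) = [:- node n, 1:] ^ a * ([:0, 1:] * (monom 1 d * (Q m * peak (node m) ^ N)))"
        by (simp add: R_def A_def mult_ac)
      then show ?thesis using j True jnb by (metis fst_conv snd_conv)
    next
      case False
      \<comment> \<open>one order more than the jets at \<open>n\<close> can see\<close>
      have "Q m = [:- node n, 1:] ^ Suc (K n) * (\<Prod>m'\<in>Ix - {m} - {n}. [:- node m', 1:] ^ Suc (K m'))"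
        unfolding Q_def using finite_Ix n False by (intro prod.remove) auto
      then have "pCons 0 (R N) = [:- node n, 1:] ^ Suc (K n) * ((\<Prod>m'\<in>Ix - {m} - {n}. [:- node m', 1:] ^ Suc (K m'))
          * ([:0, 1:] * (monom 1 d * ([:- node m, 1:] ^ a * peak (node m) ^ N))))"
        by (simp add: R_def A_def mult_ac del: power_Suc)
      then show ?thesis using n by (meson le_imp_less_Suc)
    qed
    then obtain c S where cS: "b < c" "pCons 0 (R N) = [:- node n, 1:] ^ c * S" by blast
    with w_deriv_iter_vanishing[of b c "node n" S] have "poly ((w_deriv ^^ b) (pCons 0 (R N))) (node n) = 0"
      by auto
    then show ?thesis using jet_test_fun[OF j(1), of "R N"] by (simp add: jnb)
  qed
  have "(\<lambda>N. Re (h0 \<sigma> (test_fun (R N)) (test_fun (R N)))) \<longlonglongrightarrow> 0"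
    unfolding R_def by (rule peak_test_funs_vanish[OF node_props(1,2)[OF m(1)]])
  from LIMSEQ_D[OF this, of "\<epsilon> * (cmod c)\<^sup>2"] \<epsilon> c
  obtain N where N: "\<bar>Re (h0 \<sigma> (test_fun (R N)) (test_fun (R N)))\<bar> < \<epsilon> * (cmod c)\<^sup>2" by fastforce
  define f where "f = fscale (1 / c) (test_fun (R N))"
  have D: "test_fun (R N) \<in> dom_h0 \<sigma>" unfolding R_def by (rule test_fun_in_dom)
  have "Re (h0 \<sigma> f f) = Re (h0 \<sigma> (test_fun (R N)) (test_fun (R N))) / (cmod c)\<^sup>2"
    unfolding f_def h0.diagonal_scale[OF D] by (simp add: norm_divide power_divide)
  also have "\<dots> \<le> \<epsilon>" using N c by (simp add: divide_le_eq)
  finally have "Re (h0 \<sigma> f f) \<le> \<epsilon>" .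
  moreover have "jet (m, a) f = 1"
    using c c_eq[of N] c_eq[of 0] i by (simp add: f_def jet_scale test_fun_L2 c_def)
  moreover have "\<forall>j\<in>idx. fst j \<noteq> m \<or> snd j < a \<longrightarrow> jet j f = 0"
    using zero by (simp add: f_def jet_scale test_fun_L2)
  moreover have "f \<in> dom_h0 \<sigma>" unfolding f_def using D by (rule h0.D_scale)
  ultimately show ?thesis by blast
qed

text \<open>Jet vectors that occur at arbitrarily small unperturbed energy; they form a subspace.\<close>

definition attainable :: "(nat \<times> nat \<Rightarrow> complex) \<Rightarrow> bool" where
  "attainable y \<longleftrightarrow> (\<forall>\<epsilon>>0. \<exists>f\<in>dom_h0 \<sigma>. (\<forall>j\<in>idx. jet j f = y j) \<and> Re (h0 \<sigma> f f) \<le> \<epsilon>)"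

lemma attainable_add:
  assumes "attainable y" "attainable z"
  shows "attainable (\<lambda>j. y j + z j)"
  unfolding attainable_def
proof (intro allI impI)
  fix \<epsilon> :: real assume "\<epsilon> > 0"
  then have e: "\<epsilon> / 4 > 0" by simp
  obtain f where f: "f \<in> dom_h0 \<sigma>" "\<forall>j\<in>idx. jet j f = y j" "Re (h0 \<sigma> f f) \<le> \<epsilon> / 4"
    using assms(1)[unfolded attainable_def, rule_format, OF e] by blast
  obtain g where g: "g \<in> dom_h0 \<sigma>" "\<forall>j\<in>idx. jet j g = z j" "Re (h0 \<sigma> g g) \<le> \<epsilon> / 4"
    using assms(2)[unfolded attainable_def, rule_format, OF e] by blast
  have "Re (h0 \<sigma> (f + g) (f + g)) \<le> 2 * Re (h0 \<sigma> f f) + 2 * Re (h0 \<sigma> g g)"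
    using h0.nonneg[OF h0.D_diff[OF f(1) g(1)]] f g by (simp add: h0.diagonal_add h0.diagonal_diff)
  with f g have "Re (h0 \<sigma> (f + g) (f + g)) \<le> \<epsilon>" by simp
  moreover have "\<forall>j\<in>idx. jet j (f + g) = y j + z j" using f g by (simp add: jet_add dom_L2)
  ultimately show "\<exists>f\<in>dom_h0 \<sigma>. (\<forall>j\<in>idx. jet j f = y j + z j) \<and> Re (h0 \<sigma> f f) \<le> \<epsilon>"
    using h0.D_add[OF f(1) g(1)] by blast
qed

lemma attainable_scale:
  assumes "attainable y"
  shows "attainable (\<lambda>j. c * y j)"
  unfolding attainable_def
proof (intro allI impI)
  fix \<epsilon> :: real assume \<epsilon>: "\<epsilon> > 0"
  have pos: "(cmod c)\<^sup>2 + 1 > 0" by (simp add: add_nonneg_pos)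
  with assms \<epsilon> obtain f where f: "f \<in> dom_h0 \<sigma>" "\<forall>j\<in>idx. jet j f = y j"
    "Re (h0 \<sigma> f f) \<le> \<epsilon> / ((cmod c)\<^sup>2 + 1)" unfolding attainable_def by (meson divide_pos_pos)
  have "Re (h0 \<sigma> (fscale c f) (fscale c f)) \<le> ((cmod c)\<^sup>2 + 1) * Re (h0 \<sigma> f f)"
    using h0.nonneg[OF f(1)] by (simp add: h0.diagonal_scale[OF f(1)] algebra_simps)
  also have "\<dots> \<le> \<epsilon>" using f(3) pos by (simp add: field_simps)
  finally have "Re (h0 \<sigma> (fscale c f) (fscale c f)) \<le> \<epsilon>" .
  then show "\<exists>f\<in>dom_h0 \<sigma>. (\<forall>j\<in>idx. jet j f = c * y j) \<and> Re (h0 \<sigma> f f) \<le> \<epsilon>"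
    using f h0.D_scale[OF f(1), of c] by (intro bexI[of _ "fscale c f"]) (auto simp: jet_scale dom_L2)
qed

lemma attainable_zero: "attainable (\<lambda>j. 0)"
  unfolding attainable_def
proof (intro allI impI)
  fix \<epsilon> :: real assume "\<epsilon> > 0"
  moreover have "h0 \<sigma> 0 0 = 0" using h0.zero_left[OF h0.D_zero] .
  moreover have "jet j 0 = 0" if "j \<in> idx" for j
    using jet_diff[OF that L2.D_zero L2.D_zero] by simp
  ultimately show "\<exists>f\<in>dom_h0 \<sigma>. (\<forall>j\<in>idx. jet j f = 0) \<and> Re (h0 \<sigma> f f) \<le> \<epsilon>"
    using h0.D_zero by (intro bexI[of _ 0]) auto
qed

lemma attainable_sum:
  assumes "finite S" "\<And>k. k \<in> S \<Longrightarrow> attainable (y k)"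
  shows "attainable (\<lambda>j. \<Sum>k\<in>S. c k * y k j)"
  using assms
proof (induction S rule: finite_induct)
  case empty
  then show ?case by (simp add: attainable_zero)
next
  case (insert k S)
  have "attainable (\<lambda>j. c k * y k j)" using insert.prems by (intro attainable_scale) auto
  moreover have "attainable (\<lambda>j. \<Sum>k\<in>S. c k * y k j)" using insert by simp
  ultimately have "attainable (\<lambda>j. c k * y k j + (\<Sum>k\<in>S. c k * y k j))"
    by (rule attainable_add)
  then show ?case using insert.hyps by simp
qed

text \<open>Descending induction on the order: the uncontrolled higher jets of a function provided by
\<open>leading_jet\<close> are removed by a function whose jets have higher order. That function may have small
energy however large the jets to be removed are, because it is chosen after them.\<close>

lemma attainable_unit:
  assumes "(m, a) \<in> idx"
  shows "attainable (\<lambda>j. of_bool (j = (m, a)))"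
  using assms
proof (induction "K m - a" arbitrary: a rule: less_induct)
  case less
  have m: "m \<in> Ix" "a \<le> K m" using less.prems by (auto simp: idx_def)
  show ?case unfolding attainable_def
  proof (intro allI impI)
    fix \<epsilon> :: real assume \<epsilon>: "\<epsilon> > 0"
    then obtain f where f: "f \<in> dom_h0 \<sigma>" "jet (m, a) f = 1"
      "\<forall>j\<in>idx. fst j \<noteq> m \<or> snd j < a \<longrightarrow> jet j f = 0" "Re (h0 \<sigma> f f) \<le> \<epsilon> / 4"
      using leading_jet[OF less.prems, of "\<epsilon> / 4"] by auto
    define z where "z j = (\<Sum>b\<in>{a<..K m}. (- jet (m, b) f) * of_bool (j = (m, b)))" for j
    have "attainable z" unfolding z_def
      using less.hyps m by (intro attainable_sum) (auto simp: idx_def)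
    then obtain g where g: "g \<in> dom_h0 \<sigma>" "\<forall>j\<in>idx. jet j g = z j" "Re (h0 \<sigma> g g) \<le> \<epsilon> / 4"
      using \<epsilon> unfolding attainable_def by (meson divide_pos_pos zero_less_numeral)
    have "jet j f + z j = of_bool (j = (m, a))" if j: "j \<in> idx" for j
    proof (cases "fst j = m \<and> a < snd j")
      case True
      then have jm: "j = (m, snd j)" by (metis prod.collapse)
      have "z j = (\<Sum>b\<in>{a<..K m}. if b = snd j then - jet j f else 0)"
        unfolding z_def using jm by (intro sum.cong) auto
      also have "\<dots> = - jet j f" using True j by (simp add: idx_def) (metis mem_Sigma_iff atMost_iff prod.collapse)
      finally have "z j = - jet j f" .
      moreover have "j \<noteq> (m, a)" using conjunct2[OF True] by (metis less_irrefl snd_conv)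
      ultimately show ?thesis by simp
    next
      case False
      then have "z j = 0" unfolding z_def by (intro sum.neutral) auto
      moreover have "jet j f = of_bool (j = (m, a))"
        using False f(2,3) j by (cases "j = (m, a)") (auto simp: prod_eq_iff)
      ultimately show ?thesis by simp
    qed
    then have "\<forall>j\<in>idx. jet j (f + g) = of_bool (j = (m, a))" using f g by (simp add: jet_add dom_L2)
    moreover have "Re (h0 \<sigma> (f + g) (f + g)) \<le> 2 * Re (h0 \<sigma> f f) + 2 * Re (h0 \<sigma> g g)"
      using h0.nonneg[OF h0.D_diff[OF f(1) g(1)]] f g by (simp add: h0.diagonal_add h0.diagonal_diff)
    then have "Re (h0 \<sigma> (f + g) (f + g)) \<le> \<epsilon>" using f g by simp
    ultimately show "\<exists>f\<in>dom_h0 \<sigma>. (\<forall>j\<in>idx. jet j f = of_bool (j = (m, a))) \<and> Re (h0 \<sigma> f f) \<le> \<epsilon>"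
      using h0.D_add[OF f(1) g(1)] by blast
  qed
qed

theorem every_jet_attainable: "attainable y"
proof -
  have "attainable (\<lambda>j. \<Sum>k\<in>idx. y k * of_bool (j = k))"
    using finite_idx attainable_unit by (intro attainable_sum) auto
  moreover have "(\<Sum>k\<in>idx. y k * of_bool (j = k)) = y j" if "j \<in> idx" for j
  proof -
    have "(\<Sum>k\<in>idx. y k * of_bool (j = k)) = (\<Sum>k\<in>idx. if k = j then y j else 0)"
      by (intro sum.cong) auto
    then show ?thesis using that finite_idx by simp
  qed
  ultimately show ?thesis by (simp add: attainable_def cong: ball_cong)
qed

end

section \<open>The negative subspace and the number of eigenvalues\<close>

text \<open>The last two conditions make \<open>card J\<close> the number of negative squares of the form. By \<open>J_self\<close> it
contains at most one index of each pair interchanged by the antidiagonal symmetry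
\<open>(m, a) \<mapsto> (star m, K m - a)\<close>, and a fixed index only if the antidiagonal entry is negative; by
\<open>J_rest\<close> the form of the remaining jets is diagonal and nonnegative.\<close>

locale hankel_count = hankel_model +
  fixes J :: "(nat \<times> nat) set"
  assumes J_idx: "J \<subseteq> idx"
    and J_self: "\<lbrakk>(m, a) \<in> J; (star m, K m - a) \<in> J\<rbrakk>
      \<Longrightarrow> (star m, K m - a) = (m, a) \<and> q m (K m) = of_real (- cmod (q m (K m)))"
    and J_rest: "\<lbrakk>i \<in> idx - J; j \<in> idx - J; coupling i j \<noteq> 0\<rbrakk> \<Longrightarrow> i = j \<and> Re (coupling i j) \<ge> 0"
begin

sublocale pert: finite_rank_perturbation fscale "dom_h0 \<sigma>" inner_L2 "h0 \<sigma>" bform idx jet coupling jet_const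
proof -
  have sub: "dom_h0 \<sigma> \<subseteq> L2_Rplus" using dom_L2 by auto
  interpret ip: hermitian_form fscale "dom_h0 \<sigma>" inner_L2
    by (rule L2.subspace_restrict[OF dom_subspace sub])
  interpret ip: nonneg_form fscale "dom_h0 \<sigma>" inner_L2
    by unfold_locales (rule L2.nonneg[OF dom_L2])
  interpret b: hermitian_form fscale "dom_h0 \<sigma>" bform
    by (rule bform_hermitian_form[OF dom_subspace sub])
  show "finite_rank_perturbation fscale (dom_h0 \<sigma>) inner_L2 (h0 \<sigma>) bform idx jet coupling jet_const"
    by unfold_locales
      (auto simp: finite_idx jet_diff jet_bound dom_L2 bform_def intro!: h0_complete)
qed

text \<open>The symmetry of the antidiagonals and the entries on them.\<close>

definition \<tau> :: "nat \<times> nat \<Rightarrow> nat \<times> nat" where "\<tau> i = (star (fst i), K (fst i) - snd i)"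
definition \<kappa> :: "nat \<times> nat \<Rightarrow> complex" where "\<kappa> i = q (fst i) (K (fst i))"

lemma \<tau>_idx: "i \<in> idx \<Longrightarrow> \<tau> i \<in> idx"
  using star_in by (auto simp: \<tau>_def idx_def K_star)

lemma \<tau>_\<tau>: "i \<in> idx \<Longrightarrow> \<tau> (\<tau> i) = i"
  by (auto simp: \<tau>_def idx_def K_star star_star)

lemma \<kappa>_\<tau>: "i \<in> idx \<Longrightarrow> \<kappa> (\<tau> i) = cnj (\<kappa> i)"
  by (auto simp: \<tau>_def \<kappa>_def idx_def K_star q_star)

lemma \<kappa>_nz: "i \<in> idx \<Longrightarrow> \<kappa> i \<noteq> 0"
  using P_nz by (auto simp: \<kappa>_def q_def idx_def)

text \<open>The entry of the form with indices \<open>(m, b)\<close> and \<open>(star m, a)\<close> is multiplied by \<open>\<delta> ^ (2 * (K m - a - b))\<close>,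
which is \<open>1\<close> on the antidiagonal and tends to \<open>0\<close> elsewhere.\<close>

definition scaling :: "real \<Rightarrow> nat \<times> nat \<Rightarrow> complex" where
  "scaling \<delta> i = of_real (\<delta> ^ K (fst i) / \<delta> ^ (2 * snd i))"

lemma scaled_coupling_limit:
  assumes "i \<in> idx" "j \<in> idx"
  shows "((\<lambda>\<delta>. coupling i j * (scaling \<delta> i * scaling \<delta> j)) \<longlongrightarrow> (if j = \<tau> i then \<kappa> i else 0)) (at_right 0)"
proof (cases "fst j = star (fst i) \<and> snd i + snd j \<le> K (fst i)")
  case True
  have m: "fst i \<in> Ix" using assms by (auto simp: idx_def)
  define r where "r = K (fst i) - (snd i + snd j)"
  have "scaling \<delta> i * scaling \<delta> j = of_real (\<delta> ^ (2 * r))" if "\<delta> > 0" for \<delta>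
  proof -
    have "\<delta> ^ K (fst i) * \<delta> ^ K (fst i) = \<delta> ^ (2 * r) * (\<delta> ^ (2 * snd i) * \<delta> ^ (2 * snd j))"
    proof -
      have "K (fst i) + K (fst i) = 2 * r + (2 * snd i + 2 * snd j)"
        unfolding r_def using conjunct2[OF True] by arith
      then show ?thesis by (simp only: power_add[symmetric])
    qed
    then have "(\<delta> ^ K (fst i) / \<delta> ^ (2 * snd i)) * (\<delta> ^ K (fst i) / \<delta> ^ (2 * snd j)) = \<delta> ^ (2 * r)"
      using that by (simp add: field_simps)
    then show ?thesis unfolding scaling_def using True K_star[OF m] by (metis of_real_mult)
  qed
  then have ev: "\<forall>\<^sub>F \<delta> in at_right 0. coupling i j * of_real (\<delta> ^ (2 * r)) = coupling i j * (scaling \<delta> i * scaling \<delta> j)"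
    by (auto simp: eventually_at_filter)
  have lim: "((\<lambda>\<delta>. coupling i j * of_real (\<delta> ^ (2 * r))) \<longlongrightarrow> coupling i j * of_real (0 ^ (2 * r))) (at_right 0)"
    by (intro tendsto_intros)
  have val: "coupling i j * of_real (0 ^ (2 * r)) = (if j = \<tau> i then \<kappa> i else 0)"
  proof (cases "r = 0")
    case r: True
    then have eq: "snd i + snd j = K (fst i)" using True by (simp add: r_def)
    then have "j = \<tau> i" using True by (auto simp: \<tau>_def prod_eq_iff)
    then show ?thesis using r True eq by (simp add: coupling_def \<kappa>_def)
  next
    case r: False
    then have "j \<noteq> \<tau> i" using True by (auto simp: \<tau>_def r_def)
    then show ?thesis using r by simp
  qed
  show ?thesis using Lim_transform_eventually[OF lim ev] unfolding val .
next
  case False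
  then have "coupling i j = 0" "j \<noteq> \<tau> i" using assms by (auto simp: coupling_def \<tau>_def idx_def)
  then show ?thesis by simp
qed

text \<open>The two unit vectors exchanged by \<open>\<tau>\<close>, combined with the phase that makes both cross terms of the
limit form equal to \<open>- cmod (\<kappa> j)\<close>. If \<open>\<tau> j = j\<close> and \<open>\<kappa> j < 0\<close>, the phase is \<open>- 1\<close> and the vector is twice the unit vector.\<close>

definition direction :: "nat \<times> nat \<Rightarrow> nat \<times> nat \<Rightarrow> complex" where
  "direction j i = of_bool (i = j) - \<kappa> j / of_real (cmod (\<kappa> j)) * of_bool (i = \<tau> j)"

lemma finite_J: "finite J" using J_idx finite_idx by (rule finite_subset)

text \<open>The value on the diagonal is \<open>- 2 * cmod (\<kappa> j)\<close> when \<open>\<tau> j \<noteq> j\<close> and \<open>- 4 * cmod (\<kappa> j)\<close> when \<open>\<tau> j = j\<close>.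
Different directions have disjoint supports that \<open>\<tau>\<close> preserves, so they are orthogonal.\<close>

lemma limit_form:
  assumes jk: "j \<in> J" "k \<in> J"
  shows "\<exists>g. g \<ge> 2 * cmod (\<kappa> j) \<and>
    (\<Sum>i\<in>idx. \<Sum>i'\<in>idx. (if i' = \<tau> i then \<kappa> i else 0) * direction j i * cnj (direction k i'))
      = - of_real g * of_bool (j = k)"
proof -
  define \<omega> where "\<omega> j = \<kappa> j / of_real (cmod (\<kappa> j))" for j
  have idx: "j \<in> idx" "k \<in> idx" using jk J_idx by auto
  have "(\<Sum>i'\<in>idx. (if i' = \<tau> i then \<kappa> i else 0) * direction j i * cnj (direction k i'))
      = (\<Sum>i'\<in>idx. if i' = \<tau> i then \<kappa> i * direction j i * cnj (direction k (\<tau> i)) else 0)" for i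
    by (intro sum.cong) auto
  then have "(\<Sum>i\<in>idx. \<Sum>i'\<in>idx. (if i' = \<tau> i then \<kappa> i else 0) * direction j i * cnj (direction k i'))
      = (\<Sum>i\<in>idx. \<kappa> i * direction j i * cnj (direction k (\<tau> i)))"
    using finite_idx \<tau>_idx by (simp cong: sum.cong)
  also have "\<dots> = (\<Sum>i\<in>idx. (if i = j then \<kappa> j * cnj (direction k (\<tau> j)) else 0)
      - (if i = \<tau> j then \<omega> j * (\<kappa> (\<tau> j) * cnj (direction k j)) else 0))"
    using \<tau>_\<tau>[OF idx(1)]
    by (intro sum.cong refl) (auto simp: direction_def[of j] \<omega>_def algebra_simps)
  also have "\<dots> = \<kappa> j * cnj (direction k (\<tau> j)) - \<omega> j * (cnj (\<kappa> j) * cnj (direction k j))"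
    using finite_idx idx \<tau>_idx by (simp add: sum_subtractf \<kappa>_\<tau>)
  finally have eq: "(\<Sum>i\<in>idx. \<Sum>i'\<in>idx. (if i' = \<tau> i then \<kappa> i else 0) * direction j i * cnj (direction k i'))
      = \<kappa> j * cnj (direction k (\<tau> j)) - \<omega> j * (cnj (\<kappa> j) * cnj (direction k j))" .
  have self: "\<tau> x = x \<and> \<kappa> x = of_real (- cmod (\<kappa> x))" if "x \<in> J" "\<tau> x \<in> J" for x
    using J_self[of "fst x" "snd x"] that by (simp add: \<tau>_def \<kappa>_def)
  have pol: "\<kappa> j * cnj (\<omega> j) = of_real (cmod (\<kappa> j))" "\<omega> j * cnj (\<kappa> j) = of_real (cmod (\<kappa> j))"
    using \<kappa>_nz[OF idx(1)] complex_norm_square[of "\<kappa> j"]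
    by (simp_all add: \<omega>_def field_simps power2_eq_square)
  show ?thesis
  proof (cases "j = k")
    case False
    have "\<tau> j \<noteq> k" using False self[of j] jk by auto
    moreover have "j \<noteq> \<tau> k" using False self[of k] jk by auto
    moreover have "\<tau> j \<noteq> \<tau> k" using False \<tau>_\<tau> idx by metis
    ultimately have "direction k (\<tau> j) = 0" "direction k j = 0" using False by (auto simp: direction_def)
    then show ?thesis unfolding eq using False by auto
  next
    case True
    show ?thesis
    proof (cases "\<tau> j = j")
      case fixed: True
      then have neg: "\<kappa> j = of_real (- cmod (\<kappa> j))" using self[of j] jk by auto
      then have "\<omega> j = -1" using \<kappa>_nz[OF idx(1)] unfolding \<omega>_def
        by (metis divide_minus_left divide_self_if norm_eq_zero of_real_eq_0_iff of_real_minus)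
      then have "direction j j = 2" using fixed by (simp add: direction_def \<omega>_def)
      then have "\<kappa> j * cnj (direction k (\<tau> j)) - \<omega> j * (cnj (\<kappa> j) * cnj (direction k j))
          = 2 * \<kappa> j + 2 * cnj (\<kappa> j)" using fixed True \<open>\<omega> j = -1\<close> by simp
      also have "\<dots> = - of_real (4 * cmod (\<kappa> j))" using neg by (metis (no_types, opaque_lifting)
          add.commute complex_cnj_complex_of_real mult_minus_right of_real_minus of_real_mult of_real_numeral
          distrib_right numeral_Bit0 minus_add_distrib)
      finally show ?thesis unfolding eq using True by (intro exI[of _ "4 * cmod (\<kappa> j)"]) simp
    next
      case False
      then have "direction j j = 1" "direction j (\<tau> j) = - \<omega> j" by (auto simp: direction_def \<omega>_def)
      then have "\<kappa> j * cnj (direction k (\<tau> j)) - \<omega> j * (cnj (\<kappa> j) * cnj (direction k j))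
          = - of_real (2 * cmod (\<kappa> j))" using True pol by simp
      then show ?thesis unfolding eq using True by (intro exI[of _ "2 * cmod (\<kappa> j)"]) simp
    qed
  qed
qed

text \<open>For small \<open>\<delta>\<close> the form of \<open>V\<close> on the rescaled directions is close to a negative diagonal matrix;
realising these jets at small energy changes the Gram matrix by as little as needed.\<close>

theorem negative_trial_space:
  "\<exists>f. (\<forall>j\<in>J. f j \<in> dom_h0 \<sigma>) \<and> (\<forall>c. (\<exists>j\<in>J. c j \<noteq> 0) \<longrightarrow>
     Re (pert.h (\<Sum>j\<in>J. fscale (c j) (f j)) (\<Sum>j\<in>J. fscale (c j) (f j))) < 0)"
proof -
  define G where "G \<delta> j k = (\<Sum>i\<in>idx. \<Sum>i'\<in>idx. coupling i i' * (scaling \<delta> i * direction j i)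
      * cnj (scaling \<delta> i' * direction k i'))" for \<delta> j k
  define G0 where "G0 j k = (\<Sum>i\<in>idx. \<Sum>i'\<in>idx. (if i' = \<tau> i then \<kappa> i else 0) * direction j i
      * cnj (direction k i'))" for j k
  have G_lim: "((\<lambda>\<delta>. G \<delta> j k) \<longlongrightarrow> G0 j k) (at_right 0)" for j k
  proof -
    have "G \<delta> j k = (\<Sum>i\<in>idx. \<Sum>i'\<in>idx. coupling i i' * (scaling \<delta> i * scaling \<delta> i') * direction j i
        * cnj (direction k i'))" for \<delta>
      unfolding G_def by (intro sum.cong refl) (simp add: scaling_def)
    then show ?thesis unfolding G0_def by (simp only:) (intro tendsto_intros scaled_coupling_limit)
  qed
  have "\<forall>j\<in>J. \<exists>g. g \<ge> 2 * cmod (\<kappa> j) \<and> G0 j j = - of_real g"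
    using limit_form unfolding G0_def by fastforce
  then obtain g where g: "\<And>j. j \<in> J \<Longrightarrow> g j \<ge> 2 * cmod (\<kappa> j)" "\<And>j. j \<in> J \<Longrightarrow> G0 j j = - of_real (g j)"
    by metis
  have G0: "G0 j k = - of_real (g j) * of_bool (j = k)" if "j \<in> J" "k \<in> J" for j k
    using limit_form[OF that] g(2)[OF that(1)] unfolding G0_def by (cases "j = k") auto
  obtain d where d: "d > 0" "\<And>j. j \<in> J \<Longrightarrow> d \<le> g j"
  proof
    let ?d = "Min (insert 1 (g ` J))"
    have "g j > 0" if "j \<in> J" for j
      using g(1)[OF that] \<kappa>_nz[of j] that J_idx by (smt (verit) zero_less_norm_iff subsetD)
    then show "?d > 0" using finite_J by simp
    show "?d \<le> g j" if "j \<in> J" for j using finite_J that by (intro Min_le) auto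
  qed
  define \<eta> where "\<eta> = d / (4 * (real (card J) + 1))"
  have \<eta>: "\<eta> > 0" using d(1) by (simp add: \<eta>_def)
  have "\<forall>\<^sub>F \<delta> in at_right 0. \<forall>j\<in>J. \<forall>k\<in>J. dist (G \<delta> j k) (G0 j k) < \<eta>"
    using finite_J tendstoD[OF G_lim \<eta>] by (intro eventually_ball_finite ballI)
  then have "\<forall>\<^sub>F \<delta> in at_right 0. (\<forall>j\<in>J. \<forall>k\<in>J. dist (G \<delta> j k) (G0 j k) < \<eta>)" .
  then obtain \<delta> where \<delta>: "\<And>j k. j \<in> J \<Longrightarrow> k \<in> J \<Longrightarrow> dist (G \<delta> j k) (G0 j k) < \<eta>"
    using eventually_happens'[OF trivial_limit_at_right_real] by blast
  have "\<exists>f\<in>dom_h0 \<sigma>. (\<forall>i\<in>idx. jet i f = scaling \<delta> i * direction j i) \<and> Re (h0 \<sigma> f f) \<le> \<eta>" for j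
    using every_jet_attainable[of "\<lambda>i. scaling \<delta> i * direction j i"] \<eta> by (simp add: attainable_def)
  then obtain f where f: "\<And>j. f j \<in> dom_h0 \<sigma>"
    "\<And>i j. i \<in> idx \<Longrightarrow> jet i (f j) = scaling \<delta> i * direction j i" "\<And>j. Re (h0 \<sigma> (f j) (f j)) \<le> \<eta>"
    by metis
  interpret h: hermitian_form fscale "dom_h0 \<sigma>" pert.h
    using hermitian_form_plus[OF h0.hermitian_form_axioms pert.b.hermitian_form_axioms, of 1] by simp
  have near: "cmod (pert.h (f j) (f k) + of_real (g j) * of_bool (j = k)) \<le> 2 * \<eta>"
    if "j \<in> J" "k \<in> J" for j k
  proof -
    have "bform (f j) (f k) = G \<delta> j k"
      unfolding bform_def G_def using f(2) by (intro sum.cong refl) simp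
    then have eq: "pert.h (f j) (f k) + of_real (g j) * of_bool (j = k)
        = h0 \<sigma> (f j) (f k) + (G \<delta> j k - G0 j k)"
      using G0[OF that] by simp
    have "cmod (h0 \<sigma> (f j) (f k)) \<le> sqrt \<eta> * sqrt \<eta>"
      by (rule order.trans[OF h0.Cauchy_Schwarz_sqrt[OF f(1) f(1)]])
        (intro mult_mono real_sqrt_le_mono f(3); simp add: \<eta> less_imp_le h0.nonneg f)
    moreover have "cmod (G \<delta> j k - G0 j k) \<le> \<eta>" using \<delta>[OF that] by (simp add: dist_norm)
    ultimately show ?thesis unfolding eq
      using norm_triangle_ineq[of "h0 \<sigma> (f j) (f k)" "G \<delta> j k - G0 j k"] \<eta> by simp
  qed
  have "2 * \<eta> * real (card J) < d" using d(1) by (simp add: \<eta>_def field_simps add_pos_nonneg)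
  then have "\<forall>c. (\<exists>j\<in>J. c j \<noteq> 0) \<longrightarrow>
     Re (pert.h (\<Sum>j\<in>J. fscale (c j) (f j)) (\<Sum>j\<in>J. fscale (c j) (f j))) < 0"
    using h.nearly_diagonal_negative[OF finite_J f(1) near d(2)] by blast
  then show ?thesis using f(1) by blast
qed

lemma bform_nonneg:
  assumes "f \<in> dom_h0 \<sigma>" "\<And>j. j \<in> J \<Longrightarrow> jet j f = 0"
  shows "0 \<le> Re (bform f f)"
proof -
  have "0 \<le> Re (coupling i j * jet i f * cnj (jet j f))" if ij: "i \<in> idx" "j \<in> idx" for i j
  proof (cases "i \<in> J \<or> j \<in> J \<or> coupling i j = 0")
    case True
    then show ?thesis using assms(2)[of i] assms(2)[of j] by auto
  next
    case False
    then have "i = j" "Re (coupling i j) \<ge> 0" using J_rest ij by blast+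
    have "coupling i i * jet i f * cnj (jet i f) = coupling i i * of_real ((cmod (jet i f))\<^sup>2)"
      unfolding complex_norm_square by (simp add: mult.assoc)
    then have "Re (coupling i j * jet i f * cnj (jet j f)) = Re (coupling i i * of_real ((cmod (jet i f))\<^sup>2))"
      unfolding \<open>i = j\<close>[symmetric] by (rule arg_cong)
    also have "\<dots> = Re (coupling i i) * (cmod (jet i f))\<^sup>2" by (simp flip: of_real_power)
    also have "\<dots> \<ge> 0" using \<open>i = j\<close> \<open>Re (coupling i j) \<ge> 0\<close> by simp
    finally show ?thesis .
  qed
  then show ?thesis unfolding bform_def by (auto intro!: sum_nonneg)
qed

end

lemma Sup_enat_bounded_attained:
  fixes A :: "enat set"
  assumes "A \<noteq> {}" "\<And>x. x \<in> A \<Longrightarrow> x \<le> enat n"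
  shows "Sup A \<in> A"
  using assms finite_enat_bounded[OF assms(2)] by (simp add: Sup_enat_def)

text \<open>The upper bound holds for every choice of independent eigenvectors, so all multiplicities are finite
and attained. For the lower bound the orthonormal eigenvectors are grouped by eigenvalue.\<close>

theorem (in hankel_count) N_minus_eq_card:
  assumes v: "\<And>t. t > 0 \<Longrightarrow> v t = (\<Sum>m\<in>Ix. poly (P m) (of_real t) * exp (- \<beta> m * of_real t))"
  shows "N_minus (perturbed_hankel \<sigma> v) = enat (card J)"
proof -
  let ?H = "perturbed_hankel \<sigma> v"
  have eig: "f \<in> eigenspace ?H l \<longleftrightarrow> pert.eigenpair f l" for f l
  proof -
    have "inner_L2 (\<lambda>t. of_real l * f t) \<phi> = of_real l * inner_L2 f \<phi>" if "f \<in> dom_h0 \<sigma>" "\<phi> \<in> dom_h0 \<sigma>" for \<phi>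
      using L2.scale_left[OF that[THEN dom_L2], of "of_real l"] by (simp add: fscale_def)
    moreover have "(\<lambda>t. of_real l * f t) \<in> L2_Rplus" if "f \<in> dom_h0 \<sigma>"
      using L2.D_scale[OF dom_L2[OF that], of "of_real l"] by (simp add: fscale_def)
    ultimately show ?thesis
      using hankel_form[OF v]
      by (auto simp: eigenspace_def perturbed_hankel_def form_operator_def pert.eigenpair_def dom_L2)
  qed
  have eigD: "f \<in> dom_h0 \<sigma>" if "f \<in> eigenspace ?H l" for f l
    using that by (simp add: eig pert.eigenpair_def)
  have upper: "(\<Sum>l\<in>F. card (S l)) \<le> card J"
    if F: "finite F" "\<And>l. l \<in> F \<Longrightarrow> l < 0"
      and S: "\<And>l. l \<in> F \<Longrightarrow> finite (S l) \<and> S l \<subseteq> eigenspace ?H l \<and> lin_indep_ae (S l)" for F S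
  proof -
    let ?S = "Sigma F S"
    have SD: "x \<in> dom_h0 \<sigma>" if "l \<in> F" "x \<in> S l" for l x using S[OF that(1)] that(2) eigD by blast
    have "card ?S \<le> card J"
    proof (rule pert.negative_eigenvectors_le_functionals[where x = snd and l = fst and \<phi> = jet])
      show "finite ?S" using F S by blast
      show "finite J" by (rule finite_J)
      show "jet k (\<Sum>i\<in>?S. fscale (c i) (snd i)) = (\<Sum>i\<in>?S. c i * jet k (snd i))" if "k \<in> J" for k c
        using that J_idx SD by (intro jet_sum) (auto intro!: dom_L2)
      show "0 \<le> Re (bform y y)" if "y \<in> dom_h0 \<sigma>" "\<And>k. k \<in> J \<Longrightarrow> jet k y = 0" for y
        using that by (rule bform_nonneg)
      show "pert.eigenpair (snd i) (fst i)" if "i \<in> ?S" for i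
        using that S[of "fst i"] eig by (metis SigmaE fst_conv snd_conv subsetD)
      show "fst i < 0" if "i \<in> ?S" for i using that F by auto
      fix c :: "real \<times> (real \<Rightarrow> complex) \<Rightarrow> complex"
      assume null: "\<And>t. let y = (\<Sum>i\<in>{i\<in>?S. fst i = t}. fscale (c i) (snd i)) in inner_L2 y y = 0"
      show "\<forall>i\<in>?S. c i = 0"
      proof
        fix i assume i: "i \<in> ?S"
        define t where "t = fst i"
        have t: "t \<in> F" "snd i \<in> S t" using i by (auto simp: t_def)
        have "{i\<in>?S. fst i = t} = Pair t ` S t" using t by auto
        then have sum: "(\<Sum>i\<in>{i\<in>?S. fst i = t}. fscale (c i) (snd i)) = (\<Sum>f\<in>S t. fscale (c (t, f)) f)"
          by (simp add: sum.reindex inj_on_def)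
        have "(\<Sum>f\<in>S t. fscale (c (t, f)) f) \<in> L2_Rplus"
          using S[OF t(1)] eigD dom_L2 by (intro L2.D_combination) blast
        then have "AE x in Rplus. (\<Sum>f\<in>S t. c (t, f) * f x) = 0"
          using null[of t] inner_L2_eq_0_iff by (simp add: sum Let_def fscale_sum_apply)
        then have "\<forall>f\<in>S t. c (t, f) = 0"
          using S[OF t(1)] unfolding lin_indep_ae_def by (meson)
        then show "c i = 0" using t by (metis prod.collapse t_def)
      qed
    qed
    then show ?thesis using F S by (subst (asm) card_SigmaI) auto
  qed
  have le: "N_minus ?H \<le> enat (card J)"
    unfolding N_minus_def
  proof (rule SUP_least)
    fix F assume "F \<in> {F. finite F \<and> F \<subseteq> {l. l < 0 \<and> is_eigenvalue ?H l}}"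
    then have F: "finite F" "\<And>l. l \<in> F \<Longrightarrow> l < 0" by auto
    have "\<exists>S. finite S \<and> S \<subseteq> eigenspace ?H l \<and> lin_indep_ae S \<and> multiplicity_of ?H l = enat (card S)"
      if l: "l \<in> F" for l
    proof -
      let ?A = "(\<lambda>S. enat (card S)) ` {S. finite S \<and> S \<subseteq> eigenspace ?H l \<and> lin_indep_ae S}"
      have "{} \<in> {S. finite S \<and> S \<subseteq> eigenspace ?H l \<and> lin_indep_ae S}" by (simp add: lin_indep_ae_def)
      then have "?A \<noteq> {}" by blast
      moreover have "x \<le> enat (card J)" if x: "x \<in> ?A" for x
      proof -
        obtain S where S: "finite S \<and> S \<subseteq> eigenspace ?H l \<and> lin_indep_ae S" "x = enat (card S)"
          using x by auto
        have "(\<Sum>l'\<in>{l}. card S) \<le> card J" by (rule upper) (use S(1) F(2)[OF l] in auto)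
        then show ?thesis using S(2) by simp
      qed
      ultimately have "Sup ?A \<in> ?A" by (rule Sup_enat_bounded_attained)
      then show ?thesis unfolding multiplicity_of_def by auto
    qed
    then obtain S where S: "\<And>l. l \<in> F \<Longrightarrow> finite (S l) \<and> S l \<subseteq> eigenspace ?H l \<and> lin_indep_ae (S l)"
      "\<And>l. l \<in> F \<Longrightarrow> multiplicity_of ?H l = enat (card (S l))" by metis
    have "(\<Sum>l\<in>F. multiplicity_of ?H l) = (\<Sum>l\<in>F. enat (card (S l)))"
      using S(2) by (intro sum.cong) auto
    also have "\<dots> = enat (\<Sum>l\<in>F. card (S l))"
      by (simp flip: of_nat_eq_enat)
    also have "\<dots> \<le> enat (card J)" using upper[of F S] F S(1) by simp
    finally show "(\<Sum>l\<in>F. multiplicity_of ?H l) \<le> enat (card J)" .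
  qed
  obtain f where f: "\<And>j. j \<in> J \<Longrightarrow> f j \<in> dom_h0 \<sigma>"
    "\<And>c. (\<exists>j\<in>J. c j \<noteq> 0) \<Longrightarrow> Re (pert.h (\<Sum>j\<in>J. fscale (c j) (f j)) (\<Sum>j\<in>J. fscale (c j) (f j))) < 0"
    using negative_trial_space by blast
  obtain e l where el: "\<And>i. i < card J \<Longrightarrow> pert.eigenpair (e i) (l i)" "\<And>i. i < card J \<Longrightarrow> l i < (0::real)"
    "\<And>i j. i < card J \<Longrightarrow> j < card J \<Longrightarrow> inner_L2 (e i) (e j) = of_bool (i = j)"
    using pert.eigenvectors_of_negative_subspace[OF finite_J f] by blast
  define n where "n = card J"
  have eL2: "e i \<in> L2_Rplus" if "i < n" for i
    using el(1)[of i] that by (simp add: n_def pert.eigenpair_def dom_L2)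
  have inj: "inj_on e {..<n}"
  proof (rule inj_onI)
    fix i j assume ij: "i \<in> {..<n}" "j \<in> {..<n}" "e i = e j"
    then have "inner_L2 (e i) (e j) = 1" using el(3)[of j j] by (simp add: n_def)
    then show "i = j" using el(3)[of i j] ij by (simp add: n_def split: if_splits)
  qed
  define S where "S t = e ` {i. i < n \<and> l i = t}" for t
  have S_eig: "S t \<subseteq> eigenspace ?H t" for t using el(1) by (auto simp: S_def n_def eig)
  have S_indep: "lin_indep_ae (S t)" for t
    unfolding lin_indep_ae_def
  proof (intro allI impI ballI)
    fix c f assume AE: "AE x in Rplus. (\<Sum>f\<in>S t. c f * f x) = 0" and "f \<in> S t"
    then obtain k where k: "k < n" "l k = t" "f = e k" by (auto simp: S_def)
    have SL2: "g \<in> L2_Rplus" if "g \<in> S t" for g using that eL2 by (auto simp: S_def)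
    have "inner_L2 (\<Sum>g\<in>S t. fscale (c g) g) f = 0"
      using AE SL2 \<open>f \<in> S t\<close> by (intro AE_zero_inner L2.D_combination) (auto simp: fscale_sum_apply)
    then have "(\<Sum>g\<in>S t. c g * inner_L2 g f) = 0"
      using SL2 \<open>f \<in> S t\<close> by (subst (asm) L2.sum_left) auto
    moreover have "inner_L2 g f = of_bool (g = f)" if "g \<in> S t" for g
    proof -
      obtain i where i: "i < n" "g = e i" using \<open>g \<in> S t\<close> by (auto simp: S_def)
      then have "i = k \<longleftrightarrow> g = f" using k inj by (auto dest: inj_onD)
      then show ?thesis using el(3)[of i k] i k by (simp add: n_def)
    qed
    then have "(\<Sum>g\<in>S t. c g * inner_L2 g f) = (\<Sum>g\<in>S t. if g = f then c f else 0)"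
      by (intro sum.cong) auto
    moreover have "finite (S t)" by (simp add: S_def)
    ultimately show "c f = 0" using \<open>f \<in> S t\<close> by simp
  qed
  define F where "F = l ` {..<n}"
  have "is_eigenvalue ?H (l i)" if "i < n" for i
  proof -
    have "inner_L2 (e i) (e i) \<noteq> 0" using el(3)[of i i] that by (simp add: n_def)
    then have "\<not> (AE t in Rplus. e i t = 0)" using inner_L2_eq_0_iff[OF eL2[OF that]] by simp
    then show ?thesis using el(1)[of i] that by (auto simp: is_eigenvalue_def eig n_def)
  qed
  then have F: "F \<in> {F. finite F \<and> F \<subseteq> {l. l < 0 \<and> is_eigenvalue ?H l}}"
    using el(2) by (auto simp: F_def n_def)
  have "n = (\<Sum>t\<in>F. card {i \<in> {..<n}. l i = t})"
    unfolding F_def using sum.image_gen[of "{..<n}" "\<lambda>_. 1::nat" l] by simp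
  also have "\<dots> = (\<Sum>t\<in>F. card (S t))"
    unfolding S_def by (intro sum.cong refl, subst card_image) (auto intro: inj_on_subset[OF inj])
  finally have "enat n = (\<Sum>t\<in>F. enat (card (S t)))" by (simp flip: of_nat_eq_enat)
  also have "\<dots> \<le> (\<Sum>t\<in>F. multiplicity_of ?H t)"
    unfolding multiplicity_of_def using S_eig S_indep
    by (intro sum_mono SUP_upper) (auto simp: S_def)
  also have "\<dots> \<le> N_minus ?H" unfolding N_minus_def by (rule SUP_upper[OF F])
  finally show ?thesis using le by (simp add: n_def)
qed

section \<open>The explicit count\<close>

lemma top_deriv_eq: "top_deriv p = Re (fact (degree p) * lead_coeff p)"
proof -
  have "coeff ((pderiv ^^ n) p) 0 = fact n * coeff p n" for n
    by (simp add: coeff_higher_pderiv pochhammer_fact[symmetric])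
  then show ?thesis by (simp add: top_deriv_def poly_0_coeff_0)
qed

text \<open>The conjugate polynomial agrees with \<open>r\<close> at infinitely many points.\<close>

lemma coeff_cnj_if_poly_cnj:
  fixes p r :: "complex poly"
  assumes "\<And>t. poly r (complex_of_real t) = cnj (poly p (complex_of_real t))"
  shows "coeff r k = cnj (coeff p k)"
proof -
  define s where "s = map_poly cnj p"
  have cs: "coeff s k = cnj (coeff p k)" for k by (simp add: s_def coeff_map_poly)
  have "degree s = degree p" unfolding s_def by (intro degree_map_poly) auto
  then have "poly s (complex_of_real t) = cnj (poly p (complex_of_real t))" for t
    by (simp add: poly_altdef cs)
  then have "range complex_of_real \<subseteq> {z. poly (r - s) z = 0}" using assms by auto
  moreover have "infinite (range complex_of_real)"
    by (metis finite_imageD inj_of_real infinite_UNIV_char_0)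
  ultimately have "infinite {z. poly (r - s) z = 0}" by (metis finite_subset)
  then have "r - s = 0" using poly_roots_finite by blast
  then show ?thesis using cs by simp
qed

text \<open>It remains to choose \<open>J\<close>. For a real exponent it consists of the lowest \<open>N_real (P m)\<close> orders, which
reach the middle of the antidiagonal exactly when \<open>K m\<close> is even and the antidiagonal entry is
negative. For a pair of conjugate exponents it consists of all orders at the one with positive
imaginary part.\<close>

theorem theorem5p1:
  fixes \<sigma>0 :: "real \<Rightarrow> real" and lp lm :: real
    and v :: "real \<Rightarrow> complex"
    and M M0 M1 :: nat
    and \<beta> :: "nat \<Rightarrow> complex" and P :: "nat \<Rightarrow> complex poly" and K :: "nat \<Rightarrow> nat"
  assumes \<sigma>0_nonneg: "\<And>l. l > 0 \<Longrightarrow> \<sigma>0 l \<ge> 0"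
    and \<sigma>0_Linf_loc: "\<sigma>0 \<in> Linf_loc_Rplus"
    and \<sigma>0_zero: "\<sigma>0 \<in> O[at_right 0](\<lambda>l. l powr (- lp))"
    and \<sigma>0_infinity: "\<sigma>0 \<in> O[at_top](\<lambda>l. l powr lm)"
    and lp: "lp < 1"
    and v_def: "\<And>t. t > 0 \<Longrightarrow> v t = (\<Sum>m=1..M. poly (P m) (of_real t) * exp (- \<beta> m * of_real t))"
    and v_real: "\<And>t. t > 0 \<Longrightarrow> v t = cnj (v t)"
    and \<beta>_distinct: "inj_on \<beta> {1..M}"
    and \<beta>_Re: "\<And>m. m \<in> {1..M} \<Longrightarrow> Re (\<beta> m) > 0"
    and P_nonzero: "\<And>m. m \<in> {1..M} \<Longrightarrow> P m \<noteq> 0"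
    and P_degree: "\<And>m. m \<in> {1..M} \<Longrightarrow> degree (P m) = K m"
    and M_eq: "M = M0 + 2 * M1"
    and real_\<beta>: "\<And>m. m \<in> {1..M0} \<Longrightarrow> Im (\<beta> m) = 0"
    and real_P: "\<And>m t. m \<in> {1..M0} \<Longrightarrow>
          poly (P m) (complex_of_real t) = cnj (poly (P m) (complex_of_real t))"
    and complex_\<beta>: "\<And>m. m \<in> {M0+1..M0+M1} \<Longrightarrow> Im (\<beta> m) > 0 \<and> \<beta> (M1 + m) = cnj (\<beta> m)"
    and complex_P: "\<And>m t. m \<in> {M0+1..M0+M1} \<Longrightarrow>
          poly (P (M1 + m)) (complex_of_real t) = cnj (poly (P m) (complex_of_real t))"
  shows "N_minus (perturbed_hankel \<sigma>0 v) =
           enat ((\<Sum>m=1..M0. N_real (P m)) + (\<Sum>m=M0+1..M0+M1. K m) + M1)"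
proof -
  \<comment> \<open>interchanges the two blocks of indices of conjugate exponents\<close>
  define star where "star m = (if m \<le> M0 then m else if m \<le> M0 + M1 then m + M1 else m - M1)" for m
  define n where "n m = (if m \<le> M0 then N_real (P m) else Suc (K m))" for m
  define J where "J = Sigma {1..M0 + M1} (\<lambda>m. {..<n m})"
  obtain d where d: "integrable Rplus (\<lambda>l. (1 / (1 + l)) ^ (2 * d) * \<sigma>0 l)"
    using moderate_growth[OF \<sigma>0_nonneg \<sigma>0_Linf_loc \<sigma>0_zero \<sigma>0_infinity lp] by blast
  have coeff_star: "coeff (P (star m)) k = cnj (coeff (P m) k)" and beta_star: "\<beta> (star m) = cnj (\<beta> m)"
    if m: "m \<in> {1..M}" for m k
  proof -
    consider "m \<in> {1..M0}" | "m \<in> {M0+1..M0+M1}" | "m - M1 \<in> {M0+1..M0+M1}" "M1 + (m - M1) = m" "m > M0 + M1"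
      using m M_eq by fastforce
    then have "coeff (P (star m)) k = cnj (coeff (P m) k) \<and> \<beta> (star m) = cnj (\<beta> m)"
    proof cases
      case 1
      then show ?thesis using coeff_cnj_if_poly_cnj[of "P m" "P m" k] real_P real_\<beta>
        by (auto simp: star_def complex_eq_iff)
    next
      case 2
      then have "star m = M1 + m" by (simp add: star_def)
      then show ?thesis
        using coeff_cnj_if_poly_cnj[of "P (M1 + m)" "P m" k] complex_P[OF 2] complex_\<beta>[OF 2] by simp
    next
      case 3
      then show ?thesis
        using coeff_cnj_if_poly_cnj[of "P m" "P (m - M1)" k] complex_P[OF 3(1)] complex_\<beta>[OF 3(1)]
        by (auto simp: star_def)
    qed
    then show "coeff (P (star m)) k = cnj (coeff (P m) k)" "\<beta> (star m) = cnj (\<beta> m)" by auto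
  qed
  interpret hankel_model "{1..M}" star \<beta> P \<sigma>0 d
  proof
    show "star m \<in> {1..M}" if "m \<in> {1..M}" for m using that M_eq by (auto simp: star_def)
    show "star (star m) = m" if "m \<in> {1..M}" for m using that M_eq by (auto simp: star_def)
    show "\<sigma>0 \<in> borel_measurable Rplus" using \<sigma>0_Linf_loc by (simp add: Linf_loc_Rplus_def)
  qed (use coeff_star beta_star \<beta>_distinct \<beta>_Re P_nonzero \<sigma>0_nonneg d in auto)
  have q_real: "q m (degree (P m)) = of_real (top_deriv (P m))" "top_deriv (P m) \<noteq> 0"
    if "m \<in> {1..M0}" for m
  proof -
    have m: "m \<in> {1..M}" "star m = m" using that M_eq by (auto simp: star_def)
    have "q m (degree (P m)) = cnj (q m (degree (P m)))" using q_star[OF m(1), of "degree (P m)"] m(2) by simp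
    then have "Im (q m (degree (P m))) = 0" by (simp add: complex_eq_iff)
    then show eq: "q m (degree (P m)) = of_real (top_deriv (P m))"
      by (simp add: top_deriv_eq q_def[symmetric] complex_eq_iff)
    have "q m (degree (P m)) \<noteq> 0" using P_nonzero[OF m(1)] by (simp add: q_def)
    with eq show "top_deriv (P m) \<noteq> 0" by auto
  qed
  have N_real_half: "2 * N_real (P m) \<le> degree (P m) + 2" for m
    by (auto simp: N_real_def)
  have N_real_le: "N_real (P m) \<le> Suc (degree (P m))" for m
    by (auto simp: N_real_def)
  interpret hankel_count "{1..M}" star \<beta> P \<sigma>0 d J
  proof
    show "J \<subseteq> idx"
    proof
      fix i assume "i \<in> J"
      then obtain m a where i: "i = (m, a)" "m \<in> {1..M0+M1}" "a < n m" by (auto simp: J_def)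
      then have "m \<in> {1..M}" using M_eq by auto
      moreover have "a \<le> degree (P m)"
        using i(3) N_real_le[of m] P_degree[OF \<open>m \<in> {1..M}\<close>] by (auto simp: n_def split: if_splits)
      ultimately show "i \<in> idx" unfolding idx_def using i by simp
    qed
  next
    fix m a assume 1: "(m, a) \<in> J" and 2: "(star m, degree (P m) - a) \<in> J"
    have m: "m \<in> {1..M0}"
    proof (rule ccontr)
      assume "\<not> ?thesis"
      then have "star m = m + M1" "m > M0" using 1 by (auto simp: J_def star_def)
      then show False using 2 by (auto simp: J_def)
    qed
    then have sm: "star m = m" by (simp add: star_def)
    have less: "a < N_real (P m)" "degree (P m) - a < N_real (P m)" using 1 2 m sm by (auto simp: J_def n_def)
    \<comment> \<open>both \<open>a\<close> and \<open>K m - a\<close> lie below \<open>N_real (P m)\<close>, which forces the middle of the antidiagonal\<close>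
    then have "degree (P m) + 2 \<le> 2 * N_real (P m)" by linarith
    then have even: "even (degree (P m))" and neg: "\<not> top_deriv (P m) > 0"
      by (auto simp: N_real_def split: if_splits)
    have "degree (P m) - a = a" using less even neg by (auto simp: N_real_def)
    moreover have "q m (degree (P m)) = of_real (- cmod (q m (degree (P m))))"
      using q_real[OF m] neg by simp
    ultimately show "(star m, degree (P m) - a) = (m, a) \<and> q m (degree (P m)) = of_real (- cmod (q m (degree (P m))))"
      using sm by simp
  next
    fix i j assume i: "i \<in> idx - J" and j: "j \<in> idx - J" and "coupling i j \<noteq> 0"
    obtain m b where mb: "i = (m, b)" by force
    have j1: "fst j = star m" "b + snd j \<le> degree (P m)" and Bij: "coupling i j = q m (b + snd j)"
      using \<open>coupling i j \<noteq> 0\<close> mb by (auto simp: coupling_def split: if_splits)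
    have m: "m \<in> {1..M}" "b \<le> degree (P m)" using i mb unfolding idx_def by auto
    have real: "m \<in> {1..M0}"
    proof (rule ccontr)
      assume not_real: "\<not> ?thesis"
      show False
      proof (cases "m \<le> M0 + M1")
        case True
        then show False using i mb m not_real P_degree[OF m(1)] by (auto simp: J_def n_def)
      next
        case False
        then have "star m \<in> {M0+1..M0+M1}" using m M_eq by (auto simp: star_def)
        moreover have "star m \<in> {1..M}" using m star_in by blast
        moreover have "snd j \<le> degree (P (star m))" using j1 K_star[OF m(1)] by simp
        ultimately show False using j j1(1) P_degree[of "star m"] by (cases j) (auto simp: J_def n_def)
      qed
    qed
    then have sm: "star m = m" by (simp add: star_def)
    have ge: "N_real (P m) \<le> b" "N_real (P m) \<le> snd j"
      using i j mb j1(1) sm real by (cases j; auto simp: J_def n_def)+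
    have lt: "degree (P m) \<le> 2 * N_real (P m)" by (auto simp: N_real_def)
    then have eq: "b + snd j = degree (P m)" "2 * N_real (P m) = degree (P m)" using ge j1(2) by linarith+
    then have "even (degree (P m))" "top_deriv (P m) > 0"
      by (auto simp: N_real_def split: if_splits)
    moreover have "b = N_real (P m)" "snd j = N_real (P m)" using ge eq by linarith+
    then have "i = j" using mb j1(1) sm by (simp add: prod_eq_iff)
    ultimately show "i = j \<and> Re (coupling i j) \<ge> 0" using Bij eq q_real[OF real] by simp
  qed
  have "N_minus (perturbed_hankel \<sigma>0 v) = enat (card J)"
    by (rule N_minus_eq_card) (rule v_def)
  also have "card J = (\<Sum>m=1..M0+M1. n m)" unfolding J_def by (subst card_SigmaI) auto
  also have "\<dots> = (\<Sum>m=1..M0. n m) + (\<Sum>m=M0+1..M0+M1. n m)"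
    by (rule sum.ub_add_nat) simp
  also have "(\<Sum>m=1..M0. n m) = (\<Sum>m=1..M0. N_real (P m))" by (intro sum.cong) (auto simp: n_def)
  also have "(\<Sum>m=M0+1..M0+M1. n m) = (\<Sum>m=M0+1..M0+M1. K m) + M1"
    by (simp add: n_def sum_Suc)
  finally show ?thesis by (simp add: add.assoc)
qed

end
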